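(* Let $\mathcal{A}$ be a central hyperplane arrangement in $\mathbb{R}^d$ and $B$ a region of $\mathcal{A}$ such that the poset of regions $\mathcal{P}(\mathcal{A},B)$ is a lattice, and let $\mathcal{F}$ be the fan consisting of the regions of $\mathcal{A}$ and all their faces. Then for any lattice congruence $\Theta$ on $\mathcal{P}(\mathcal{A},B)$ there is a complete fan $\mathcal{F}_\Theta$, refined by $\mathcal{F}$, whose maximal cones are identified with the elements of the quotient lattice $\mathcal{P}(\mathcal{A},B)/\Theta$, with the following properties: (i) $(\mathcal{F}_\Theta,\mathcal{P}(\mathcal{A},B)/\Theta)$ is a fan lattice (a fan poset whose poset is a lattice). (ii) $(\mathcal{F}_\Theta,\mathcal{P}(\mathcal{A},B)/\Theta)$ is induced by any linear functional whose minimum on the unit sphere lies in the interior of $B$. (iii) Any linear extension of $\mathcal{P}(\mathcal{A},B)/\Theta$ is a shelling order on the facets of the associated sphere of $\mathcal{F}_\Theta$. (iv) If $\mathcal{A}$ is simplicial, then $(\mathcal{F}_\Theta,\mathcal{P}(\mathcal{A},B)/\Theta)$ is homotopy facial, atomic-facial, and bisimplicial with respect to any linear functional whose minimum on the unit sphere lies in the interior of $B$.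
   Context: A central hyperplane arrangement $\mathcal{A}$ in $\mathbb{R}^d$ is a finite set of linear hyperplanes; its regions are the closures of the connected components of $\mathbb{R}^d\setminus\bigcup\mathcal{A}$. A region is simplicial if the normals to its facets are linearly independent; $\mathcal{A}$ is simplicial if every region is. For a fixed region $B$, the separating set $S(R)$ of a region $R$ is the set of hyperplanes separating $R$ from $B$, and the poset of regions $\mathcal{P}(\mathcal{A},B)$ orders regions by $R_1\le R_2$ iff $S(R_1)\subseteq S(R_2)$. A lattice congruence on a finite lattice $L$ is an equivalence relation respecting joins and meets; its classes are intervals, and $L/\Theta$ is the set of classes ordered by $[a]\le[b]$ iff some $x\in[a]$, $y\in[b]$ have $x\le y$. A fan in $\mathbb{R}^d$ is a family of nonempty closed polyhedral cones closed under taking nonempty faces, in which any two cones intersect in a face of each; it is complete if its union is $\mathbb{R}^d$. A fan $\mathcal{F}'$ is refined by $\mathcal{F}$ if every cone of $\mathcal{F}'$ is a union of cones of $\mathcal{F}$. A fan poset $(\mathcal{F},P)$ is a complete fan $\mathcal{F}$ together with a partial order $P$ on its maximal cones such that (a) for every interval $I$ of $P$ the union of the cones in $I$ is a polyhedral cone, and (b) for every cone $C$ of $\mathcal{F}$, the set of maximal cones containing $C$ is an interval of $P$ (such intervals are called facial, associated to $C$). $(\mathcal{F},P)$ is homotopy facial if for every facial interval $[x,y]$ associated to a cone of dimension $k$ the order complex of the open interval $(x,y)$ is homotopy equivalent to a $(d-2-k)$-sphere, and for every non-facial interval $[x,y]$ the open interval $(x,y)$ is contractible (conventions: the complex containing only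 the empty face is a $(-1)$-sphere, the empty complex a $(-2)$-sphere). An interval is atomic if its top element is the join of its atoms; $(\mathcal{F},P)$ is atomic-facial if the facial intervals are exactly the atomic intervals. For a linear functional $b$, $(\mathcal{F},P)$ is induced by $b$ if for every cover $C_1\lessdot C_2$ in $P$, the unit normal $\nu$ to the hyperplane separating $C_1$ from $C_2$, oriented from $C_1$ to $C_2$, has $b(\nu)>0$. It is bisimplicial with respect to $b$ if it is induced by $b$ and for every maximal cone $C$, the set of outward unit facet normals $\nu$ of $C$ with $b(\nu)>0$ and the set of those with $b(\nu)<0$ are each linearly independent. The associated sphere of a complete fan $\mathcal{F}$ is the cellular decomposition of the unit sphere in $(\bigcap\mathcal{F})^\perp$ induced by intersecting the cones of $\mathcal{F}$ with $(\bigcap\mathcal{F})^\perp$; its facets correspond to maximal cones of $\mathcal{F}$. For a CW complex all of whose facets have dimension $d'$, a linear order $F_1,\dots,F_t$ of the facets is a shelling if $d'=0$, or $d'\ge1$ and: the boundary of $F_1$ has a shelling; for $2\le j\le t$, $F_j\cap\bigcup_{i<j}F_i$ is a pure complex of dimension $d'-1$; and for $2\le j\le t$ the boundary of $F_j$ has a shelling in which the $(d'-1)$-faces of $F_j\cap\bigcup_{i<j}F_i$ come first. *)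

theory Defs
  imports "HOL-Analysis.Analysis"
begin

definition poset_on :: "'b set \<Rightarrow> ('b \<Rightarrow> 'b \<Rightarrow> bool) \<Rightarrow> bool" where
  "poset_on X le \<longleftrightarrow> (\<forall>x\<in>X. le x x) \<and>
     (\<forall>x\<in>X. \<forall>y\<in>X. le x y \<and> le y x \<longrightarrow> x = y) \<and>
     (\<forall>x\<in>X. \<forall>y\<in>X. \<forall>z\<in>X. le x y \<and> le y z \<longrightarrow> le x z)"

definition is_lub :: "'b set \<Rightarrow> ('b \<Rightarrow> 'b \<Rightarrow> bool) \<Rightarrow> 'b set \<Rightarrow> 'b \<Rightarrow> bool" where
  "is_lub X le A u \<longleftrightarrow> u \<in> X \<and> (\<forall>a\<in>A. le a u) \<and> (\<forall>v\<in>X. (\<forall>a\<in>A. le a v) \<longrightarrow> le u v)"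

definition is_glb :: "'b set \<Rightarrow> ('b \<Rightarrow> 'b \<Rightarrow> bool) \<Rightarrow> 'b set \<Rightarrow> 'b \<Rightarrow> bool" where
  "is_glb X le A u \<longleftrightarrow> u \<in> X \<and> (\<forall>a\<in>A. le u a) \<and> (\<forall>v\<in>X. (\<forall>a\<in>A. le v a) \<longrightarrow> le v u)"

definition lattice_on :: "'b set \<Rightarrow> ('b \<Rightarrow> 'b \<Rightarrow> bool) \<Rightarrow> bool" where
  "lattice_on X le \<longleftrightarrow> poset_on X le \<and>
     (\<forall>x\<in>X. \<forall>y\<in>X. (\<exists>u. is_lub X le {x, y} u) \<and> (\<exists>u. is_glb X le {x, y} u))"

definition ljoin :: "'b set \<Rightarrow> ('b \<Rightarrow> 'b \<Rightarrow> bool) \<Rightarrow> 'b \<Rightarrow> 'b \<Rightarrow> 'b" where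
  "ljoin X le x y = (THE u. is_lub X le {x, y} u)"

definition lmeet :: "'b set \<Rightarrow> ('b \<Rightarrow> 'b \<Rightarrow> bool) \<Rightarrow> 'b \<Rightarrow> 'b \<Rightarrow> 'b" where
  "lmeet X le x y = (THE u. is_glb X le {x, y} u)"

definition lattice_congruence :: "'b set \<Rightarrow> ('b \<Rightarrow> 'b \<Rightarrow> bool) \<Rightarrow> ('b \<times> 'b) set \<Rightarrow> bool" where
  "lattice_congruence X le Th \<longleftrightarrow> equiv X Th \<and>
     (\<forall>x y z. (x, y) \<in> Th \<and> z \<in> X \<longrightarrow>
        (ljoin X le x z, ljoin X le y z) \<in> Th \<and> (lmeet X le x z, lmeet X le y z) \<in> Th)"

definition quot_le :: "('b \<Rightarrow> 'b \<Rightarrow> bool) \<Rightarrow> 'b set \<Rightarrow> 'b set \<Rightarrow> bool" where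
  "quot_le le c1 c2 \<longleftrightarrow> (\<exists>x\<in>c1. \<exists>y\<in>c2. le x y)"

definition interval :: "'b set \<Rightarrow> ('b \<Rightarrow> 'b \<Rightarrow> bool) \<Rightarrow> 'b \<Rightarrow> 'b \<Rightarrow> 'b set" where
  "interval M P x y = {z \<in> M. P x z \<and> P z y}"

definition open_interval :: "'b set \<Rightarrow> ('b \<Rightarrow> 'b \<Rightarrow> bool) \<Rightarrow> 'b \<Rightarrow> 'b \<Rightarrow> 'b set" where
  "open_interval M P x y = {z \<in> M. P x z \<and> P z y \<and> z \<noteq> x \<and> z \<noteq> y}"

definition covers :: "'b set \<Rightarrow> ('b \<Rightarrow> 'b \<Rightarrow> bool) \<Rightarrow> 'b \<Rightarrow> 'b \<Rightarrow> bool" where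
  "covers M P x y \<longleftrightarrow> x \<in> M \<and> y \<in> M \<and> P x y \<and> x \<noteq> y \<and> open_interval M P x y = {}"

definition linear_extension :: "'b set \<Rightarrow> ('b \<Rightarrow> 'b \<Rightarrow> bool) \<Rightarrow> 'b list \<Rightarrow> bool" where
  "linear_extension M P L \<longleftrightarrow> distinct L \<and> set L = M \<and>
     (\<forall>i<length L. \<forall>j<length L. P (L ! i) (L ! j) \<longrightarrow> i \<le> j)"

text \<open>Geometric realization of the order complex of a finite subposet S: probability
  vectors supported on S whose support is a chain, with the product topology.\<close>
definition order_complex_space :: "('b \<Rightarrow> 'b \<Rightarrow> bool) \<Rightarrow> 'b set \<Rightarrow> ('b \<Rightarrow> real) topology" where
  "order_complex_space P S = subtopology (powertop_real UNIV)
     {p. (\<forall>z. 0 \<le> p z) \<and> (\<forall>z. z \<notin> S \<longrightarrow> p z = 0) \<and> sum p S = 1 \<and>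
         (\<forall>u\<in>S. \<forall>v\<in>S. 0 < p u \<and> 0 < p v \<longrightarrow> P u v \<or> P v u)}"

text \<open>The order complex of the open interval (x,y) is homotopy equivalent to an s-sphere,
  with the conventions: (-1)-sphere = complex with only the empty face (x < y, (x,y) empty),
  (-2)-sphere = empty complex (the case x = y).\<close>
definition open_interval_sphere :: "'b set \<Rightarrow> ('b \<Rightarrow> 'b \<Rightarrow> bool) \<Rightarrow> 'b \<Rightarrow> 'b \<Rightarrow> int \<Rightarrow> bool" where
  "open_interval_sphere M P x y s \<longleftrightarrow>
     (if s = -2 then x = y
      else if s = -1 then x \<noteq> y \<and> open_interval M P x y = {}
      else 0 \<le> s \<and> x \<noteq> y \<and>
        (order_complex_space P (open_interval M P x y)) homotopy_equivalent_space (nsphere (nat s)))"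

definition open_interval_contractible :: "'b set \<Rightarrow> ('b \<Rightarrow> 'b \<Rightarrow> bool) \<Rightarrow> 'b \<Rightarrow> 'b \<Rightarrow> bool" where
  "open_interval_contractible M P x y \<longleftrightarrow> x \<noteq> y \<and> open_interval M P x y \<noteq> {} \<and>
     contractible_space (order_complex_space P (open_interval M P x y))"

definition central_arrangement :: "'a::euclidean_space set set \<Rightarrow> bool" where
  "central_arrangement A \<longleftrightarrow> finite A \<and> (\<forall>H\<in>A. \<exists>a. a \<noteq> 0 \<and> H = {x. a \<bullet> x = 0})"

definition regions :: "'a::euclidean_space set set \<Rightarrow> 'a set set" where
  "regions A = closure ` components (- \<Union>A)"

definition sep_set :: "'a::euclidean_space set set \<Rightarrow> 'a set \<Rightarrow> 'a set \<Rightarrow> 'a set set" where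
  "sep_set A B R = {H \<in> A. \<exists>a. H = {x. a \<bullet> x = 0} \<and> R \<subseteq> {x. a \<bullet> x \<le> 0} \<and> B \<subseteq> {x. 0 \<le> a \<bullet> x}}"

definition region_le :: "'a::euclidean_space set set \<Rightarrow> 'a set \<Rightarrow> 'a set \<Rightarrow> 'a set \<Rightarrow> bool" where
  "region_le A B R1 R2 \<longleftrightarrow> sep_set A B R1 \<subseteq> sep_set A B R2"

definition cone_facets :: "'a::euclidean_space set \<Rightarrow> 'a set set" where
  "cone_facets C = {G. G face_of C \<and> aff_dim G = aff_dim C - 1}"

definition outward_facet_normals :: "'a::euclidean_space set \<Rightarrow> 'a set" where
  "outward_facet_normals C = {\<nu>. norm \<nu> = 1 \<and> (\<exists>G\<in>cone_facets C.
      C \<subseteq> {x. \<nu> \<bullet> x \<le> 0} \<and> G \<subseteq> {x. \<nu> \<bullet> x = 0})}"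

definition simplicial_arrangement :: "'a::euclidean_space set set \<Rightarrow> bool" where
  "simplicial_arrangement A \<longleftrightarrow> (\<forall>R\<in>regions A. independent (outward_facet_normals R))"

definition fan :: "'a::euclidean_space set set \<Rightarrow> bool" where
  "fan F \<longleftrightarrow> (\<forall>C\<in>F. C \<noteq> {} \<and> closed C \<and> polyhedron C \<and> cone C) \<and>
     (\<forall>C\<in>F. \<forall>G. G face_of C \<and> G \<noteq> {} \<longrightarrow> G \<in> F) \<and>
     (\<forall>C\<in>F. \<forall>D\<in>F. (C \<inter> D) face_of C \<and> (C \<inter> D) face_of D)"

definition complete_fan :: "'a::euclidean_space set set \<Rightarrow> bool" where
  "complete_fan F \<longleftrightarrow> fan F \<and> \<Union>F = UNIV"

definition refined_by :: "'a::euclidean_space set set \<Rightarrow> 'a set set \<Rightarrow> bool" where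
  "refined_by F' F \<longleftrightarrow> (\<forall>C\<in>F'. \<exists>S\<subseteq>F. C = \<Union>S)"

definition arrangement_fan :: "'a::euclidean_space set set \<Rightarrow> 'a set set" where
  "arrangement_fan A = {G. \<exists>R\<in>regions A. G face_of R \<and> G \<noteq> {}}"

definition max_cones :: "'a::euclidean_space set set \<Rightarrow> 'a set set" where
  "max_cones F = {C \<in> F. \<forall>D\<in>F. C \<subseteq> D \<longrightarrow> D = C}"

definition fan_poset :: "'a::euclidean_space set set \<Rightarrow> ('a set \<Rightarrow> 'a set \<Rightarrow> bool) \<Rightarrow> bool" where
  "fan_poset F P \<longleftrightarrow> complete_fan F \<and> poset_on (max_cones F) P \<and>
     (\<forall>x\<in>max_cones F. \<forall>y\<in>max_cones F. P x y \<longrightarrow>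
        polyhedron (\<Union>(interval (max_cones F) P x y)) \<and> cone (\<Union>(interval (max_cones F) P x y))) \<and>
     (\<forall>C\<in>F. \<exists>x\<in>max_cones F. \<exists>y\<in>max_cones F. P x y \<and>
        {D \<in> max_cones F. C \<subseteq> D} = interval (max_cones F) P x y)"

definition fan_lattice :: "'a::euclidean_space set set \<Rightarrow> ('a set \<Rightarrow> 'a set \<Rightarrow> bool) \<Rightarrow> bool" where
  "fan_lattice F P \<longleftrightarrow> fan_poset F P \<and> lattice_on (max_cones F) P"

definition facial_interval :: "'a::euclidean_space set set \<Rightarrow> ('a set \<Rightarrow> 'a set \<Rightarrow> bool) \<Rightarrow> 'a set \<Rightarrow> 'a set \<Rightarrow> bool" where
  "facial_interval F P x y \<longleftrightarrow> x \<in> max_cones F \<and> y \<in> max_cones F \<and> P x y \<and>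
     (\<exists>C\<in>F. {D \<in> max_cones F. C \<subseteq> D} = interval (max_cones F) P x y)"

definition homotopy_facial :: "'a::euclidean_space set set \<Rightarrow> ('a set \<Rightarrow> 'a set \<Rightarrow> bool) \<Rightarrow> bool" where
  "homotopy_facial F P \<longleftrightarrow>
     (\<forall>x\<in>max_cones F. \<forall>y\<in>max_cones F. P x y \<longrightarrow>
        (\<forall>C\<in>F. {D \<in> max_cones F. C \<subseteq> D} = interval (max_cones F) P x y \<longrightarrow>
           open_interval_sphere (max_cones F) P x y (int DIM('a) - 2 - aff_dim C)) \<and>
        (\<not> facial_interval F P x y \<longrightarrow> open_interval_contractible (max_cones F) P x y))"

text \<open>[x,y] is atomic iff y is the join (within [x,y]) of the atoms of [x,y]
  (for x = y there are no atoms and the empty join is x).\<close>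
definition atomic_interval :: "'b set \<Rightarrow> ('b \<Rightarrow> 'b \<Rightarrow> bool) \<Rightarrow> 'b \<Rightarrow> 'b \<Rightarrow> bool" where
  "atomic_interval M P x y \<longleftrightarrow> x \<in> M \<and> y \<in> M \<and> P x y \<and>
     is_lub (interval M P x y) P {z \<in> interval M P x y. covers M P x z} y"

definition atomic_facial :: "'a::euclidean_space set set \<Rightarrow> ('a set \<Rightarrow> 'a set \<Rightarrow> bool) \<Rightarrow> bool" where
  "atomic_facial F P \<longleftrightarrow> (\<forall>x\<in>max_cones F. \<forall>y\<in>max_cones F. P x y \<longrightarrow>
     (facial_interval F P x y \<longleftrightarrow> atomic_interval (max_cones F) P x y))"

definition induced_by :: "'a::euclidean_space set set \<Rightarrow> ('a set \<Rightarrow> 'a set \<Rightarrow> bool) \<Rightarrow> ('a \<Rightarrow> real) \<Rightarrow> bool" where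
  "induced_by F P b \<longleftrightarrow> (\<forall>C1 C2. covers (max_cones F) P C1 C2 \<longrightarrow>
     (\<forall>\<nu>. norm \<nu> = 1 \<and> C1 \<subseteq> {x. \<nu> \<bullet> x \<le> 0} \<and> C2 \<subseteq> {x. 0 \<le> \<nu> \<bullet> x} \<longrightarrow> 0 < b \<nu>))"

definition bisimplicial :: "'a::euclidean_space set set \<Rightarrow> ('a set \<Rightarrow> 'a set \<Rightarrow> bool) \<Rightarrow> ('a \<Rightarrow> real) \<Rightarrow> bool" where
  "bisimplicial F P b \<longleftrightarrow> induced_by F P b \<and>
     (\<forall>C\<in>max_cones F. independent {\<nu> \<in> outward_facet_normals C. 0 < b \<nu>} \<and>
                       independent {\<nu> \<in> outward_facet_normals C. b \<nu> < 0})"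

definition min_in_interior :: "'a::euclidean_space set \<Rightarrow> ('a \<Rightarrow> real) \<Rightarrow> bool" where
  "min_in_interior B b \<longleftrightarrow> linear b \<and>
     {x \<in> sphere 0 1. \<forall>y\<in>sphere 0 1. b x \<le> b y} \<subseteq> interior B"

text \<open>Cells of the associated sphere are represented by the corresponding cones (which all
  contain the lineality space); a cone of dimension e gives a cell of dimension
  e - dim(lineality) - 1; (d'-1)-faces of a d'-cell are the facets of the cone.
  @shell k Fs@: the list Fs of k-cells is a shelling.\<close>
primrec shell :: "nat \<Rightarrow> 'a::euclidean_space set list \<Rightarrow> bool" where
  "shell 0 Fs = True"
| "shell (Suc k) Fs =
     ((Fs \<noteq> [] \<longrightarrow> (\<exists>Gs. distinct Gs \<and> set Gs = cone_facets (hd Fs) \<and> shell k Gs)) \<and>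
      (\<forall>j. 0 < j \<and> j < length Fs \<longrightarrow>
         (let U = \<Union>(set (take j Fs)); I = {G \<in> cone_facets (Fs ! j). G \<subseteq> U} in
          I \<noteq> {} \<and> Fs ! j \<inter> U = \<Union>I \<and>
          (\<exists>Gs. distinct Gs \<and> set Gs = cone_facets (Fs ! j) \<and> shell k Gs \<and>
                set (take (card I) Gs) = I))))"

definition sphere_dim :: "'a::euclidean_space set set \<Rightarrow> nat" where
  "sphere_dim F = nat (int DIM('a) - aff_dim (\<Inter>F) - 1)"

end

(*
A region is determined by the set of hyperplanes separating it from B, and the union of an interval
of regions is the cone cut out by the hyperplanes on which the interval is constant. So the classes
of Theta, which are intervals, have convex unions, and these unions are the maximal cones of the fan.

Two unions C, C' meet in a common face because of a local statement at each p in both of them: C and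
C' have the same lineality space at p. Indeed, let m be the lowest region containing p, and m1, m2 the
lowest regions containing p + eps v and p - eps v. If the direction v is linear for one class at p,
meeting its regions on both sides with m1 and m2 shows that m, m1, m2 are congruent, and joining with
regions of any other class at p then shows that v is linear for that class as well. The classes
containing p form the interval from the class of the lowest to the class of the highest region
containing p.

A linear extension shells because the earlier facets of a cone C are exactly those seen from
C in the direction of B; a line shelling of the boundary of C can start with the seen facets.

The upper walls of a cone of the fan are the upper walls of the top region R of its class, and the upper
covers of the class correspond to them. If R is simplicial, every set S of upper walls cuts out a face
of R, whose star is the interval from the class to the join of the covers in S, and distinct sets give
distinct joins. So the facial intervals are the atomic ones, and retracting an open interval onto the
joins of atoms leaves the proper part of a Boolean lattice, a sphere, or a cone.
*)
theory Submission
  imports Defs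
begin

section \<open>Quotients of finite lattices\<close>

text \<open>That the classes span convex cones does not make these cones meet face to face: two
  neighbours could share only a part of a wall. The congruence speaks about this only near a point,
  so the face property is first proved infinitesimally, for the directions along which a cone is
  straight at \<open>p\<close>, and then spread along segments by stopping at the last point that
  still lies in the other cone. Everything about lower walls follows from upper walls by reversing
  the order and negating all normals. The shelling needs visibility on two levels, for the cones of
  the fan and for the faces of a single cone. It is therefore expressed by points leaving a cone: in
  the fan this is decided by the lowest class at the point, in a single cone by the signs of its
  facet normals.\<close>

lemma is_lub_unique:
  assumes "poset_on X le" "is_lub X le A u" "is_lub X le A v"
  shows "u = v"
  using assms unfolding poset_on_def is_lub_def by blast

lemma poset_on_dual: "poset_on X (\<lambda>x y. le y x) \<longleftrightarrow> poset_on X le"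
  unfolding poset_on_def by blast

lemma is_lub_dual: "is_lub X (\<lambda>x y. le y x) = is_glb X le"
  by (intro ext) (simp add: is_lub_def is_glb_def)

lemma is_glb_dual: "is_glb X (\<lambda>x y. le y x) = is_lub X le"
  by (intro ext) (simp add: is_lub_def is_glb_def)

lemma lattice_on_dual: "lattice_on X (\<lambda>x y. le y x) \<longleftrightarrow> lattice_on X le"
  unfolding lattice_on_def is_lub_dual[of X le] is_glb_dual[of X le] poset_on_dual[of X le] by blast

lemma ljoin_dual: "ljoin X (\<lambda>x y. le y x) = lmeet X le"
  by (intro ext) (simp only: ljoin_def lmeet_def is_lub_dual[of X le])

lemma lmeet_dual: "lmeet X (\<lambda>x y. le y x) = ljoin X le"
  by (intro ext) (simp only: ljoin_def lmeet_def is_glb_dual[of X le])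

text \<open>A congruence is given by a map \<open>k\<close> whose kernel it is, so that the image of \<open>k\<close> can be
  either the set of classes or the set of the cones they span.\<close>

locale lattice_quotient =
  fixes X :: "'b set" and le :: "'b \<Rightarrow> 'b \<Rightarrow> bool" and k :: "'b \<Rightarrow> 'c" and P :: "'c \<Rightarrow> 'c \<Rightarrow> bool"
  assumes fin: "finite X" and lat: "lattice_on X le"
    and join_cong: "\<lbrakk>x \<in> X; y \<in> X; z \<in> X; k x = k y\<rbrakk> \<Longrightarrow> k (ljoin X le x z) = k (ljoin X le y z)"
    and meet_cong: "\<lbrakk>x \<in> X; y \<in> X; z \<in> X; k x = k y\<rbrakk> \<Longrightarrow> k (lmeet X le x z) = k (lmeet X le y z)"
    and P_eq: "\<lbrakk>x \<in> X; y \<in> X\<rbrakk> \<Longrightarrow>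
      P (k x) (k y) \<longleftrightarrow> (\<exists>x'\<in>X. \<exists>y'\<in>X. k x' = k x \<and> k y' = k y \<and> le x' y')"
begin

abbreviation "jn \<equiv> ljoin X le"
abbreviation "mt \<equiv> lmeet X le"

definition "M = k ` X"

text \<open>Reversing both orders exchanges the two congruence conditions. Meets, bottoms of classes
  and later the lower walls are read off from this instance.\<close>

lemma dual: "lattice_quotient X (\<lambda>x y. le y x) k (\<lambda>x y. P y x)"
proof unfold_locales
  show "P (k y) (k x) \<longleftrightarrow> (\<exists>x'\<in>X. \<exists>y'\<in>X. k x' = k x \<and> k y' = k y \<and> le y' x')"
    if "x \<in> X" "y \<in> X" for x y
    using P_eq[OF that(2,1)] by blast
qed (unfold lattice_on_dual[of X le] ljoin_dual[of X le] lmeet_dual[of X le], (fact fin lat join_cong meet_cong)+)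

lemma po: "poset_on X le"
  using lat unfolding lattice_on_def by blast

lemma le_refl: "x \<in> X \<Longrightarrow> le x x"
  using po unfolding poset_on_def by blast

lemma le_antisym: "\<lbrakk>x \<in> X; y \<in> X; le x y; le y x\<rbrakk> \<Longrightarrow> x = y"
  using po unfolding poset_on_def by blast

lemma le_trans: "\<lbrakk>x \<in> X; y \<in> X; z \<in> X; le x y; le y z\<rbrakk> \<Longrightarrow> le x z"
  using po unfolding poset_on_def by blast

lemma jn_lub:
  assumes "x \<in> X" "y \<in> X"
  shows "is_lub X le {x, y} (jn x y)"
proof -
  obtain u where u: "is_lub X le {x, y} u"
    using lat assms unfolding lattice_on_def by blast
  then show ?thesis
    unfolding ljoin_def using is_lub_unique[OF po] by (metis (mono_tags, lifting) theI')
qed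

lemma mt_glb:
  assumes "x \<in> X" "y \<in> X"
  shows "is_glb X le {x, y} (mt x y)"
proof -
  interpret d: lattice_quotient X "\<lambda>x y. le y x" k "\<lambda>x y. P y x" by (rule dual)
  show ?thesis using d.jn_lub[OF assms] by (simp only: is_lub_dual[of X le] ljoin_dual[of X le])
qed

lemma jn_in [simp]: "\<lbrakk>x \<in> X; y \<in> X\<rbrakk> \<Longrightarrow> jn x y \<in> X"
  and jn_ub1: "\<lbrakk>x \<in> X; y \<in> X\<rbrakk> \<Longrightarrow> le x (jn x y)"
  and jn_ub2: "\<lbrakk>x \<in> X; y \<in> X\<rbrakk> \<Longrightarrow> le y (jn x y)"
  and jn_least: "\<lbrakk>x \<in> X; y \<in> X; z \<in> X; le x z; le y z\<rbrakk> \<Longrightarrow> le (jn x y) z"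
  using jn_lub unfolding is_lub_def by blast+

lemma mt_in [simp]: "\<lbrakk>x \<in> X; y \<in> X\<rbrakk> \<Longrightarrow> mt x y \<in> X"
  and mt_lb1: "\<lbrakk>x \<in> X; y \<in> X\<rbrakk> \<Longrightarrow> le (mt x y) x"
  and mt_lb2: "\<lbrakk>x \<in> X; y \<in> X\<rbrakk> \<Longrightarrow> le (mt x y) y"
  and mt_greatest: "\<lbrakk>x \<in> X; y \<in> X; z \<in> X; le z x; le z y\<rbrakk> \<Longrightarrow> le z (mt x y)"
  using mt_glb unfolding is_glb_def by blast+

lemma jn_comm: "\<lbrakk>x \<in> X; y \<in> X\<rbrakk> \<Longrightarrow> jn x y = jn y x"
  by (simp add: ljoin_def insert_commute)

lemma jn_absorb: "\<lbrakk>x \<in> X; y \<in> X; le x y\<rbrakk> \<Longrightarrow> jn x y = y"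
  by (meson jn_in jn_least jn_ub2 le_antisym le_refl)

lemma mt_absorb: "\<lbrakk>x \<in> X; y \<in> X; le x y\<rbrakk> \<Longrightarrow> mt x y = x"
  by (meson mt_in mt_greatest mt_lb1 le_antisym le_refl)

lemma mt_absorb2: "\<lbrakk>x \<in> X; y \<in> X; le y x\<rbrakk> \<Longrightarrow> mt x y = y"
  by (meson mt_in mt_greatest mt_lb2 le_antisym le_refl)

lemma jn_cong2:
  "\<lbrakk>x \<in> X; x' \<in> X; y \<in> X; y' \<in> X; k x = k x'; k y = k y'\<rbrakk> \<Longrightarrow> k (jn x y) = k (jn x' y')"
  by (metis join_cong jn_comm)

text \<open>Joins of congruent elements are congruent, so the comparable representatives that
  witness \<open>P\<close> can be exchanged for any others at the cost of a congruence.\<close>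

lemma P_jn:
  assumes "x \<in> X" "y \<in> X"
  shows "P (k x) (k y) \<longleftrightarrow> k (jn x y) = k y"
proof
  assume "P (k x) (k y)"
  then obtain x' y' where h: "x' \<in> X" "y' \<in> X" "k x' = k x" "k y' = k y" "le x' y'"
    using P_eq assms by blast
  then have "k (jn x y) = k (jn x' y')"
    using jn_cong2[of x x' y y'] assms by simp
  then show "k (jn x y) = k y" using h jn_absorb by simp
next
  assume "k (jn x y) = k y"
  then show "P (k x) (k y)"
    using P_eq[OF assms] assms jn_ub1[OF assms] jn_in[OF assms] by blast
qed

text \<open>Meeting the congruent pair \<open>x\<close>, \<open>z\<close> with \<open>y\<close>
  gives \<open>x\<close> and \<open>y\<close>: classes are convex.\<close>

lemma k_between:
  assumes "x \<in> X" "y \<in> X" "z \<in> X" "le x y" "le y z" "k x = k z"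
  shows "k y = k x"
proof -
  have "k (mt x y) = k (mt z y)" using assms meet_cong by blast
  then show ?thesis using assms mt_absorb mt_absorb2 by simp
qed

lemma k_in_M [simp]: "x \<in> X \<Longrightarrow> k x \<in> M"
  by (simp add: M_def)

lemma P_mono: "\<lbrakk>x \<in> X; y \<in> X; le x y\<rbrakk> \<Longrightarrow> P (k x) (k y)"
  using P_eq by blast

text \<open>The join of all members stays in the class. Whatever is below the class in the quotient
  joins into the class and hence lies below this top in the lattice itself, which turns
  \<open>P\<close> into \<open>le\<close> between tops.\<close>

lemma ex_top:
  assumes "C \<in> M"
  shows "\<exists>t\<in>X. k t = C \<and> (\<forall>z\<in>X. P (k z) C \<longrightarrow> le z t)"
proof -
  obtain x where x: "x \<in> X" "k x = C" using assms by (auto simp: M_def)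
  have "\<exists>t\<in>X. k t = C \<and> (\<forall>z\<in>S. le z t)" if "finite S" "S \<subseteq> {z \<in> X. k z = C}" for S
    using that
  proof (induction S rule: finite_induct)
    case empty then show ?case using x by auto
  next
    case (insert a S)
    then obtain t where t: "t \<in> X" "k t = C" "\<forall>z\<in>S. le z t" by auto
    have a: "a \<in> X" "k a = C" and SX: "\<forall>z\<in>S. z \<in> X" using insert by auto
    have "k (jn a t) = k (jn t t)" using a t join_cong[of a t t] by simp
    then have "k (jn a t) = C" using t jn_absorb le_refl by simp
    moreover have "\<forall>z\<in>insert a S. le z (jn a t)"
      using a t SX jn_ub1[of a t] jn_ub2[of a t] le_trans[of _ t "jn a t"] by auto
    ultimately show ?case using a t jn_in by blast
  qed
  from this[of "{z \<in> X. k z = C}"] obtain t where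
    t: "t \<in> X" "k t = C" "\<forall>z\<in>X. k z = C \<longrightarrow> le z t" using fin by auto
  have "le z t" if z: "z \<in> X" "P (k z) C" for z
  proof -
    have "k (jn z t) = C" using z t P_jn by auto
    then have "le (jn z t) t" using t z by simp
    then show ?thesis using z t jn_ub1[of z t] le_trans[of z "jn z t" t] by simp
  qed
  then show ?thesis using t by blast
qed

definition "tp C = (SOME t. t \<in> X \<and> k t = C \<and> (\<forall>z\<in>X. P (k z) C \<longrightarrow> le z t))"
definition "bt C = (SOME t. t \<in> X \<and> k t = C \<and> (\<forall>z\<in>X. P C (k z) \<longrightarrow> le t z))"

lemma tp:
  assumes "C \<in> M"
  shows "tp C \<in> X" "k (tp C) = C" "\<And>z. z \<in> X \<Longrightarrow> P (k z) C \<longleftrightarrow> le z (tp C)"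
proof -
  have *: "tp C \<in> X \<and> k (tp C) = C \<and> (\<forall>z\<in>X. P (k z) C \<longrightarrow> le z (tp C))"
    unfolding tp_def by (rule someI_ex) (use ex_top[OF assms] in blast)
  then show "tp C \<in> X" "k (tp C) = C" by auto
  show "P (k z) C \<longleftrightarrow> le z (tp C)" if "z \<in> X" for z
    using * that P_mono[of z "tp C"] by auto
qed

lemma bt:
  assumes "C \<in> M"
  shows "bt C \<in> X" "k (bt C) = C" "\<And>z. z \<in> X \<Longrightarrow> P C (k z) \<longleftrightarrow> le (bt C) z"
proof -
  interpret d: lattice_quotient X "\<lambda>x y. le y x" k "\<lambda>x y. P y x" by (rule dual)
  have "d.tp C = bt C" by (simp add: bt_def d.tp_def)
  then show "bt C \<in> X" "k (bt C) = C" "\<And>z. z \<in> X \<Longrightarrow> P C (k z) \<longleftrightarrow> le (bt C) z"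
    using d.tp[OF assms] by auto
qed

lemma P_mt: "\<lbrakk>x \<in> X; y \<in> X\<rbrakk> \<Longrightarrow> P (k x) (k y) \<longleftrightarrow> k (mt y x) = k x"
proof -
  assume xy: "x \<in> X" "y \<in> X"
  interpret d: lattice_quotient X "\<lambda>x y. le y x" k "\<lambda>x y. P y x" by (rule dual)
  show ?thesis using d.P_jn[OF xy(2,1)] unfolding ljoin_dual[of X le] .
qed

lemma M_cases: "C \<in> M \<Longrightarrow> (\<And>x. x \<in> X \<Longrightarrow> C = k x \<Longrightarrow> thesis) \<Longrightarrow> thesis"
  by (auto simp: M_def)

lemma P_tp: "\<lbrakk>C \<in> M; C' \<in> M\<rbrakk> \<Longrightarrow> P C C' \<longleftrightarrow> le (tp C) (tp C')"
  using tp(3)[of C' "tp C"] tp(1,2)[of C] by simp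

lemma P_refl: "C \<in> M \<Longrightarrow> P C C"
  by (simp add: P_tp le_refl tp)

lemma P_antisym: "\<lbrakk>C \<in> M; C' \<in> M; P C C'; P C' C\<rbrakk> \<Longrightarrow> C = C'"
proof -
  assume C: "C \<in> M" "C' \<in> M" and "P C C'" "P C' C"
  then have "tp C = tp C'" using P_tp[OF C] P_tp[OF C(2,1)] le_antisym tp(1) by blast
  then show ?thesis using tp(2)[OF C(1)] tp(2)[OF C(2)] by metis
qed

lemma P_trans: "\<lbrakk>C \<in> M; C' \<in> M; C'' \<in> M; P C C'; P C' C''\<rbrakk> \<Longrightarrow> P C C''"
proof -
  assume C: "C \<in> M" "C' \<in> M" "C'' \<in> M" and P: "P C C'" "P C' C''"
  have "le (tp C) (tp C')" "le (tp C') (tp C'')" using P P_tp[OF C(1,2)] P_tp[OF C(2,3)] by blast+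
  then show ?thesis
    using le_trans[OF tp(1)[OF C(1)] tp(1)[OF C(2)] tp(1)[OF C(3)]] P_tp[OF C(1,3)] by blast
qed

lemma bt_le: "x \<in> X \<Longrightarrow> le (bt (k x)) x"
  using bt(3)[of "k x" x] P_refl[of "k x"] by simp

lemma k_eq_iff: "\<lbrakk>C \<in> M; x \<in> X\<rbrakk> \<Longrightarrow> k x = C \<longleftrightarrow> le (bt C) x \<and> le x (tp C)"
proof -
  assume C: "C \<in> M" and x: "x \<in> X"
  have "k x = C \<longleftrightarrow> P C (k x) \<and> P (k x) C"
    using P_antisym[of C "k x"] P_refl[of C] C x by auto
  then show ?thesis using tp(3)[OF C x] bt(3)[OF C x] by simp
qed

lemma poset_M: "poset_on M P"
  unfolding poset_on_def
proof (intro conjI ballI impI; (elim conjE)?)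
  show "P C C" if "C \<in> M" for C using that by (rule P_refl)
  show "C = C'" if "C \<in> M" "C' \<in> M" "P C C'" "P C' C" for C C'
    using that by (rule P_antisym)
  show "P C C''" if "C \<in> M" "C' \<in> M" "C'' \<in> M" "P C C'" "P C' C''" for C C' C''
    using that by (rule P_trans)
qed

lemma finite_M: "finite M"
  using fin by (simp add: M_def)

lemma k_jn_lub:
  assumes "x \<in> X" "y \<in> X"
  shows "is_lub M P {k x, k y} (k (jn x y))"
  unfolding is_lub_def
proof (intro conjI ballI impI)
  show "k (jn x y) \<in> M" using assms by simp
  have "P (k x) (k (jn x y))" "P (k y) (k (jn x y))"
    using assms by (simp_all add: P_mono jn_ub1 jn_ub2)
  then show "P a (k (jn x y))" if "a \<in> {k x, k y}" for a
    using that by blast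
  show "P (k (jn x y)) C" if C: "C \<in> M" "\<forall>a\<in>{k x, k y}. P a C" for C
  proof -
    have "le x (tp C)" "le y (tp C)" using C tp(3)[OF C(1)] assms by simp_all
    then have "le (jn x y) (tp C)" using assms jn_least tp(1)[OF C(1)] by simp
    then show ?thesis using tp(3)[OF C(1)] assms by simp
  qed
qed

lemma lattice_M: "lattice_on M P"
proof -
  interpret d: lattice_quotient X "\<lambda>x y. le y x" k "\<lambda>x y. P y x" by (rule dual)
  have "\<exists>u. is_lub M P {C, C'} u" "\<exists>u. is_glb M P {C, C'} u" if C: "C \<in> M" "C' \<in> M" for C C'
  proof -
    obtain x y where xy: "x \<in> X" "y \<in> X" "C = k x" "C' = k y" using C by (auto simp: M_def)
    show "\<exists>u. is_lub M P {C, C'} u"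
      using k_jn_lub[OF xy(1,2)] xy(3,4) by blast
    show "\<exists>u. is_glb M P {C, C'} u"
      using d.k_jn_lub[OF xy(1,2)] xy(3,4) unfolding is_lub_dual[of M P] by blast
  qed
  then show ?thesis unfolding lattice_on_def using poset_M by blast
qed

text \<open>Clamping \<open>bt C\<close> to the interval, by joining with \<open>a\<close> and then
  meeting with \<open>b\<close>, does not leave the class: the class of \<open>a\<close> is below
  \<open>C\<close>, and \<open>bt C\<close> is below \<open>b\<close>. This identifies the classes
  met by an interval of regions.\<close>

lemma interval_lift:
  assumes "a \<in> X" "b \<in> X" "le a b" "C \<in> M"
  shows "P (k a) C \<and> P C (k b) \<longleftrightarrow> (\<exists>z\<in>X. k z = C \<and> le a z \<and> le z b)"
proof
  assume L: "P (k a) C \<and> P C (k b)"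
  let ?z = "mt (jn a (bt C)) b"
  have B: "bt C \<in> X" "k (bt C) = C" using bt[OF assms(4)] by auto
  have 1: "k (jn a (bt C)) = C" using L P_jn[of a "bt C"] assms B by auto
  have "k ?z = k (mt (bt C) b)" using 1 B assms meet_cong[of "jn a (bt C)" "bt C" b] by simp
  also have "\<dots> = C" using L B assms bt(3)[OF assms(4)] mt_absorb[of "bt C" b] by simp
  finally have "k ?z = C" .
  moreover have "le a ?z" using assms B mt_greatest jn_ub1 by auto
  moreover have "?z \<in> X" "le ?z b" using assms B mt_lb2 by simp_all
  ultimately show "\<exists>z\<in>X. k z = C \<and> le a z \<and> le z b" by blast
next
  assume "\<exists>z\<in>X. k z = C \<and> le a z \<and> le z b"
  then obtain z where "z \<in> X" "k z = C" "le a z" "le z b" by blast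
  then show "P (k a) C \<and> P C (k b)" using P_mono[of a z] P_mono[of z b] assms by auto
qed

end

section \<open>Homotopy type of order complexes\<close>

definition proper_subsets :: "'i set \<Rightarrow> 'i set set" where
  "proper_subsets I = {A. A \<noteq> {} \<and> A \<subset> I}"

text \<open>Positive only on superlevel sets of \<open>s\<close>, where it is the length of the
  range of thresholds that cut out \<open>A\<close>.\<close>

definition level_weight :: "'i set \<Rightarrow> ('i \<Rightarrow> real) \<Rightarrow> 'i set \<Rightarrow> real" where
  "level_weight I s A = max 0 (Min (s ` A) - Max (s ` (I - A)))"

lemma finite_proper_subsets: "finite I \<Longrightarrow> finite (proper_subsets I)"
  unfolding proper_subsets_def by (rule finite_subset[of _ "Pow I"]) auto

lemma level_weight_nonneg: "0 \<le> level_weight I s A"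
  by (simp add: level_weight_def)

lemma level_weight_pos:
  assumes "finite I" "A \<in> proper_subsets I"
  shows "0 < level_weight I s A \<longleftrightarrow> (\<forall>i\<in>A. \<forall>j\<in>I - A. s j < s i)"
proof -
  have f: "finite A" "A \<noteq> {}" "finite (I - A)" "I - A \<noteq> {}"
    using assms finite_subset by (auto simp: proper_subsets_def)
  have "0 < level_weight I s A \<longleftrightarrow> Max (s ` (I - A)) < Min (s ` A)"
    by (auto simp: level_weight_def)
  also have "\<dots> \<longleftrightarrow> (\<forall>i\<in>A. \<forall>j\<in>I - A. s j < s i)"
    using f by (simp add: Min_gr_iff Max_less_iff)
  finally show ?thesis .
qed

lemma level_weight_chain:
  assumes "finite I" "A \<in> proper_subsets I" "B \<in> proper_subsets I"
    "0 < level_weight I s A" "0 < level_weight I s B"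
  shows "A \<subseteq> B \<or> B \<subseteq> A"
proof (rule ccontr)
  assume "\<not> ?thesis"
  then obtain a b where ab: "a \<in> A" "a \<notin> B" "b \<in> B" "b \<notin> A" by blast
  then have "a \<in> I" "b \<in> I" using assms(2,3) by (auto simp: proper_subsets_def)
  then have "s b < s a" "s a < s b"
    using ab level_weight_pos[OF assms(1,2)] level_weight_pos[OF assms(1,3)] assms(4,5) by blast+
  then show False by simp
qed

text \<open>Layer-cake decomposition; induction over the values of \<open>s\<close>: passing from one value to the
  next larger one picks up exactly one superlevel set.\<close>
lemma level_weight_sum_at:
  assumes I: "finite I" and "i \<in> I"
  shows "(\<Sum>A\<in>proper_subsets I. if i \<in> A then level_weight I s A else 0) = s i - Min (s ` I)"
  using \<open>i \<in> I\<close>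
proof (induction "card {j \<in> I. s j < s i}" arbitrary: i rule: less_induct)
  case less
  let ?w = "level_weight I s" and ?PS = "proper_subsets I"
  note fin = finite_proper_subsets[OF I]
  show ?case
  proof (cases "\<exists>j\<in>I. s j < s i")
    case False
    then have "Min (s ` I) = s i"
      using less.prems I by (intro Min_eqI) (auto simp: not_less)
    moreover have "?w A = 0" if A: "A \<in> ?PS" "i \<in> A" for A
    proof (rule ccontr)
      assume "?w A \<noteq> 0"
      then have "0 < ?w A" using level_weight_nonneg[of I s A] by simp
      moreover obtain j where "j \<in> I - A" using A by (auto simp: proper_subsets_def)
      ultimately have "s j < s i" "j \<in> I" using level_weight_pos[OF I A(1)] A(2) by auto
      then show False using False by blast
    qed
    ultimately show ?thesis by (simp add: sum.neutral)
  next
    case True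
    define v where "v = Max (s ` {j \<in> I. s j < s i})"
    have "v \<in> s ` {j \<in> I. s j < s i}"
      unfolding v_def using True I by (intro Max_in) auto
    then obtain i' where i': "i' \<in> I" "s i' < s i" "v = s i'" by blast
    have gap: "s j \<le> s i'" if "j \<in> I" "s j < s i" for j
      using that I unfolding i'(3)[symmetric] v_def by (intro Max_ge) auto
    have gap2: "s i \<le> s j" if "j \<in> I" "s i' < s j" for j
      using gap[OF that(1)] that(2) by linarith
    let ?A = "{j \<in> I. s i \<le> s j}"
    have "i \<in> ?A" "i' \<notin> ?A" using less.prems i' by auto
    then have A: "?A \<in> ?PS" using i'(1) unfolding proper_subsets_def by blast
    have Min: "Min (s ` ?A) = s i" using I less.prems by (intro Min_eqI) auto
    have Max: "Max (s ` (I - ?A)) = s i'" using I i' by (intro Max_eqI) (auto simp: not_le intro: gap2)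
    have wA: "?w ?A = s i - s i'" using i' Min Max by (simp add: level_weight_def)
    have "{j \<in> I. s j < s i'} \<subset> {j \<in> I. s j < s i}" using i' by force
    then have "card {j \<in> I. s j < s i'} < card {j \<in> I. s j < s i}"
      using I by (intro psubset_card_mono) auto
    then have IH: "(\<Sum>A\<in>?PS. if i' \<in> A then ?w A else 0) = s i' - Min (s ` I)"
      using less.hyps i' by blast
    have "(\<Sum>A\<in>?PS. if i \<in> A then ?w A else 0) - (\<Sum>A\<in>?PS. if i' \<in> A then ?w A else 0)
        = (\<Sum>A\<in>?PS. (if i \<in> A then ?w A else 0) - (if i' \<in> A then ?w A else 0))"
      by (rule sum_subtractf[symmetric])
    also have "\<dots> = (\<Sum>A\<in>?PS. if A = ?A then ?w ?A else 0)"
    proof (rule sum.cong[OF refl])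
      fix B assume B: "B \<in> ?PS"
      have BI: "B \<subseteq> I" using B by (auto simp: proper_subsets_def)
      show "(if i \<in> B then ?w B else 0) - (if i' \<in> B then ?w B else 0) = (if B = ?A then ?w ?A else 0)"
      proof (cases "0 < ?w B")
        case False
        then have "?w B = 0" using level_weight_nonneg[of I s B] by simp
        then show ?thesis by auto
      next
        case True
        have lw: "s j < s l" if "l \<in> B" "j \<in> I" "j \<notin> B" for l j
          using level_weight_pos[OF I B] True that by blast
        have "i' \<in> B \<Longrightarrow> i \<in> B" using lw[of i' i] less.prems i' by force
        moreover have "B = ?A" if "i \<in> B" "i' \<notin> B"
        proof
          show "B \<subseteq> ?A"
          proof
            fix l assume l: "l \<in> B"
            have "s i' < s l" using lw[OF l i'(1) that(2)] .
            then have "s i \<le> s l" using gap2[of l] l BI by blast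
            then show "l \<in> ?A" using l BI by auto
          qed
          show "?A \<subseteq> B" using lw[OF that(1)] by force
        qed
        moreover have "i \<in> ?A" "i' \<notin> ?A" using less.prems i' by auto
        ultimately show ?thesis by (cases "i \<in> B"; cases "i' \<in> B") auto
      qed
    qed
    also have "\<dots> = s i - s i'" using A fin wA by simp
    finally show ?thesis using IH by simp
  qed
qed

text \<open>A set of positive weight is a superlevel set and so contains every maximizer of
  \<open>s\<close>; the layer-cake formula at such an index sums all the weights.\<close>

lemma level_weight_sum:
  assumes I: "finite I" "I \<noteq> {}"
  shows "sum (level_weight I s) (proper_subsets I) = Max (s ` I) - Min (s ` I)"
proof -
  have "Max (s ` I) \<in> s ` I" using I by (intro Max_in) auto
  then obtain i where i: "i \<in> I" "Max (s ` I) = s i" by blast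
  have "sum (level_weight I s) (proper_subsets I)
      = (\<Sum>A\<in>proper_subsets I. if i \<in> A then level_weight I s A else 0)"
  proof (rule sum.cong[OF refl])
    fix A assume A: "A \<in> proper_subsets I"
    have "\<not> 0 < level_weight I s A" if "i \<notin> A"
    proof
      assume w: "0 < level_weight I s A"
      obtain a where a: "a \<in> A" "a \<in> I" using A by (auto simp: proper_subsets_def)
      have "s i < s a" using level_weight_pos[OF I(1) A] w a i that by blast
      moreover have "s a \<le> s i" unfolding i(2)[symmetric] using a I by (intro Max_ge) auto
      ultimately show False by simp
    qed
    then show "level_weight I s A = (if i \<in> A then level_weight I s A else 0)"
      using level_weight_nonneg[of I s A] by force
  qed
  then show ?thesis using level_weight_sum_at[OF I(1) i(1)] i(2) by simp
qed

text \<open>The layer-cake decomposition is unique: between the minimum of \<open>q\<close> on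
  \<open>A\<close> and its maximum off \<open>A\<close>, no member of the chain other than
  \<open>A\<close> makes a difference.\<close>

lemma level_weight_of_chain:
  fixes p :: "'i set \<Rightarrow> real"
  assumes I: "finite I" and nn: "\<And>A. A \<in> proper_subsets I \<Longrightarrow> 0 \<le> p A"
    and ch: "\<And>A B. \<lbrakk>A \<in> proper_subsets I; B \<in> proper_subsets I; 0 < p A; 0 < p B\<rbrakk> \<Longrightarrow> A \<subseteq> B \<or> B \<subseteq> A"
    and q: "\<And>i. i \<in> I \<Longrightarrow> q i = (\<Sum>A\<in>proper_subsets I. if i \<in> A then p A else 0)"
    and A: "A \<in> proper_subsets I"
  shows "level_weight I q A = p A"
proof -
  let ?PS = "proper_subsets I"
  note fin = finite_proper_subsets[OF I]
  have f: "finite A" "A \<noteq> {}" "finite (I - A)" "I - A \<noteq> {}" "A \<subseteq> I"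
    using A I finite_subset by (auto simp: proper_subsets_def)
  have diff: "q i - q j = (\<Sum>B\<in>?PS. (if i \<in> B then p B else 0) - (if j \<in> B then p B else 0))"
    if "i \<in> I" "j \<in> I" for i j
    using that q by (simp add: sum_subtractf)
  have nonneg: "0 \<le> (if i \<in> C then p C else 0) - (if j \<in> C then p C else 0)"
    if "B \<in> ?PS" "0 < p B" "i \<in> B" "j \<notin> B" "C \<in> ?PS" for i j B C
  proof (cases "0 < p C")
    case True
    then have "C \<subseteq> B \<or> B \<subseteq> C" using ch that by blast
    then show ?thesis using that True by auto
  next
    case False
    then have "p C = 0" using nn[OF that(5)] by simp
    then show ?thesis by simp
  qed
  have ge: "p B \<le> q i - q j" if "B \<in> ?PS" "0 < p B" "i \<in> B" "j \<in> I" "j \<notin> B" for i j B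
  proof -
    have "i \<in> I" using that by (auto simp: proper_subsets_def)
    have "p B = (if i \<in> B then p B else 0) - (if j \<in> B then p B else 0)" using that by simp
    also have "\<dots> \<le> (\<Sum>C\<in>?PS. (if i \<in> C then p C else 0) - (if j \<in> C then p C else 0))"
      by (rule member_le_sum) (use that fin nonneg[OF that(1,2,3,5)] in auto)
    finally show ?thesis using diff[OF \<open>i \<in> I\<close> \<open>j \<in> I\<close>] by simp
  qed
  have "Min (q ` A) \<in> q ` A" using f by (intro Min_in) auto
  then obtain i where i: "i \<in> A" "Min (q ` A) = q i" by blast
  have imin: "q i \<le> q i'" if "i' \<in> A" for i'
    unfolding i(2)[symmetric] using f that by (intro Min_le) auto
  have "Max (q ` (I - A)) \<in> q ` (I - A)" using f by (intro Max_in) auto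
  then obtain j where j: "j \<in> I - A" "Max (q ` (I - A)) = q j" by blast
  have jmax: "q j' \<le> q j" if "j' \<in> I - A" for j'
    unfolding j(2)[symmetric] using f that by (intro Max_ge) auto
  have iI: "i \<in> I" and jI: "j \<in> I" "j \<notin> A" using i j f by auto
  \<comment> \<open>An element of \<open>A\<close> outside \<open>B\<close> would have a smaller
    \<open>q\<close> than the minimizer \<open>i\<close>, an element of \<open>B\<close> outside
    \<open>A\<close> a larger \<open>q\<close> than the maximizer \<open>j\<close>.\<close>
  have only_A: "B = A" if B: "B \<in> ?PS" "0 < p B" "i \<in> B" "j \<notin> B" for B
  proof
    show "A \<subseteq> B"
    proof
      fix i' assume "i' \<in> A"
      then have "q i \<le> q i'" "i' \<in> I" using imin f by auto
      then show "i' \<in> B" using ge[OF B(1,2,3), of i'] B(2) by linarith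
    qed
    show "B \<subseteq> A"
    proof
      fix j' assume "j' \<in> B"
      then have "p B \<le> q j' - q j" "j' \<in> I" using ge[OF B(1,2) _ jI(1) B(4)] B(1)
        by (auto simp: proper_subsets_def)
      then show "j' \<in> A" using jmax[of j'] B(2) by force
    qed
  qed
  have "q i - q j \<le> p A"
  proof -
    have "(if i \<in> B then p B else 0) - (if j \<in> B then p B else 0) \<le> (if B = A then p A else 0)"
      if "B \<in> ?PS" for B
    proof (cases "0 < p B \<and> i \<in> B \<and> j \<notin> B")
      case True
      then show ?thesis using only_A[OF that] by auto
    next
      case False
      then have "(if i \<in> B then p B else 0) - (if j \<in> B then p B else 0) \<le> 0"
        using nn[OF that] by auto
      then show ?thesis using nn[OF A] by auto
    qed
    then have "q i - q j \<le> (\<Sum>B\<in>?PS. if B = A then p A else 0)"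
      unfolding diff[OF iI jI(1)] by (rule sum_mono)
    then show ?thesis using fin A by simp
  qed
  moreover have "0 < p A \<Longrightarrow> p A \<le> q i - q j"
    using ge[OF A _ i(1) jI] by simp
  ultimately have "max 0 (q i - q j) = p A"
    using nn[OF A] by linarith
  then show ?thesis unfolding level_weight_def i(2) j(2) .
qed

section \<open>Realizations of order complexes and homotopies between them\<close>

lemma topspace_order_complex:
  "topspace (order_complex_space P S) = {p. (\<forall>z. 0 \<le> p z) \<and> (\<forall>z. z \<notin> S \<longrightarrow> p z = 0) \<and> sum p S = 1 \<and>
         (\<forall>u\<in>S. \<forall>v\<in>S. 0 < p u \<and> 0 < p v \<longrightarrow> P u v \<or> P v u)}"
  by (simp add: order_complex_space_def)

lemma order_complex_dual: "order_complex_space (\<lambda>x y. P y x) S = order_complex_space P S"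
  unfolding order_complex_space_def by (rule arg_cong[where f = "subtopology _"]) blast

lemma continuous_map_into_order_complex:
  "continuous_map X (order_complex_space P S) f \<longleftrightarrow>
     (\<forall>w. continuous_map X euclideanreal (\<lambda>x. f x w)) \<and> f \<in> topspace X \<rightarrow> topspace (order_complex_space P S)"
  by (simp add: order_complex_space_def continuous_map_in_subtopology continuous_map_componentwise_UNIV)

lemma continuous_map_order_complex_eval [continuous_intros]:
  "continuous_map (order_complex_space P S) euclideanreal (\<lambda>p. p w)"
  unfolding order_complex_space_def
  by (intro continuous_map_from_subtopology continuous_map_product_projection) simp

text \<open>The affine extension of \<open>f\<close> from the vertices to the realization.\<close>

definition push_forward :: "'b set \<Rightarrow> ('b \<Rightarrow> 'b) \<Rightarrow> ('b \<Rightarrow> real) \<Rightarrow> 'b \<Rightarrow> real" where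
  "push_forward S f p w = (\<Sum>z\<in>S. if f z = w then p z else 0)"

text \<open>The part of the mass at \<open>z\<close> that has been moved at time \<open>t\<close>, the mass being moved from the
  bottom of the supporting chain upwards. At every time the moved points lie below the unmoved
  ones, so that the images of the former and the latter form a chain (a straight-line homotopy
  would leave the order complex).\<close>
definition moved :: "('b \<Rightarrow> 'b \<Rightarrow> bool) \<Rightarrow> 'b set \<Rightarrow> real \<Rightarrow> ('b \<Rightarrow> real) \<Rightarrow> 'b \<Rightarrow> real" where
  "moved P S t p z = min (p z) (max 0 (t - (\<Sum>u\<in>S. if P u z \<and> u \<noteq> z then p u else 0)))"

text \<open>At time \<open>t\<close> the mass \<open>moved\<close> sits at its image under
  \<open>f\<close> and the rest where it was. \<open>mono\<close> makes the images a chain, and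
  \<open>decr\<close> puts the image of a moved point below every point that is not yet fully
  moved.\<close>

lemma homotopic_push_forward:
  fixes S :: "'b set"
  assumes S: "finite S" "poset_on S P" and f: "f ` S \<subseteq> S"
    and mono: "\<And>x y. \<lbrakk>x \<in> S; y \<in> S; P x y\<rbrakk> \<Longrightarrow> P (f x) (f y)"
    and decr: "\<And>x. x \<in> S \<Longrightarrow> P (f x) x"
  shows "homotopic_with (\<lambda>_. True) (order_complex_space P S) (order_complex_space P S) id (push_forward S f)"
proof -
  let ?O = "order_complex_space P S"
  define c where "c p z = (\<Sum>u\<in>S. if P u z \<and> u \<noteq> z then p u else 0)" for p :: "'b \<Rightarrow> real" and z
  define h where "h = (\<lambda>(t, p) w. p w - moved P S t p w + (\<Sum>z\<in>S. if f z = w then moved P S t p z else 0))"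
  have mv: "moved P S t p z = min (p z) (max 0 (t - c p z))" for t p z
    by (simp add: moved_def c_def)
  have trans: "P x z" if "x \<in> S" "y \<in> S" "z \<in> S" "P x y" "P y z" for x y z
    using S(2) that unfolding poset_on_def by blast
  have into: "h (t, p) \<in> topspace ?O" if p: "p \<in> topspace ?O" for t p
  proof -
    have p0: "\<And>z. 0 \<le> p z" "\<And>z. z \<notin> S \<Longrightarrow> p z = 0" "sum p S = 1"
      and pc: "\<And>u v. \<lbrakk>u \<in> S; v \<in> S; 0 < p u; 0 < p v\<rbrakk> \<Longrightarrow> P u v \<or> P v u"
      using p by (auto simp: topspace_order_complex)
    have m0: "0 \<le> moved P S t p z" "moved P S t p z \<le> p z" for z
      using p0(1)[of z] by (auto simp: mv)
    have nn: "0 \<le> h (t, p) w" for w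
      using m0 by (auto simp: h_def intro!: add_nonneg_nonneg sum_nonneg)
    have supp: "h (t, p) w = 0" if "w \<notin> S" for w
    proof -
      have "f z \<noteq> w" if "z \<in> S" for z using f that \<open>w \<notin> S\<close> by auto
      then show ?thesis using p0(2)[OF that] m0[of w] by (simp add: h_def)
    qed
    have "(\<Sum>w\<in>S. \<Sum>z\<in>S. if f z = w then moved P S t p z else 0)
        = (\<Sum>z\<in>S. \<Sum>w\<in>S. if f z = w then moved P S t p z else 0)"
      by (rule sum.swap)
    also have "\<dots> = (\<Sum>z\<in>S. moved P S t p z)"
      using S f by (intro sum.cong) (auto simp: sum.delta)
    finally have tot: "sum (h (t, p)) S = 1"
      using p0(3) by (simp add: h_def sum.distrib sum_subtractf)
    have src: "(0 < p w \<and> moved P S t p w < p w) \<or> (\<exists>z\<in>S. f z = w \<and> 0 < moved P S t p z)"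
      if "0 < h (t, p) w" for w
    proof (rule ccontr)
      assume neg: "\<not> ?thesis"
      then have "p w - moved P S t p w = 0" using m0[of w] by linarith
      moreover have "(\<Sum>z\<in>S. if f z = w then moved P S t p z else 0) = 0"
      proof (rule sum.neutral, rule ballI)
        fix z assume "z \<in> S"
        then have "f z = w \<Longrightarrow> \<not> 0 < moved P S t p z" using neg by blast
        then show "(if f z = w then moved P S t p z else 0) = 0" using m0(1)[of z] by auto
      qed
      ultimately show False using that by (simp add: h_def)
    qed
    \<comment> \<open>Otherwise \<open>v\<close> is strictly below \<open>z\<close>, the mass up to
      and including \<open>v\<close> is at most \<open>c p z < t\<close>, and \<open>v\<close> has
      moved completely.\<close>
    have below: "P z v" if "z \<in> S" "v \<in> S" "0 < moved P S t p z" "moved P S t p v < p v" for z v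
    proof (rule ccontr)
      assume n: "\<not> P z v"
      have pz: "0 < p z" "c p z < t" and pv: "0 < p v" "t < c p v + p v"
        using that m0[of v] m0[of z] by (auto simp: mv min_def max_def split: if_splits)
      have vz: "P v z" "v \<noteq> z" using n pc[OF that(1,2) pz(1) pv(1)] S(2) that
        unfolding poset_on_def by blast+
      have "c p v + p v = (\<Sum>u\<in>S. (if P u v \<and> u \<noteq> v then p u else 0) + (if u = v then p v else 0))"
        using S that by (simp add: c_def sum.distrib)
      also have "\<dots> \<le> c p z"
        unfolding c_def
      proof (rule sum_mono)
        fix u assume u: "u \<in> S"
        show "(if P u v \<and> u \<noteq> v then p u else 0) + (if u = v then p v else 0)
          \<le> (if P u z \<and> u \<noteq> z then p u else 0)"
        proof (cases "u = v")
          case False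
          then show ?thesis using vz trans[OF u that(2,1)] n p0(1)[of u] by auto
        qed (use vz p0(1)[of v] in simp)
      qed
      finally show False using pz pv by simp
    qed
    have "P u v \<or> P v u" if uv: "u \<in> S" "v \<in> S" "0 < h (t, p) u" "0 < h (t, p) v" for u v
    proof -
      have pos: "0 < p z" if "0 < moved P S t p z" for z using m0(2)[of z] that by simp
      have mixed: "P u v" if "u \<in> S" "v \<in> S" "z \<in> S" "f z = u" "0 < moved P S t p z" "moved P S t p v < p v"
        for z u v
        using trans[of "f z" z v] decr[of z] below[of z v] that by simp
      consider "0 < p u" "moved P S t p u < p u" "0 < p v" "moved P S t p v < p v"
        | z where "z \<in> S" "f z = u" "0 < moved P S t p z" "moved P S t p v < p v"
        | z where "z \<in> S" "f z = v" "0 < moved P S t p z" "moved P S t p u < p u"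
        | z z' where "z \<in> S" "f z = u" "0 < moved P S t p z" "z' \<in> S" "f z' = v" "0 < moved P S t p z'"
        using src[OF uv(3)] src[OF uv(4)] by blast
      then show ?thesis
      proof cases
        case 1 then show ?thesis using pc uv by blast
      next
        case 2 then show ?thesis using mixed uv by blast
      next
        case 3 then show ?thesis using mixed uv by blast
      next
        case 4
        then have "P z z' \<or> P z' z" using pc pos by blast
        then show ?thesis using mono[of z z'] mono[of z' z] 4 by blast
      qed
    qed
    then show ?thesis using nn supp tot by (simp add: topspace_order_complex)
  qed
  have "continuous_map (prod_topology (top_of_set {0..1}) ?O) euclideanreal (\<lambda>x. h x w)" for w
  proof -
    have e: "continuous_map (prod_topology (top_of_set {0..1}) ?O) euclideanreal (\<lambda>x. snd x z)" for z
      using continuous_map_compose[OF continuous_map_snd continuous_map_order_complex_eval[of P S z]]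
      by (simp add: o_def)
    have t: "continuous_map (prod_topology (top_of_set {0..1}) ?O) euclideanreal (\<lambda>x. fst x)"
      by (rule continuous_map_into_fulltopology[OF continuous_map_fst])
    have ite: "continuous_map (prod_topology (top_of_set {0..1}) ?O) euclideanreal (\<lambda>x. if b then g x else 0)"
      if "continuous_map (prod_topology (top_of_set {0..1}) ?O) euclideanreal g" for b and g
      using that by (cases b) auto
    have m: "continuous_map (prod_topology (top_of_set {0..1}) ?O) euclideanreal (\<lambda>x. moved P S (fst x) (snd x) z)" for z
      unfolding moved_def using S(1)
      by (intro continuous_map_real_min continuous_map_real_max continuous_map_diff continuous_map_sum ite e t) auto
    show ?thesis
      unfolding h_def case_prod_unfold using S(1)
      by (intro continuous_map_add continuous_map_diff continuous_map_sum ite e m) auto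
  qed
  then have "continuous_map (prod_topology (top_of_set {0..1}) ?O) ?O h"
    using into by (auto simp: continuous_map_into_order_complex)
  moreover have "h (0, p) = id p" "h (1, p) = push_forward S f p" if p: "p \<in> topspace ?O" for p
  proof -
    have p0: "\<And>z. 0 \<le> p z" "\<And>z. z \<notin> S \<Longrightarrow> p z = 0" "sum p S = 1"
      using p by (auto simp: topspace_order_complex)
    have c0: "0 \<le> c p z" for z unfolding c_def using p0 by (intro sum_nonneg) auto
    have "moved P S 0 p z = 0" for z
      using c0[of z] p0(1)[of z] by (auto simp: mv)
    then show "h (0, p) = id p" by (simp add: h_def cong: if_cong)
    \<comment> \<open>Everything has moved at time 1, since the mass up to and including
      \<open>z\<close> is part of the total.\<close>
    have "c p z + p z \<le> 1" if "z \<in> S" for z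
    proof -
      have "c p z + p z = (\<Sum>u\<in>S. (if P u z \<and> u \<noteq> z then p u else 0) + (if u = z then p z else 0))"
        using S that by (simp add: c_def sum.distrib)
      also have "\<dots> \<le> sum p S" by (rule sum_mono) (use p0(1) in auto)
      finally show ?thesis using p0 by simp
    qed
    then have "moved P S 1 p z = p z" for z
      using p0(1)[of z] p0(2)[of z] by (cases "z \<in> S") (force simp: mv)+
    then show "h (1, p) = push_forward S f p"
      by (intro ext) (simp add: h_def push_forward_def cong: if_cong)
  qed
  ultimately show ?thesis
    by (subst homotopic_with) auto
qed

lemma topspace_order_complex_subset:
  assumes "finite S" "T \<subseteq> S"
  shows "p \<in> topspace (order_complex_space P T) \<longleftrightarrow>
    p \<in> topspace (order_complex_space P S) \<and> (\<forall>z. z \<notin> T \<longrightarrow> p z = 0)"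
proof -
  have "p \<in> topspace (order_complex_space P T) \<longleftrightarrow> p \<in> topspace (order_complex_space P S)"
    if z: "\<forall>z. z \<notin> T \<longrightarrow> p z = 0"
  proof -
    have "sum p T = sum p S"
      using assms z by (intro sum.mono_neutral_left) auto
    moreover have "u \<in> T" if "0 < p u" for u using z that by force
    then have "(\<forall>u\<in>T. \<forall>v\<in>T. 0 < p u \<and> 0 < p v \<longrightarrow> P u v \<or> P v u) \<longleftrightarrow>
        (\<forall>u\<in>S. \<forall>v\<in>S. 0 < p u \<and> 0 < p v \<longrightarrow> P u v \<or> P v u)"
      using assms(2) by blast
    moreover have "\<forall>z. z \<notin> S \<longrightarrow> p z = 0" using z assms(2) by blast
    ultimately show ?thesis
      unfolding topspace_order_complex mem_Collect_eq using z by simp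
  qed
  moreover have "\<forall>z. z \<notin> T \<longrightarrow> p z = 0" if "p \<in> topspace (order_complex_space P T)"
    using that by (simp add: topspace_order_complex)
  ultimately show ?thesis by blast
qed

text \<open>By idempotence the push-forward fixes all mass supported in the image, so the homotopy
  to the identity makes it a homotopy inverse of the inclusion.\<close>

lemma order_complex_retract:
  assumes S: "finite S" "poset_on S P" and f: "f ` S \<subseteq> S"
    and mono: "\<And>x y. \<lbrakk>x \<in> S; y \<in> S; P x y\<rbrakk> \<Longrightarrow> P (f x) (f y)"
    and decr: "\<And>x. x \<in> S \<Longrightarrow> P (f x) x"
    and idem: "\<And>x. x \<in> S \<Longrightarrow> f (f x) = f x"
  shows "order_complex_space P S homotopy_equivalent_space order_complex_space P (f ` S)"
proof -
  let ?O = "order_complex_space P S" and ?T = "order_complex_space P (f ` S)"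
  note H = homotopic_push_forward[OF S f mono decr]
  have sub: "p \<in> topspace ?T \<longleftrightarrow> p \<in> topspace ?O \<and> (\<forall>z. z \<notin> f ` S \<longrightarrow> p z = 0)" for p
    by (rule topspace_order_complex_subset[OF S(1) f])
  have c: "continuous_map ?O ?O (push_forward S f)"
    using homotopic_with_imp_continuous_maps[OF H] by blast
  have z: "push_forward S f p w = 0" if "w \<notin> f ` S" for p w
    unfolding push_forward_def using that by (intro sum.neutral) auto
  have c1: "continuous_map ?O ?T (push_forward S f)"
    using c z sub unfolding continuous_map_into_order_complex by blast
  have c2: "continuous_map ?T ?O id"
    unfolding continuous_map_into_order_complex using sub
    by (auto intro: continuous_map_order_complex_eval)
  have "push_forward S f p = p" if p: "p \<in> topspace ?T" for p
  proof
    fix w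
    have "push_forward S f p w = (\<Sum>z\<in>S. if z = w then p w else 0)"
      unfolding push_forward_def
    proof (rule sum.cong[OF refl])
      fix z assume "z \<in> S"
      then show "(if f z = w then p z else 0) = (if z = w then p w else 0)"
        using p idem sub by (cases "z \<in> f ` S") auto
    qed
    also have "\<dots> = p w"
    proof (cases "w \<in> S")
      case False
      then have "p w = 0" using f p sub by blast
      then show ?thesis using S by simp
    qed (use S in simp)
    finally show "push_forward S f p w = p w" .
  qed
  then have "homotopic_with (\<lambda>_. True) ?T ?T (push_forward S f \<circ> id) id"
    using continuous_map_compose[OF c2 c1] by (intro homotopic_with_equal) auto
  moreover have "homotopic_with (\<lambda>_. True) ?O ?O (id \<circ> push_forward S f) id"
    using H unfolding id_comp by (rule homotopic_with_symD)
  ultimately show ?thesis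
    unfolding homotopy_equivalent_space_def using c1 c2 by blast
qed

text \<open>The constant map to a least element is order preserving and decreasing, hence homotopic
  to the identity.\<close>

lemma order_complex_contractible:
  assumes S: "finite S" "poset_on S P" and m: "m \<in> S" "\<And>x. x \<in> S \<Longrightarrow> P m x"
  shows "contractible_space (order_complex_space P S)"
proof -
  let ?O = "order_complex_space P S"
  let ?c = "\<lambda>w. if w = m then 1 else 0 :: real"
  have "P m m" using m by blast
  have H: "homotopic_with (\<lambda>_. True) ?O ?O id (push_forward S (\<lambda>_. m))"
    by (rule homotopic_push_forward[OF S]) (use m \<open>P m m\<close> in auto)
  have "push_forward S (\<lambda>_. m) p = ?c" if "p \<in> topspace ?O" for p
    using that by (intro ext) (simp add: push_forward_def topspace_order_complex)
  then have "homotopic_with (\<lambda>_. True) ?O ?O id (\<lambda>_. ?c)"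
    by (intro homotopic_with_eq[OF H]) simp_all
  then show ?thesis unfolding contractible_space_def by blast
qed

lemma continuous_map_Min:
  assumes "finite A" "A \<noteq> {}" "\<And>i. i \<in> A \<Longrightarrow> continuous_map X euclideanreal (\<lambda>x. f x i)"
  shows "continuous_map X euclideanreal (\<lambda>x. Min (f x ` A))"
  using assms
proof (induction A rule: finite_ne_induct)
  case (insert i A)
  then have "(\<lambda>x. Min (f x ` insert i A)) = (\<lambda>x. min (f x i) (Min (f x ` A)))" by simp
  then show ?case using insert by (simp add: continuous_map_real_min)
qed simp

lemma continuous_map_Max:
  assumes "finite A" "A \<noteq> {}" "\<And>i. i \<in> A \<Longrightarrow> continuous_map X euclideanreal (\<lambda>x. f x i)"
  shows "continuous_map X euclideanreal (\<lambda>x. Max (f x ` A))"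
  using assms
proof (induction A rule: finite_ne_induct)
  case (insert i A)
  then have "(\<lambda>x. Max (f x ` insert i A)) = (\<lambda>x. max (f x i) (Max (f x ` A)))" by simp
  then show ?case using insert by (simp add: continuous_map_real_max)
qed simp

text \<open>By the layer-cake formula this is the total level weight, the constant by which weights
  are normalized.\<close>

definition spread :: "'i set \<Rightarrow> ('i \<Rightarrow> real) \<Rightarrow> real" where
  "spread I s = Max (s ` I) - Min (s ` I)"

lemma Min_Max_affine:
  fixes s :: "'i \<Rightarrow> real"
  assumes "finite A" "A \<noteq> {}" "0 < r" "\<And>i. i \<in> A \<Longrightarrow> s' i = (s i - c) / r"
  shows "Min (s' ` A) = (Min (s ` A) - c) / r" "Max (s' ` A) = (Max (s ` A) - c) / r"
proof -
  have "mono (\<lambda>x. (x - c) / r)" using assms(3) by (intro monoI) (simp add: divide_right_mono)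
  moreover have "s' ` A = (\<lambda>x. (x - c) / r) ` (s ` A)" using assms(4) by (auto simp: image_iff)
  ultimately show "Min (s' ` A) = (Min (s ` A) - c) / r" "Max (s' ` A) = (Max (s ` A) - c) / r"
    using mono_Min_commute[of "\<lambda>x. (x - c) / r" "s ` A"] mono_Max_commute[of "\<lambda>x. (x - c) / r" "s ` A"] assms
    by auto
qed

lemma level_weight_affine:
  fixes s :: "'i \<Rightarrow> real"
  assumes "finite I" "A \<in> proper_subsets I" "0 < r" "\<And>i. i \<in> I \<Longrightarrow> s' i = (s i - c) / r"
  shows "level_weight I s' A = level_weight I s A / r"
proof -
  have f: "finite A" "A \<noteq> {}" "finite (I - A)" "I - A \<noteq> {}" "A \<subseteq> I"
    using assms finite_subset by (auto simp: proper_subsets_def)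
  have "Min (s' ` A) - Max (s' ` (I - A)) = (Min (s ` A) - Max (s ` (I - A))) / r"
  proof -
    have "Min (s' ` A) = (Min (s ` A) - c) / r"
      by (rule Min_Max_affine(1)[OF f(1,2) assms(3)]) (use f assms(4) in blast)
    moreover have "Max (s' ` (I - A)) = (Max (s ` (I - A)) - c) / r"
      by (rule Min_Max_affine(2)[OF f(3,4) assms(3)]) (use assms(4) in blast)
    ultimately show ?thesis by (simp add: diff_divide_distrib)
  qed
  then show ?thesis
    using assms(3) by (auto simp: level_weight_def max_def divide_le_0_iff zero_le_divide_iff)
qed

lemma spread_affine:
  fixes s :: "'i \<Rightarrow> real"
  assumes "finite I" "I \<noteq> {}" "0 < r" "\<And>i. i \<in> I \<Longrightarrow> s' i = (s i - c) / r"
  shows "spread I s' = spread I s / r"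
  using Min_Max_affine[of I r s' s c] assms by (simp add: spread_def diff_divide_distrib)

lemma spread_pos_iff:
  assumes "finite I" "I \<noteq> {}"
  shows "0 < spread I s \<longleftrightarrow> (\<exists>i\<in>I. \<exists>j\<in>I. s i < s j)"
  using assms by (auto simp: spread_def Min_less_iff Max_gr_iff)

text \<open>The homeomorphism is \<open>p \<mapsto> (\<lambda>i. \<Sum>A\<ni>i. p A)\<close>, taken modulo constants and normalized.\<close>
lemma boolean_proper_part_sphere:
  fixes g :: "nat set \<Rightarrow> 'b"
  assumes g: "bij_betw g (proper_subsets {..Suc m}) T"
    and ord: "\<And>A B. \<lbrakk>A \<in> proper_subsets {..Suc m}; B \<in> proper_subsets {..Suc m}\<rbrakk> \<Longrightarrow> P (g A) (g B) \<longleftrightarrow> A \<subseteq> B"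
  shows "order_complex_space P T homeomorphic_space nsphere m"
proof -
  define I where "I = {..Suc m}"
  let ?PS = "proper_subsets I" and ?O = "order_complex_space P T"
  define q where "q p i = (\<Sum>A\<in>?PS. if i \<in> A then p (g A) else 0)" for p :: "'b \<Rightarrow> real" and i
  \<comment> \<open>The representative modulo constants that vanishes at the last index. Its other
    \<open>m + 1\<close> coordinates, divided by their norm, form a point of the
    \<open>m\<close>-sphere.\<close>
  define y where "y p i = q p i - q p (Suc m)" for p i
  define nrm where "nrm p = sqrt (\<Sum>i\<le>m. (y p i)\<^sup>2)" for p
  define F where "F p i = (if i \<le> m then y p i / nrm p else 0)" for p i
  define h where "h = inv_into ?PS g"
  \<comment> \<open>Level weights ignore additive constants and scale with \<open>s\<close>, so the
    inverse map has only to divide them by their total.\<close>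
  define G where "G s z = (if z \<in> T then level_weight I s (h z) / spread I s else 0)" for s z
  have I: "finite I" "I \<noteq> {}" by (auto simp: I_def)
  note fin = finite_proper_subsets[OF I(1)]
  have gb: "bij_betw g ?PS T" using g by (simp add: I_def)
  have gT: "g A \<in> T" if "A \<in> ?PS" for A using gb that by (auto simp: bij_betw_def)
  have hg: "h (g A) = A" if "A \<in> ?PS" for A
    using gb that by (simp add: h_def bij_betw_def inv_into_f_f)
  have hz: "h z \<in> ?PS" "g (h z) = z" if "z \<in> T" for z
    using gb that by (auto simp: h_def bij_betw_def inv_into_into f_inv_into_f)
  have ordg: "P (g A) (g B) \<longleftrightarrow> A \<subseteq> B" if "A \<in> ?PS" "B \<in> ?PS" for A B
    using ord that by (simp add: I_def)
  have sumT: "sum p T = (\<Sum>A\<in>?PS. p (g A))" for p :: "'b \<Rightarrow> real"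
    using sum.reindex_bij_betw[OF gb, of p] by simp
  have tsph: "topspace (nsphere m) = {s. (\<Sum>i\<le>m. (s i)\<^sup>2) = 1 \<and> (\<forall>i>m. s i = 0)}"
    by (auto simp: nsphere)
  have lw: "level_weight I (q p) A = p (g A)" if p: "p \<in> topspace ?O" and A: "A \<in> ?PS" for p A
  proof (rule level_weight_of_chain[OF I(1) _ _ _ A])
    show "B \<subseteq> C \<or> C \<subseteq> B" if "B \<in> ?PS" "C \<in> ?PS" "0 < p (g B)" "0 < p (g C)" for B C
      using p that gT[OF that(1)] gT[OF that(2)] ordg[OF that(1,2)] ordg[OF that(2,1)]
      unfolding topspace_order_complex by blast
  qed (use p in \<open>auto simp: topspace_order_complex q_def\<close>)
  have spr1: "spread I (q p) = 1" if p: "p \<in> topspace ?O" for p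
  proof -
    have "spread I (q p) = sum (level_weight I (q p)) ?PS"
      using level_weight_sum[OF I] by (simp add: spread_def)
    also have "\<dots> = sum p T" unfolding sumT using lw[OF p] by (intro sum.cong) auto
    finally show ?thesis using p by (simp add: topspace_order_complex)
  qed
  have npos: "0 < nrm p" if p: "p \<in> topspace ?O" for p
  proof -
    obtain i j where ij: "i \<in> I" "j \<in> I" "q p i < q p j"
      using spread_pos_iff[OF I, of "q p"] spr1[OF p] by auto
    then have "y p i \<noteq> 0 \<or> y p j \<noteq> 0" by (auto simp: y_def)
    moreover have "y p (Suc m) = 0" by (simp add: y_def)
    ultimately have "\<exists>i\<le>m. y p i \<noteq> 0"
      using ij(1,2) unfolding I_def by (metis atMost_iff le_Suc_eq)
    then have "0 < (\<Sum>i\<le>m. (y p i)\<^sup>2)" by (auto intro: sum_pos2)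
    then show ?thesis by (simp add: nrm_def)
  qed
  have Faff: "F p i = (q p i - q p (Suc m)) / nrm p" if "i \<in> I" for p i
    using that by (auto simp: F_def y_def I_def le_Suc_eq)
  have Fin: "F p \<in> topspace (nsphere m)" if p: "p \<in> topspace ?O" for p
  proof -
    have "(\<Sum>i\<le>m. (F p i)\<^sup>2) = (\<Sum>i\<le>m. (y p i)\<^sup>2) / (nrm p)\<^sup>2"
      by (simp add: F_def power_divide sum_divide_distrib)
    also have "(\<Sum>i\<le>m. (y p i)\<^sup>2) = (nrm p)\<^sup>2" by (simp add: nrm_def sum_nonneg)
    finally show ?thesis using npos[OF p] by (simp add: tsph F_def)
  qed
  have GF: "G (F p) = p" if p: "p \<in> topspace ?O" for p
  proof
    fix z show "G (F p) z = p z"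
    proof (cases "z \<in> T")
      case True
      have "level_weight I (F p) (h z) = p z / nrm p"
        using level_weight_affine[OF I(1) hz(1)[OF True] npos[OF p] Faff]
          lw[OF p hz(1)[OF True]] hz(2)[OF True] by simp
      moreover have "spread I (F p) = 1 / nrm p"
        using spread_affine[OF I npos[OF p] Faff] spr1[OF p] by simp
      ultimately show ?thesis using True npos[OF p] by (simp add: G_def)
    qed (use p in \<open>simp add: G_def topspace_order_complex\<close>)
  qed
  have spr: "0 < spread I s" if s: "s \<in> topspace (nsphere m)" for s
  proof -
    have "\<exists>i\<le>m. s i \<noteq> 0"
    proof (rule ccontr)
      assume "\<not> ?thesis"
      then have "(\<Sum>i\<le>m. (s i)\<^sup>2) = 0" by (intro sum.neutral) auto
      then show False using s by (simp add: tsph)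
    qed
    then obtain i where i: "i \<le> m" "s i \<noteq> 0" by blast
    have "s (Suc m) = 0" using s by (simp add: tsph)
    then have "s i < s (Suc m) \<or> s (Suc m) < s i" using i by auto
    then show ?thesis using i spread_pos_iff[OF I, of s] by (auto simp: I_def)
  qed
  have Gg: "G s (g A) = level_weight I s A / spread I s" if "A \<in> ?PS" for s A
    using that gT hg by (simp add: G_def)
  have Gin: "G s \<in> topspace ?O" if s: "s \<in> topspace (nsphere m)" for s
  proof -
    have "0 \<le> G s z" for z
      using spr[OF s] level_weight_nonneg[of I s "h z"] by (simp add: G_def)
    moreover have "sum (G s) T = 1"
      unfolding sumT using Gg spr[OF s] level_weight_sum[OF I, of s]
      by (simp add: sum_divide_distrib[symmetric] spread_def)
    moreover have "P u v \<or> P v u" if "u \<in> T" "v \<in> T" "0 < G s u" "0 < G s v" for u v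
    proof -
      have "0 < level_weight I s (h u)" "0 < level_weight I s (h v)"
        using that spr[OF s] by (auto simp: G_def zero_less_divide_iff)
      then show ?thesis
        using level_weight_chain[OF I(1) hz(1)[OF that(1)] hz(1)[OF that(2)]]
          ordg hz[OF that(1)] hz[OF that(2)] by metis
    qed
    ultimately show ?thesis unfolding topspace_order_complex by (auto simp: G_def)
  qed
  have FG: "F (G s) = s" if s: "s \<in> topspace (nsphere m)" for s
  proof
    fix i
    have q: "q (G s) i = (s i - Min (s ` I)) / spread I s" if "i \<in> I" for i
    proof -
      have "q (G s) i = (\<Sum>A\<in>?PS. (if i \<in> A then level_weight I s A else 0) / spread I s)"
        unfolding q_def using Gg by (intro sum.cong) auto
      then show ?thesis
        using level_weight_sum_at[OF I(1) that, of s] by (simp add: sum_divide_distrib[symmetric])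
    qed
    have s0: "s (Suc m) = 0" using s by (simp add: tsph)
    have y: "y (G s) i = s i / spread I s" if "i \<le> m" for i
    proof -
      have "i \<in> I" "Suc m \<in> I" using that by (auto simp: I_def)
      then show ?thesis unfolding y_def q[OF \<open>i \<in> I\<close>] q[OF \<open>Suc m \<in> I\<close>] s0 diff_divide_distrib by simp
    qed
    have "nrm (G s) = sqrt ((\<Sum>i\<le>m. (s i)\<^sup>2) / (spread I s)\<^sup>2)"
      unfolding nrm_def using y by (simp add: power_divide sum_divide_distrib)
    also have "\<dots> = 1 / spread I s" using s spr[OF s] by (simp add: tsph real_sqrt_divide)
    finally show "F (G s) i = s i"
      using y[of i] spr[OF s] s by (simp add: F_def tsph)
  qed
  have qc: "continuous_map ?O euclideanreal (\<lambda>p. q p i)" for i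
  proof -
    have "continuous_map ?O euclideanreal (\<lambda>p. if i \<in> A then p (g A) else 0)" for A
      by (cases "i \<in> A") (simp_all add: continuous_map_order_complex_eval)
    then show ?thesis unfolding q_def using fin by (intro continuous_map_sum) auto
  qed
  then have yc: "continuous_map ?O euclideanreal (\<lambda>p. y p i)" for i
    unfolding y_def by (intro continuous_map_diff)
  then have nc: "continuous_map ?O euclideanreal nrm"
    unfolding nrm_def by (intro continuous_map_sqrt continuous_map_sum continuous_map_real_pow) auto
  have "continuous_map ?O euclideanreal (\<lambda>p. F p i)" for i
    unfolding F_def using yc nc npos
    by (cases "i \<le> m") (auto intro!: continuous_map_real_divide simp: less_imp_neq[THEN not_sym])
  then have Fc: "continuous_map ?O (nsphere m) F"
    unfolding nsphere continuous_map_in_subtopology continuous_map_componentwise_UNIV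
    using Fin by (auto simp: tsph)
  have ev: "continuous_map (nsphere m) euclideanreal (\<lambda>s. s i)" for i
    by (rule continuous_map_nsphere_projection)
  have sc: "continuous_map (nsphere m) euclideanreal (spread I)"
    unfolding spread_def using I ev by (intro continuous_map_diff continuous_map_Min continuous_map_Max) auto
  have lc: "continuous_map (nsphere m) euclideanreal (\<lambda>s. level_weight I s A)" if A: "A \<in> ?PS" for A
  proof -
    have f: "finite A" "A \<noteq> {}" "finite (I - A)" "I - A \<noteq> {}"
      using A I finite_subset by (auto simp: proper_subsets_def)
    show ?thesis unfolding level_weight_def
      using f ev by (intro continuous_map_real_max continuous_map_diff continuous_map_Min continuous_map_Max) auto
  qed
  have "continuous_map (nsphere m) euclideanreal (\<lambda>s. G s z)" for z
  proof (cases "z \<in> T")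
    case True
    have "spread I s \<noteq> 0" if "s \<in> topspace (nsphere m)" for s using spr[OF that] by simp
    then show ?thesis unfolding G_def using True lc[OF hz(1)[OF True]] sc
      by (simp add: continuous_map_real_divide)
  qed (simp add: G_def)
  then have Gc: "continuous_map (nsphere m) ?O G"
    using Gin by (auto simp: continuous_map_into_order_complex)
  show ?thesis
    unfolding homeomorphic_space_def homeomorphic_maps_def
    using Fc Gc FG GF by blast
qed

section \<open>Open intervals above an element whose atoms have joins\<close>

lemma ex_atom_below:
  assumes "finite M" "poset_on M P" "x \<in> M" "z \<in> M" "P x z" "x \<noteq> z"
  shows "\<exists>a. covers M P x a \<and> P a z"
  using assms(4-6)
proof (induction "card {u \<in> M. P x u \<and> P u z}" arbitrary: z rule: less_induct)
  case less
  have po: "P u u" "P u v \<Longrightarrow> P v u \<Longrightarrow> u = v" "P u v \<Longrightarrow> P v w \<Longrightarrow> P u w"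
    if "u \<in> M" "v \<in> M" "w \<in> M" for u v w
    using assms(2) that unfolding poset_on_def by blast+
  show ?case
  proof (cases "covers M P x z")
    case True
    then show ?thesis using less.prems po(1) by blast
  next
    case False
    then obtain u where u: "u \<in> M" "P x u" "P u z" "u \<noteq> x" "u \<noteq> z"
      using less.prems assms(3) unfolding covers_def open_interval_def by blast
    have "{v \<in> M. P x v \<and> P v u} \<subseteq> {v \<in> M. P x v \<and> P v z}"
      using u(1,3) less.prems(1) po(3) by blast
    moreover have "z \<notin> {v \<in> M. P x v \<and> P v u}" "z \<in> {v \<in> M. P x v \<and> P v z}"
      using u less.prems po by blast+
    ultimately have "{v \<in> M. P x v \<and> P v u} \<subset> {v \<in> M. P x v \<and> P v z}" by blast
    then have "card {v \<in> M. P x v \<and> P v u} < card {v \<in> M. P x v \<and> P v z}"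
      using assms(1) by (intro psubset_card_mono) auto
    then obtain a where "covers M P x a" "P a u" using less.hyps u by blast
    then show ?thesis using u less.prems(1) po(3)[of a u z] unfolding covers_def by blast
  qed
qed

text \<open>\<open>J S\<close> is the join of \<open>x\<close> and the atoms in \<open>S\<close>,
  given by its universal property \<open>J_le\<close>; in particular \<open>J {}\<close> is
  \<open>x\<close>.\<close>

locale atomic_joins =
  fixes M :: "'b set" and P and x :: 'b and At :: "'b set" and J :: "'b set \<Rightarrow> 'b"
  assumes finite_M: "finite M" and poset: "poset_on M P" and x: "x \<in> M"
    and J_in: "S \<subseteq> At \<Longrightarrow> J S \<in> M"
    and J_le: "\<lbrakk>S \<subseteq> At; v \<in> M\<rbrakk> \<Longrightarrow> P (J S) v \<longleftrightarrow> P x v \<and> (\<forall>a\<in>S. P a v)"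
    and At: "a \<in> At \<Longrightarrow> covers M P x a"
begin

definition "below z = {a \<in> At. P a z}"

lemma po_refl: "u \<in> M \<Longrightarrow> P u u"
  and po_antisym: "\<lbrakk>u \<in> M; v \<in> M; P u v; P v u\<rbrakk> \<Longrightarrow> u = v"
  and po_trans: "\<lbrakk>u \<in> M; v \<in> M; w \<in> M; P u v; P v w\<rbrakk> \<Longrightarrow> P u w"
  using poset unfolding poset_on_def by blast+

lemma At_M: "At \<subseteq> M" and At_x: "a \<in> At \<Longrightarrow> \<not> P a x" and finite_At: "finite At"
proof -
  show 1: "At \<subseteq> M" using At unfolding covers_def by blast
  show "\<not> P a x" if "a \<in> At"
    using At[OF that] po_antisym unfolding covers_def by blast
  show "finite At" using 1 finite_M finite_subset by blast
qed

lemma below_At: "below z \<subseteq> At"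
  by (auto simp: below_def)

lemma J_ub: "S \<subseteq> At \<Longrightarrow> a \<in> S \<Longrightarrow> P a (J S)" and x_J: "S \<subseteq> At \<Longrightarrow> P x (J S)"
  using J_le[of S "J S"] J_in po_refl by blast+

lemma J_ne_x: "S \<subseteq> At \<Longrightarrow> S \<noteq> {} \<Longrightarrow> J S \<noteq> x"
  using J_ub At_x by blast

lemma J_below_le: "z \<in> M \<Longrightarrow> P x z \<Longrightarrow> P (J (below z)) z"
  using J_le[OF below_At] by (auto simp: below_def)

lemma below_mono: "\<lbrakk>z \<in> M; z' \<in> M; P z z'\<rbrakk> \<Longrightarrow> below z \<subseteq> below z'"
  using po_trans At_M unfolding below_def by blast

lemma J_mono: "\<lbrakk>S \<subseteq> S'; S' \<subseteq> At\<rbrakk> \<Longrightarrow> P (J S) (J S')"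
  using J_le[of S "J S'"] J_in[of S'] x_J[of S'] J_ub[of S'] by blast

lemma J_below_J: "S \<subseteq> At \<Longrightarrow> J (below (J S)) = J S"
proof (rule po_antisym)
  assume S: "S \<subseteq> At"
  show "J (below (J S)) \<in> M" "J S \<in> M" using S J_in below_At by blast+
  show "P (J (below (J S))) (J S)" using S J_below_le J_in x_J by blast
  have "S \<subseteq> below (J S)" using S J_ub unfolding below_def by blast
  then show "P (J S) (J (below (J S)))" using J_mono below_At by blast
qed

context
  fixes y
  assumes y: "y \<in> M" "P x y" and below_y: "\<And>a. covers M P x a \<Longrightarrow> P a y \<Longrightarrow> a \<in> At"
    and At_y: "\<And>a. a \<in> At \<Longrightarrow> P a y"
begin

abbreviation "OI \<equiv> open_interval M P x y"

lemma finite_OI: "finite OI" and OI_M: "OI \<subseteq> M" and poset_OI: "poset_on OI P"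
proof -
  show 1: "OI \<subseteq> M" by (auto simp: open_interval_def)
  then show "finite OI" using finite_M finite_subset by blast
  show "poset_on OI P" using poset 1 unfolding poset_on_def by blast
qed

lemma below_OI_ne: "z \<in> OI \<Longrightarrow> below z \<noteq> {}"
proof -
  assume z: "z \<in> OI"
  then obtain a where "covers M P x a" "P a z"
    using ex_atom_below[OF finite_M poset x, of z] unfolding open_interval_def by blast
  moreover then have "P a y" using po_trans[of a z y] z y unfolding covers_def open_interval_def by blast
  ultimately show ?thesis using below_y unfolding below_def by blast
qed

lemma J_below_OI: "z \<in> OI \<Longrightarrow> J (below z) \<in> OI"
proof -
  assume z: "z \<in> OI"
  then have zM: "z \<in> M" "P x z" "P z y" "z \<noteq> y" by (auto simp: open_interval_def)
  have 1: "P (J (below z)) z" using J_below_le zM by blast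
  moreover have 2: "J (below z) \<in> M" using J_in below_At by blast
  moreover have "P (J (below z)) y" using po_trans[OF 2 zM(1) y(1) 1 zM(3)] .
  moreover have "J (below z) \<noteq> y" using 1 zM po_antisym y by blast
  ultimately show ?thesis
    using x_J[OF below_At] J_ne_x[OF below_At below_OI_ne[OF z]] unfolding open_interval_def by blast
qed

text \<open>Replacing an element by the join of the atoms below it is order preserving, decreasing
  and idempotent.\<close>

lemma retract: "order_complex_space P OI homotopy_equivalent_space order_complex_space P ((\<lambda>z. J (below z)) ` OI)"
proof (rule order_complex_retract[OF finite_OI poset_OI])
  show "(\<lambda>z. J (below z)) ` OI \<subseteq> OI" using J_below_OI by blast
  show "P (J (below u)) (J (below v))" if "u \<in> OI" "v \<in> OI" "P u v" for u v
    using J_mono below_mono[of u v] below_At that OI_M by blast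
  show "P (J (below u)) u" if "u \<in> OI" for u
    using J_below_le that unfolding open_interval_def by blast
  show "J (below (J (below u))) = J (below u)" for u using J_below_J below_At by blast
qed

text \<open>When the atoms do not join to \<open>y\<close>, their join lies in the open interval and
  is the greatest of the joins of atoms, so the retract is a cone over it.\<close>

lemma nonatomic_contractible:
  assumes "x \<noteq> y" "J At \<noteq> y"
  shows "open_interval_contractible M P x y"
proof -
  have Jy: "P (J At) y" using J_le[of At y] y At_y by blast
  obtain a where a: "covers M P x a" "P a y"
    using ex_atom_below[OF finite_M poset x y(1,2) assms(1)] by blast
  then have aA: "a \<in> At" using below_y by blast
  then have "J At \<noteq> x" using J_ne_x by blast
  then have JO: "J At \<in> OI"
    using Jy assms x_J J_in unfolding open_interval_def by blast
  have bJ: "below (J At) = At" using J_ub unfolding below_def by blast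
  let ?T = "(\<lambda>z. J (below z)) ` OI"
  have T: "?T \<subseteq> OI" using J_below_OI by blast
  \<comment> \<open>The cone point is a greatest element; reversing the order leaves the order
    complex unchanged and makes it a least one.\<close>
  have "contractible_space (order_complex_space (\<lambda>u v. P v u) ?T)"
  proof (rule order_complex_contractible)
    show "finite ?T" using finite_OI by blast
    show "poset_on ?T (\<lambda>u v. P v u)" using poset_OI T unfolding poset_on_def by blast
    show "J At \<in> ?T" using JO bJ by (metis imageI)
    show "P z (J At)" if "z \<in> ?T" for z using that J_mono below_At by blast
  qed
  then have "contractible_space (order_complex_space P ?T)"
    unfolding order_complex_dual[of P] .
  then have "contractible_space (order_complex_space P OI)"
    using homotopy_equivalent_space_contractibility[OF retract] by simp
  then show ?thesis using JO assms unfolding open_interval_contractible_def by blast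
qed

text \<open>\<open>indep\<close> makes \<open>below\<close> inverse to \<open>J\<close>, so the
  joins of atoms in the open interval form the poset of nonempty proper subsets of
  \<open>m + 2\<close> atoms.\<close>

lemma atomic_sphere:
  assumes Jy: "J At = y" and card: "card At = Suc (Suc m)"
    and indep: "\<And>a S. \<lbrakk>S \<subseteq> At; a \<in> At; P a (J S)\<rbrakk> \<Longrightarrow> a \<in> S"
  shows "order_complex_space P OI homotopy_equivalent_space nsphere m"
proof -
  let ?I = "{..Suc m}" and ?T = "(\<lambda>z. J (below z)) ` OI"
  have bJ: "below (J S) = S" if "S \<subseteq> At" for S
    using indep[OF that] J_ub[OF that] that unfolding below_def by blast
  have "card ?I = card At" using card by simp
  then obtain e where e: "bij_betw e ?I At"
    using finite_At by (metis finite_atMost finite_same_card_bij)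
  have einj: "inj_on e ?I" and eim: "e ` ?I = At" using e by (auto simp: bij_betw_def)
  have sub: "e ` A \<subseteq> At" if "A \<subseteq> ?I" for A using that eim by blast
  have PS: "A \<subseteq> ?I" "A \<noteq> {}" "A \<noteq> ?I" if "A \<in> proper_subsets ?I" for A
    using that by (auto simp: proper_subsets_def)
  have JO: "J S \<in> OI" if S: "S \<subseteq> At" "S \<noteq> {}" "S \<noteq> At" for S
  proof -
    have "J S \<noteq> J At" using bJ[OF S(1)] bJ[OF order_refl] S(3) by metis
    then have "J S \<noteq> y" unfolding Jy .
    moreover have "P (J S) y" using J_mono[OF S(1) order_refl] unfolding Jy .
    ultimately show ?thesis using S J_in x_J J_ne_x unfolding open_interval_def by blast
  qed
  have "order_complex_space P ?T homeomorphic_space nsphere m"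
  proof (rule boolean_proper_part_sphere)
    show "bij_betw (\<lambda>A. J (e ` A)) (proper_subsets ?I) ?T"
      unfolding bij_betw_def
    proof
      show "inj_on (\<lambda>A. J (e ` A)) (proper_subsets ?I)"
      proof (rule inj_onI)
        fix A B assume AB: "A \<in> proper_subsets ?I" "B \<in> proper_subsets ?I" "J (e ` A) = J (e ` B)"
        then have "e ` A = e ` B" using bJ[OF sub[OF PS(1)[OF AB(1)]]] bJ[OF sub[OF PS(1)[OF AB(2)]]] by metis
        then show "A = B" using einj PS(1) AB(1,2) by (metis inj_on_image_eq_iff)
      qed
      show "(\<lambda>A. J (e ` A)) ` proper_subsets ?I = ?T"
      proof
        show "(\<lambda>A. J (e ` A)) ` proper_subsets ?I \<subseteq> ?T"
        proof clarify
          fix A assume A: "A \<in> proper_subsets ?I"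
          note s = sub[OF PS(1)[OF A]]
          have "e ` A \<noteq> At" using einj PS[OF A] eim by (metis inj_on_image_eq_iff order_refl)
          then have "J (e ` A) \<in> OI" using JO[OF s] PS(2)[OF A] by blast
          then show "J (e ` A) \<in> ?T" using bJ[OF s] by (metis imageI)
        qed
        show "?T \<subseteq> (\<lambda>A. J (e ` A)) ` proper_subsets ?I"
        proof clarify
          fix z assume z: "z \<in> OI"
          define A where "A = {i \<in> ?I. e i \<in> below z}"
          have eA: "e ` A = below z" using below_At eim unfolding A_def by blast
          have "below z \<noteq> At"
          proof
            assume "below z = At"
            then have "P (J At) z" using J_below_le[of z] z unfolding open_interval_def by simp
            then have "P y z" unfolding Jy .
            then show False using z po_antisym y unfolding open_interval_def by blast
          qed
          then have "A \<in> proper_subsets ?I"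
            using eA eim below_OI_ne[OF z] unfolding proper_subsets_def A_def by blast
          then show "J (below z) \<in> (\<lambda>A. J (e ` A)) ` proper_subsets ?I" using eA by (metis imageI)
        qed
      qed
    qed
    show "P (J (e ` A)) (J (e ` B)) \<longleftrightarrow> A \<subseteq> B"
      if A: "A \<in> proper_subsets ?I" and B: "B \<in> proper_subsets ?I" for A B
    proof
      assume "P (J (e ` A)) (J (e ` B))"
      then have "below (J (e ` A)) \<subseteq> below (J (e ` B))"
        using below_mono J_in sub PS(1) A B by blast
      then have "e ` A \<subseteq> e ` B" using bJ sub PS(1) A B by simp
      then show "A \<subseteq> B" using einj PS(1)[OF A] PS(1)[OF B] by (simp add: inj_on_image_subset_iff)
    next
      assume "A \<subseteq> B"
      then show "P (J (e ` A)) (J (e ` B))" using J_mono sub PS(1)[OF B] by (simp add: image_mono)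
    qed
  qed
  then show ?thesis
    using homotopy_eqv_trans[OF retract] homeomorphic_imp_homotopy_equivalent_space by blast
qed

end

end

section \<open>Shellings of polyhedral cones\<close>

text \<open>The segment from \<open>x\<close> to \<open>p\<close> can be prolonged beyond
  \<open>p\<close> within \<open>G\<close>, where \<open>c\<close> would be positive if it were
  negative at \<open>x\<close>.\<close>

lemma rel_interior_supporting:
  fixes G :: "'a::euclidean_space set"
  assumes "convex G" "p \<in> rel_interior G" "\<And>x. x \<in> G \<Longrightarrow> c \<bullet> x \<le> 0" "c \<bullet> p = 0" "x \<in> G"
  shows "c \<bullet> x = 0"
proof -
  obtain e where e: "e > 1" "(1 - e) *\<^sub>R x + e *\<^sub>R p \<in> G"
    using convex_rel_interior_iff[OF assms(1), of p] assms(2,5) by blast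
  have "c \<bullet> ((1 - e) *\<^sub>R x + e *\<^sub>R p) = (1 - e) * (c \<bullet> x)"
    using assms(4) by (simp add: inner_add_right)
  then have "(1 - e) * (c \<bullet> x) \<le> 0" using assms(3)[OF e(2)] by simp
  then have "0 \<le> c \<bullet> x" using e(1) by (simp add: mult_le_0_iff)
  then show ?thesis using assms(3)[OF assms(5)] by simp
qed

text \<open>\<open>p\<close> is an inner point of the segment from \<open>x\<close> to
  \<open>p + t *\<^sub>R (p - x)\<close>. Membership in faces is established in this form
  throughout: it is enough to take a small step away from \<open>x\<close>.\<close>

lemma face_extend:
  fixes G :: "'a::real_vector set"
  assumes "G face_of S" "p \<in> G" "x \<in> S" "0 < t" "p + t *\<^sub>R (p - x) \<in> S"
  shows "x \<in> G"
proof (cases "x = p")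
  case False
  let ?y = "p + t *\<^sub>R (p - x)"
  have y: "?y = (1 + t) *\<^sub>R p - t *\<^sub>R x" by (simp add: algebra_simps)
  have "(1 / (1 + t)) *\<^sub>R ?y = p - (t / (1 + t)) *\<^sub>R x"
    unfolding y using assms(4) by (simp add: scaleR_diff_right[of _ "(1 + t) *\<^sub>R p" "t *\<^sub>R x"])
  moreover have "1 - 1 / (1 + t) = t / (1 + t)" using assms(4) by (simp add: field_simps)
  ultimately have "p = (1 - 1 / (1 + t)) *\<^sub>R x + (1 / (1 + t)) *\<^sub>R ?y" by simp
  moreover have "0 < 1 / (1 + t)" "1 / (1 + t) < 1" using assms(4) by simp_all
  moreover have "x \<noteq> ?y"
  proof
    assume "x = ?y"
    then have "(1 + t) *\<^sub>R (p - x) = 0" by (simp add: algebra_simps)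
    then show False using assms(4) False by simp
  qed
  ultimately have "p \<in> open_segment x ?y" unfolding in_segment by blast
  then show ?thesis using assms(1-3,5) unfolding face_of_def by blast
qed (use assms(2) in simp)

lemma face_of_cone:
  fixes G :: "'a::real_vector set"
  assumes "G face_of S" "cone S"
  shows "cone G"
  unfolding cone_def
proof (intro ballI allI impI)
  fix x and c :: real assume x: "x \<in> G" and c: "0 \<le> c"
  have xS: "x \<in> S" using x assms(1) face_of_imp_subset by blast
  \<comment> \<open>With this length the step from \<open>x\<close> away from
    \<open>c *\<^sub>R x\<close> ends at the multiple \<open>2 / (1 + c)\<close> of
    \<open>x\<close>, which is still in the cone.\<close>
  let ?t = "1 / (1 + c)"
  have "1 + ?t * (1 - c) = 2 / (1 + c)" using c by (simp add: field_simps)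
  moreover have "x + ?t *\<^sub>R (x - c *\<^sub>R x) = (1 + ?t * (1 - c)) *\<^sub>R x"
    by (simp add: scaleR_add_left scaleR_diff_left scaleR_diff_right right_diff_distrib)
  ultimately have "x + ?t *\<^sub>R (x - c *\<^sub>R x) = (2 / (1 + c)) *\<^sub>R x" by simp
  moreover have "(2 / (1 + c)) *\<^sub>R x \<in> S" "c *\<^sub>R x \<in> S" using assms(2) xS c unfolding cone_def by auto
  ultimately show "c *\<^sub>R x \<in> G"
    using face_extend[OF assms(1) x, of "c *\<^sub>R x" ?t] c by simp
qed

text \<open>A constraint that is slack at \<open>p\<close> survives a small step in any direction;
  only the tight ones restrict \<open>v\<close>.\<close>

lemma small_step:
  fixes p v :: "'a::real_inner"
  assumes "finite K" "\<And>a. a \<in> K \<Longrightarrow> a \<bullet> p \<le> 0" "\<And>a. a \<in> K \<Longrightarrow> a \<bullet> p = 0 \<Longrightarrow> a \<bullet> v \<le> 0"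
  shows "\<exists>e>0. \<forall>t. 0 < t \<and> t \<le> e \<longrightarrow> (\<forall>a\<in>K. a \<bullet> (p + t *\<^sub>R v) \<le> 0)"
  using assms
proof (induction K rule: finite_induct)
  case empty
  show ?case by (intro exI[of _ 1]) auto
next
  case (insert b K)
  then obtain e where e: "e > 0" "\<And>t a. 0 < t \<Longrightarrow> t \<le> e \<Longrightarrow> a \<in> K \<Longrightarrow> a \<bullet> (p + t *\<^sub>R v) \<le> 0" by blast
  have "\<exists>d>0. \<forall>t. 0 < t \<and> t \<le> d \<longrightarrow> b \<bullet> (p + t *\<^sub>R v) \<le> 0"
  proof (cases "b \<bullet> v \<le> 0")
    case True
    then have "b \<bullet> (p + t *\<^sub>R v) \<le> 0" if "0 < t" for t
      using insert.prems(1)[of b] that by (simp add: inner_add_right add_nonpos_nonpos mult_nonneg_nonpos)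
    then show ?thesis by (intro exI[of _ 1]) auto
  next
    case False
    then have neg: "b \<bullet> p < 0" using insert.prems[of b] by fastforce
    define d where "d = - (b \<bullet> p) / (b \<bullet> v)"
    have "d > 0" using False neg by (simp add: d_def divide_neg_pos)
    moreover have "b \<bullet> (p + t *\<^sub>R v) \<le> 0" if "t \<le> d" for t
    proof -
      have "t * (b \<bullet> v) \<le> d * (b \<bullet> v)" using that False by (intro mult_right_mono) auto
      also have "\<dots> = - (b \<bullet> p)" using False by (simp add: d_def)
      finally show ?thesis by (simp add: inner_add_right)
    qed
    ultimately show ?thesis by blast
  qed
  then obtain d where "d > 0" "\<And>t. 0 < t \<Longrightarrow> t \<le> d \<Longrightarrow> b \<bullet> (p + t *\<^sub>R v) \<le> 0" by blast
  then show ?case using e by (intro exI[of _ "min d e"]) auto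
qed

text \<open>An irredundant system of inequalities relative to \<open>span D\<close>, so that it also
  serves the lower-dimensional facets to which a shelling descends. The witnesses in the last two
  conjuncts are a relative interior point of \<open>D\<close> and, for each \<open>a\<close>, a
  point of its facet that is on no other facet.\<close>

definition facet_normals :: "'a::euclidean_space set \<Rightarrow> 'a set \<Rightarrow> bool" where
  "facet_normals D K \<longleftrightarrow> finite K \<and> K \<subseteq> span D \<and> D = {x \<in> span D. \<forall>a\<in>K. a \<bullet> x \<le> 0} \<and>
     {G. G facet_of D} = (\<lambda>a. D \<inter> {x. a \<bullet> x = 0}) ` K \<and> (\<exists>z\<in>D. \<forall>c\<in>K. c \<bullet> z < 0) \<and>
     (\<forall>a\<in>K. \<exists>w\<in>D. a \<bullet> w = 0 \<and> (\<forall>c\<in>K - {a}. c \<bullet> w < 0))"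

lemma cone_zero_in: "cone D \<Longrightarrow> D \<noteq> {} \<Longrightarrow> (0::'a::real_vector) \<in> D"
  unfolding cone_def by fastforce

text \<open>A minimal system of half-spaces for \<open>D\<close> within its affine hull, which is
  the span, has the required form once its offsets are seen to vanish; minimality provides the
  witnesses on the facets.\<close>

lemma ex_facet_normals:
  fixes D :: "'a::euclidean_space set"
  assumes D: "polyhedron D" "cone D" "D \<noteq> {}"
  shows "\<exists>K. facet_normals D K"
proof -
  have D0: "0 \<in> D" using cone_zero_in D by blast
  then have aff: "affine hull D = span D" by (simp add: affine_hull_span_0 hull_inc)
  obtain F where F: "finite F" "D = affine hull D \<inter> \<Inter>F"
    "\<forall>h\<in>F. \<exists>a b. a \<noteq> 0 \<and> h = {x. a \<bullet> x \<le> b} \<and> (\<forall>x\<in>affine hull D. x + a \<in> affine hull D)"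
    "\<forall>F'. F' \<subset> F \<longrightarrow> D \<subset> affine hull D \<inter> \<Inter>F'"
    using D(1) unfolding polyhedron_Int_affine_parallel_minimal by blast
  obtain a where "\<forall>h\<in>F. \<exists>b. a h \<noteq> 0 \<and> h = {x. a h \<bullet> x \<le> b} \<and> (\<forall>x\<in>affine hull D. x + a h \<in> affine hull D)"
    using bchoice[OF F(3)] by blast
  from bchoice[OF this] obtain b where b: "\<forall>h\<in>F. a h \<noteq> 0 \<and> h = {x. a h \<bullet> x \<le> b h} \<and>
      (\<forall>x\<in>affine hull D. x + a h \<in> affine hull D)" by blast
  then have ab: "\<And>h. h \<in> F \<Longrightarrow> a h \<noteq> 0 \<and> h = {x. a h \<bullet> x \<le> b h}" by blast
  have par: "\<And>h x. h \<in> F \<Longrightarrow> x \<in> affine hull D \<Longrightarrow> x + a h \<in> affine hull D" using b by blast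
  have min: "D \<subset> affine hull D \<inter> \<Inter>F'" if "F' \<subset> F" for F'
    using F(4)[rule_format, OF that] .
  note fac = facet_of_polyhedron_explicit[OF F(1,2) ab min]
  note ri = rel_interior_polyhedron_explicit[OF F(1,2) ab min]
  have le: "a h \<bullet> x \<le> b h" if "h \<in> F" "x \<in> D" for h x
  proof -
    have "x \<in> affine hull D \<inter> \<Inter>F" using that(2) F(2) by simp
    then have "x \<in> h" using that(1) by blast
    then show ?thesis using ab[OF that(1)] by blast
  qed
  \<comment> \<open>The facet contains some \<open>x\<close> of value \<open>b h\<close>. Since
    \<open>2 *\<^sub>R x\<close> and \<open>0\<close> lie in \<open>D\<close> as well,
    \<open>b h\<close> is neither positive nor negative.\<close>
  have b0: "b h = 0" if h: "h \<in> F" for h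
  proof -
    have "(D \<inter> {x. a h \<bullet> x = b h}) facet_of D" using fac h by blast
    then obtain x where x: "x \<in> D" "a h \<bullet> x = b h" by (auto simp: facet_of_def)
    have "2 *\<^sub>R x \<in> D" using x D(2) unfolding cone_def by simp
    then have "a h \<bullet> (2 *\<^sub>R x) \<le> b h" using le[OF h] by blast
    then show ?thesis using le[OF h D0] x(2) by simp
  qed
  let ?K = "a ` F"
  have Deq: "D = {x \<in> span D. \<forall>c\<in>?K. c \<bullet> x \<le> 0}"
  proof
    show "D \<subseteq> {x \<in> span D. \<forall>c\<in>?K. c \<bullet> x \<le> 0}" using le b0 by (auto simp: span_base)
    show "{x \<in> span D. \<forall>c\<in>?K. c \<bullet> x \<le> 0} \<subseteq> D"
    proof
      fix x assume x: "x \<in> {x \<in> span D. \<forall>c\<in>?K. c \<bullet> x \<le> 0}"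
      have "x \<in> h" if "h \<in> F" for h
      proof -
        have "a h \<bullet> x \<le> b h" using that x b0 by simp
        then show ?thesis using ab[OF that] by blast
      qed
      then show "x \<in> D" by (subst F(2)) (use x aff in auto)
    qed
  qed
  have "convex D" using D(1) by (rule polyhedron_imp_convex)
  then have "rel_interior D \<noteq> {}" using D(3) by (simp add: rel_interior_eq_empty)
  then obtain z where z: "z \<in> rel_interior D" by blast
  then have zD: "z \<in> D" using rel_interior_subset by blast
  have zneg: "a h \<bullet> z < 0" if "h \<in> F" for h using z ri b0[OF that] that by auto
  have wit: "\<exists>w\<in>D. a h \<bullet> w = 0 \<and> (\<forall>c\<in>?K - {a h}. c \<bullet> w < 0)" if h: "h \<in> F" for h
  proof -
    \<comment> \<open>Dropping \<open>h\<close> admits a point \<open>y\<close> beyond it; the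
      witness \<open>w\<close> is the point where the segment from the interior point
      \<open>z\<close> to \<open>y\<close> crosses the hyperplane of \<open>h\<close>.\<close>
    have "F - {h} \<subset> F" using h by blast
    from min[OF this] obtain y where y: "y \<in> span D" "y \<notin> D" "\<And>h'. h' \<in> F \<Longrightarrow> h' \<noteq> h \<Longrightarrow> y \<in> h'" using aff by blast
    have ynp: "a h' \<bullet> y \<le> 0" if "h' \<in> F" "h' \<noteq> h" for h'
    proof -
      have "a h' \<bullet> y \<le> b h'" using y(3)[OF that] ab[OF that(1)] by blast
      then show ?thesis using b0[OF that(1)] by simp
    qed
    have "y \<notin> h"
    proof
      assume "y \<in> h"
      then have "\<forall>h'\<in>F. y \<in> h'" using y(3) by blast
      then have "y \<in> affine hull D \<inter> \<Inter>F" using y(1) aff by simp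
      then show False using y(2) F(2) by simp
    qed
    then have "\<not> a h \<bullet> y \<le> b h" using ab[OF h] by blast
    then have yp: "a h \<bullet> y > 0" using b0[OF h] by simp
    define t where "t = (a h \<bullet> z) / (a h \<bullet> z - a h \<bullet> y)"
    have den: "a h \<bullet> z - a h \<bullet> y < 0" using zneg[OF h] yp by simp
    then have t: "0 < t" "t < 1" using zneg[OF h] yp
      by (simp_all add: t_def divide_neg_neg divide_less_eq)
    define w where "w = (1 - t) *\<^sub>R z + t *\<^sub>R y"
    have "a h \<bullet> w = a h \<bullet> z - t * (a h \<bullet> z - a h \<bullet> y)"
      by (simp add: w_def inner_add_right algebra_simps)
    also have "t * (a h \<bullet> z - a h \<bullet> y) = a h \<bullet> z" using den by (simp add: t_def)
    finally have w0: "a h \<bullet> w = 0" by simp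
    have wneg: "a h' \<bullet> w < 0" if "h' \<in> F" "h' \<noteq> h" for h'
    proof -
      have "a h' \<bullet> w = (1 - t) * (a h' \<bullet> z) + t * (a h' \<bullet> y)" by (simp add: w_def inner_add_right)
      moreover have "(1 - t) * (a h' \<bullet> z) < 0" using t zneg[OF that(1)] by (simp add: mult_pos_neg)
      moreover have "t * (a h' \<bullet> y) \<le> 0" using t ynp[OF that] by (simp add: mult_nonneg_nonpos)
      ultimately show ?thesis by simp
    qed
    have "w \<in> span D" unfolding w_def using span_base[OF zD] y(1) by (intro span_add span_scale)
    moreover have "c \<bullet> w \<le> 0" if c: "c \<in> ?K" for c
    proof -
      obtain h' where "h' \<in> F" "c = a h'" using c by blast
      then show ?thesis using w0 wneg[of h'] by (cases "h' = h") auto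
    qed
    ultimately have "w \<in> D" by (subst Deq) blast
    moreover have "c \<bullet> w < 0" if "c \<in> ?K - {a h}" for c using that wneg by blast
    ultimately show ?thesis using w0 by blast
  qed
  have "{G. G facet_of D} = (\<lambda>c. D \<inter> {x. c \<bullet> x = 0}) ` ?K"
  proof (rule set_eqI)
    fix G
    have "G facet_of D \<longleftrightarrow> (\<exists>h. h \<in> F \<and> G = D \<inter> {x. a h \<bullet> x = b h})" by (rule fac)
    also have "\<dots> \<longleftrightarrow> (\<exists>h\<in>F. G = D \<inter> {x. a h \<bullet> x = 0})"
      unfolding Bex_def by (intro iff_exI conj_cong refl) (simp add: b0)
    finally have "G facet_of D \<longleftrightarrow> (\<exists>h\<in>F. G = D \<inter> {x. a h \<bullet> x = 0})" .
    then show "G \<in> {G. G facet_of D} \<longleftrightarrow> G \<in> (\<lambda>c. D \<inter> {x. c \<bullet> x = 0}) ` ?K" by blast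
  qed
  moreover have "?K \<subseteq> span D"
  proof clarify
    fix h assume h: "h \<in> F"
    show "a h \<in> span D" using par[OF h, of 0] D0 aff by (simp add: span_0)
  qed
  ultimately have "facet_normals D ?K"
    unfolding facet_normals_def
  proof (intro conjI)
    show "finite ?K" using F(1) by simp
    show "\<exists>z\<in>D. \<forall>c\<in>?K. c \<bullet> z < 0" using zD zneg by blast
    show "\<forall>c\<in>?K. \<exists>w\<in>D. c \<bullet> w = 0 \<and> (\<forall>c'\<in>?K - {c}. c' \<bullet> w < 0)" using wit by blast
  qed (assumption, rule Deq, assumption)
  then show ?thesis by blast
qed

text \<open>Visibility from far away in the direction \<open>u\<close>. It is phrased by points and
  not by normals, so that in the fan it can be read off from the cone that contains
  \<open>p + e *\<^sub>R u\<close>.\<close>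

definition sees :: "'a::euclidean_space set \<Rightarrow> 'a \<Rightarrow> 'a set \<Rightarrow> bool" where
  "sees D u G \<longleftrightarrow> (\<forall>p\<in>rel_interior G. \<forall>e>0. p + e *\<^sub>R u \<notin> D)"

text \<open>For \<open>u\<close> in \<open>span D\<close> this says, without mentioning normals,
  that \<open>u\<close> lies in no hyperplane of \<open>span D\<close> spanned by a facet.\<close>

definition transversal :: "'a::euclidean_space set \<Rightarrow> 'a \<Rightarrow> bool" where
  "transversal D u \<longleftrightarrow> (\<forall>G. G facet_of D \<longrightarrow> (\<forall>p\<in>rel_interior G. \<forall>e>0. p + e *\<^sub>R u \<notin> D \<or> p - e *\<^sub>R u \<notin> D))"

locale polyhedral_cone =
  fixes D :: "'a::euclidean_space set" and K
  assumes poly: "polyhedron D" and cone: "cone D" and ne: "D \<noteq> {}" and K: "facet_normals D K"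
begin

definition "facet a = D \<inter> {x. a \<bullet> x = 0}"

lemma K_rules: "finite K" "K \<subseteq> span D" "D = {x \<in> span D. \<forall>a\<in>K. a \<bullet> x \<le> 0}"
  "{G. G facet_of D} = facet ` K" "\<exists>z\<in>D. \<forall>c\<in>K. c \<bullet> z < 0"
  "a \<in> K \<Longrightarrow> \<exists>w\<in>D. a \<bullet> w = 0 \<and> (\<forall>c\<in>K - {a}. c \<bullet> w < 0)"
  using K unfolding facet_normals_def facet_def by blast+

lemma K_le: "a \<in> K \<Longrightarrow> x \<in> D \<Longrightarrow> a \<bullet> x \<le> 0"
  using K_rules(3) by blast

lemma in_D: "x \<in> span D \<Longrightarrow> (\<And>a. a \<in> K \<Longrightarrow> a \<bullet> x \<le> 0) \<Longrightarrow> x \<in> D"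
  using K_rules(3) by blast

lemma facet_facet: "a \<in> K \<Longrightarrow> facet a facet_of D"
  using K_rules(4) by blast

lemma facet_convex: "a \<in> K \<Longrightarrow> convex (facet a)"
  using facet_facet face_of_imp_convex unfolding facet_of_def by blast

lemma rel_interior_facet_ne: "a \<in> K \<Longrightarrow> rel_interior (facet a) \<noteq> {}"
  using facet_facet facet_convex unfolding facet_of_def by (simp add: rel_interior_eq_empty)

text \<open>A further normal vanishing at \<open>p\<close> would vanish on the whole facet, in
  particular at its witness.\<close>

lemma rel_interior_facet:
  assumes a: "a \<in> K" and p: "p \<in> rel_interior (facet a)"
  shows "p \<in> D" "a \<bullet> p = 0" "c \<in> K \<Longrightarrow> c \<noteq> a \<Longrightarrow> c \<bullet> p < 0"
proof -
  have "p \<in> facet a" using p rel_interior_subset by blast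
  then show pD: "p \<in> D" "a \<bullet> p = 0" by (auto simp: facet_def)
  assume c: "c \<in> K" "c \<noteq> a"
  obtain w where w: "w \<in> D" "a \<bullet> w = 0" "c \<bullet> w < 0" using K_rules(6)[OF a] c by blast
  show "c \<bullet> p < 0"
  proof (rule ccontr)
    assume "\<not> c \<bullet> p < 0"
    then have "c \<bullet> p = 0" using K_le[OF c(1) pD(1)] by simp
    then have "c \<bullet> w = 0"
      using rel_interior_supporting[OF facet_convex[OF a] p _ _, where c = c and x = w] K_le[OF c(1)] w
      by (auto simp: facet_def)
    then show False using w by simp
  qed
qed

lemma facet_inj: "inj_on facet K"
proof (rule inj_onI, rule ccontr)
  fix a c assume h: "a \<in> K" "c \<in> K" "facet a = facet c" "a \<noteq> c"
  obtain p where "p \<in> rel_interior (facet a)" using rel_interior_facet_ne h by blast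
  then show False using rel_interior_facet(3)[of a p c] rel_interior_facet(2)[of c p] h by auto
qed

lemma step:
  assumes "p \<in> D" "v \<in> span D" "\<And>a. a \<in> K \<Longrightarrow> a \<bullet> p = 0 \<Longrightarrow> a \<bullet> v \<le> 0"
  shows "\<exists>e>0. \<forall>t. 0 < t \<and> t \<le> e \<longrightarrow> p + t *\<^sub>R v \<in> D"
proof -
  obtain e where "e > 0" "\<forall>t. 0 < t \<and> t \<le> e \<longrightarrow> (\<forall>a\<in>K. a \<bullet> (p + t *\<^sub>R v) \<le> 0)"
    using small_step[OF K_rules(1), of p v] K_le assms by blast
  moreover have "p + t *\<^sub>R v \<in> span D" for t
    using assms(1,2) by (intro span_add span_scale) (auto simp: span_base)
  ultimately show ?thesis using in_D by blast
qed

lemma sees_facet: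
  assumes a: "a \<in> K" and u: "u \<in> span D"
  shows "sees D u (facet a) \<longleftrightarrow> 0 < a \<bullet> u"
proof
  assume S: "sees D u (facet a)"
  obtain p where p: "p \<in> rel_interior (facet a)" using rel_interior_facet_ne a by blast
  show "0 < a \<bullet> u"
  proof (rule ccontr)
    assume "\<not> 0 < a \<bullet> u"
    then obtain e where "e > 0" "p + e *\<^sub>R u \<in> D"
    proof -
      have "c \<bullet> u \<le> 0" if "c \<in> K" "c \<bullet> p = 0" for c
        using rel_interior_facet(3)[OF a p that(1)] that(2) \<open>\<not> 0 < a \<bullet> u\<close> by (cases "c = a") auto
      then show ?thesis using step[OF rel_interior_facet(1)[OF a p] u] that by blast
    qed
    then show False using S p unfolding sees_def by blast
  qed
next
  assume pos: "0 < a \<bullet> u"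
  show "sees D u (facet a)" unfolding sees_def
  proof (intro ballI allI impI notI)
    fix p and e :: real assume p: "p \<in> rel_interior (facet a)" "e > 0" "p + e *\<^sub>R u \<in> D"
    have "a \<bullet> (p + e *\<^sub>R u) = e * (a \<bullet> u)" using rel_interior_facet(2)[OF a p(1)] by (simp add: inner_add_right)
    then show False using K_le[OF a p(3)] pos p(2) by (simp add: mult_le_0_iff)
  qed
qed

lemma seen_facet_at:
  assumes p: "p \<in> D" and u: "u \<in> span D" and out: "\<And>e. e > 0 \<Longrightarrow> p + e *\<^sub>R u \<notin> D"
  shows "\<exists>a\<in>K. a \<bullet> p = 0 \<and> 0 < a \<bullet> u"
proof (rule ccontr)
  assume "\<not> ?thesis"
  then have "a \<bullet> u \<le> 0" if "a \<in> K" "a \<bullet> p = 0" for a using that not_less by blast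
  then show False using step[OF p u] out by blast
qed

lemma span_facet:
  assumes a: "a \<in> K" and w: "w \<in> span D" "a \<bullet> w = 0"
  shows "w \<in> span (facet a)"
proof -
  obtain p where p: "p \<in> rel_interior (facet a)" using rel_interior_facet_ne a by blast
  have pf: "p \<in> facet a" using p rel_interior_subset by blast
  obtain e where e: "e > 0" "p + e *\<^sub>R w \<in> D"
  proof -
    have "c \<bullet> w \<le> 0" if "c \<in> K" "c \<bullet> p = 0" for c
      using rel_interior_facet(3)[OF a p that(1)] that(2) w(2) by (cases "c = a") auto
    then show ?thesis using step[OF rel_interior_facet(1)[OF a p] w(1)] that by blast
  qed
  then have "p + e *\<^sub>R w \<in> facet a" using rel_interior_facet(2)[OF a p] w by (simp add: facet_def inner_add_right)
  then have "(p + e *\<^sub>R w) - p \<in> span (facet a)" using pf by (intro span_diff) (auto simp: span_base)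
  then have "e *\<^sub>R w \<in> span (facet a)" by simp
  then have "(1 / e) *\<^sub>R (e *\<^sub>R w) \<in> span (facet a)" by (rule span_scale)
  then show ?thesis using e by simp
qed

lemma transversal_ne:
  assumes T: "transversal D u" and u: "u \<in> span D" and a: "a \<in> K"
  shows "a \<bullet> u \<noteq> 0"
proof
  assume 0: "a \<bullet> u = 0"
  obtain p where p: "p \<in> rel_interior (facet a)" using rel_interior_facet_ne a by blast
  have "\<exists>e>0. \<forall>t. 0 < t \<and> t \<le> e \<longrightarrow> p + t *\<^sub>R v \<in> D" if "v = u \<or> v = - u" for v
  proof (rule step)
    show "p \<in> D" using rel_interior_facet(1)[OF a p] .
    show "v \<in> span D" using that u by (auto simp: span_neg)
    show "c \<bullet> v \<le> 0" if "c \<in> K" "c \<bullet> p = 0" for c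
      using rel_interior_facet(3)[OF a p that(1)] that(2) 0 \<open>v = u \<or> v = - u\<close> by (cases "c = a") auto
  qed
  from this[of u] this[of "- u"] obtain e e' where e: "e > 0" "\<And>t. 0 < t \<Longrightarrow> t \<le> e \<Longrightarrow> p + t *\<^sub>R u \<in> D"
    "e' > 0" "\<And>t. 0 < t \<Longrightarrow> t \<le> e' \<Longrightarrow> p + t *\<^sub>R (- u) \<in> D" by blast
  have "p + min e e' *\<^sub>R u \<in> D" "p - min e e' *\<^sub>R u \<in> D"
    using e(2)[of "min e e'"] e(4)[of "min e e'"] e(1,3) by auto
  moreover have "min e e' > 0" using e by simp
  ultimately show False using T facet_facet[OF a] p unfolding transversal_def by blast
qed

text \<open>Orthogonality to \<open>w\<close> is destroyed by a step along \<open>w\<close> itself,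
  small enough to keep the finitely many strict conditions already achieved.\<close>

lemma generic_point:
  assumes "finite W" "W \<subseteq> span D" "0 \<notin> W"
  shows "\<exists>q\<in>D. (\<forall>c\<in>K. c \<bullet> q < 0) \<and> (\<forall>w\<in>W. w \<bullet> q \<noteq> 0)"
  using assms
proof (induction W rule: finite_induct)
  case empty
  then show ?case using K_rules(5) by blast
next
  case (insert w W)
  then obtain q where q: "q \<in> D" "\<And>c. c \<in> K \<Longrightarrow> c \<bullet> q < 0" "\<And>v. v \<in> W \<Longrightarrow> v \<bullet> q \<noteq> 0" by blast
  have ev: "\<forall>\<^sub>F t in at_right 0. (\<forall>c\<in>K. c \<bullet> (q + t *\<^sub>R w) < 0) \<and> (\<forall>v\<in>W. v \<bullet> (q + t *\<^sub>R w) \<noteq> 0) \<and> (t::real) > 0"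
  proof (intro eventually_conj eventually_ball_finite K_rules(1) insert.hyps ballI)
    have lim: "((\<lambda>t. c \<bullet> (q + t *\<^sub>R w)) \<longlongrightarrow> c \<bullet> (q + 0 *\<^sub>R w)) (at_right 0)" for c
      by (intro tendsto_intros)
    show "\<forall>\<^sub>F t in at_right 0. c \<bullet> (q + t *\<^sub>R w) < 0" if "c \<in> K" for c
      using order_tendstoD(2)[OF lim[of c], of 0] q(2)[OF that] by simp
    show "\<forall>\<^sub>F t in at_right 0. c \<bullet> (q + t *\<^sub>R w) \<noteq> 0" if "c \<in> W" for c
      using tendsto_imp_eventually_ne[OF lim[of c], of 0] q(3)[OF that] by simp
    show "\<forall>\<^sub>F t in at_right 0. (t::real) > 0" by (rule eventually_at_right_less)
  qed
  show ?case
  proof (cases "w \<bullet> q = 0")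
    case False
    then show ?thesis using q by blast
  next
    case True
    obtain t where t: "\<forall>c\<in>K. c \<bullet> (q + t *\<^sub>R w) < 0" "\<forall>v\<in>W. v \<bullet> (q + t *\<^sub>R w) \<noteq> 0" "t > 0"
      using eventually_happens[OF ev] by (auto simp: trivial_limit_at_right_real)
    have "w \<noteq> 0" using insert.prems by auto
    then have "w \<bullet> (q + t *\<^sub>R w) \<noteq> 0" using True t(3) by (simp add: inner_add_right)
    moreover have "q + t *\<^sub>R w \<in> D"
      using t(1) q(1) insert.prems
      by (intro in_D span_add span_scale) (auto simp: span_base less_imp_le)
    ultimately show ?thesis using t by blast
  qed
qed

end

section \<open>Line shellings\<close>

lemma sorted_wrt_take:
  fixes l :: "'b \<Rightarrow> real"
  assumes "sorted_wrt (\<lambda>a b. l b < l a) xs" "j < length xs"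
  shows "set (take j xs) = {c \<in> set xs. l (xs ! j) < l c}"
proof -
  have lt: "l (xs ! i') < l (xs ! i)" if "i < i'" "i' < length xs" for i i'
    using sorted_wrt_nth_less[OF assms(1) that] .
  show ?thesis
  proof (intro set_eqI iffI)
    fix c assume "c \<in> set (take j xs)"
    then obtain i where "i < j" "c = xs ! i" using assms(2) by (auto simp: in_set_conv_nth)
    then show "c \<in> {c \<in> set xs. l (xs ! j) < l c}" using lt[of i j] assms(2) by auto
  next
    fix c assume "c \<in> {c \<in> set xs. l (xs ! j) < l c}"
    then obtain i where i: "i < length xs" "c = xs ! i" "l (xs ! j) < l c" by (auto simp: in_set_conv_nth)
    then have "i < j" using lt[of j i] by (cases i j rule: linorder_cases) auto
    then show "c \<in> set (take j xs)" using i assms(2) by (auto simp: in_set_conv_nth intro!: exI[of _ i])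
  qed
qed

lemma sorted_wrt_take_positive:
  fixes l :: "'b \<Rightarrow> real"
  assumes "sorted_wrt (\<lambda>a b. l b < l a) xs"
  shows "take (length (filter (\<lambda>c. 0 < l c) xs)) xs = filter (\<lambda>c. 0 < l c) xs"
  using assms
proof (induction xs)
  case (Cons a xs)
  then have "filter (\<lambda>c. 0 < l c) xs = []" if "\<not> 0 < l a"
    using that by (fastforce simp: filter_empty_conv)
  then show ?case using Cons by auto
qed simp

lemma ex_sorted_enumeration:
  fixes l :: "'b \<Rightarrow> real"
  assumes "finite K" "inj_on l K"
  shows "\<exists>xs. distinct xs \<and> set xs = K \<and> sorted_wrt (\<lambda>a b. l b < l a) xs"
proof -
  define ys where "ys = rev (sorted_list_of_set (l ` K))"
  have ys: "set ys = l ` K" "distinct ys" "sorted_wrt (>) ys"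
    using assms(1) by (simp_all add: ys_def sorted_wrt_rev)
  let ?f = "inv_into K l"
  have f: "?f y \<in> K" "l (?f y) = y" if "y \<in> set ys" for y
    using that ys(1) by (simp_all add: inv_into_into f_inv_into_f)
  have "distinct (map ?f ys)"
    using ys(1,2) inj_on_inv_into[of "set ys" l K] by (simp add: distinct_map)
  moreover have "set (map ?f ys) = K"
    using assms(2) ys(1) by (auto simp: inv_into_f_f)
  moreover have "sorted_wrt (\<lambda>a b. l b < l a) (map ?f ys)"
    unfolding sorted_wrt_map by (rule sorted_wrt_mono_rel[OF _ ys(3)]) (simp add: f)
  ultimately show ?thesis by blast
qed

text \<open>The recursion of \<open>shell\<close> is followed to arbitrary depth, hence past the
  cone \<open>{0}\<close>. Its only facet in the sense of \<open>cone_facets\<close> is the empty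
  face, which has none.\<close>

lemma shell_singleton_empty: "shell k [{} :: 'a::euclidean_space set]"
proof (cases k)
  case (Suc k')
  have "cone_facets ({} :: 'a set) = {}" by (auto simp: cone_facets_def)
  moreover have "shell k' ([] :: 'a set list)" by (cases k') simp_all
  ultimately show ?thesis using Suc by (auto intro: exI[of _ "[]"])
qed simp

text \<open>In dimension 0 the two sides differ: \<open>cone_facets\<close> admits the empty face,
  \<open>facet_of\<close> does not.\<close>

lemma cone_facets_eq:
  assumes "0 < aff_dim D"
  shows "cone_facets D = {G. G facet_of D}"
  using assms unfolding cone_facets_def facet_of_def by auto

text \<open>What \<open>shell\<close> asks of a later cell, with the facets seen in direction
  \<open>u\<close> in place of those shared with earlier cells.\<close>

definition visible_first :: "nat \<Rightarrow> 'a::euclidean_space set \<Rightarrow> 'a \<Rightarrow> bool" where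
  "visible_first k D u \<longleftrightarrow> (\<exists>Gs. distinct Gs \<and> set Gs = cone_facets D \<and> shell k Gs \<and>
    set (take (card {G \<in> cone_facets D. sees D u G}) Gs) = {G \<in> cone_facets D. sees D u G})"

text \<open>A line shelling: the facets are met in the order of decreasing \<open>l a\<close> by the line through a generic
  interior point \<open>q\<close> with direction \<open>u\<close>, and \<open>u + l a *\<^sub>R q\<close> is the point (up to scaling) where
  the line meets the span of the facet with normal \<open>a\<close>.\<close>
lemma visible_first_step:
  fixes D :: "'a::euclidean_space set"
  assumes D: "polyhedron D" "cone D" "D \<noteq> {}" and u: "u \<in> span D" and T: "transversal D u"
    and IH: "\<And>k' (D :: 'a set) u. \<lbrakk>k = Suc k'; polyhedron D; cone D; D \<noteq> {}; u \<in> span D; transversal D u\<rbrakk> \<Longrightarrow>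
        visible_first k' D u"
  shows "visible_first k D u"
proof (cases "aff_dim D = 0")
  case True
  then obtain x where "D = {x}" by (auto simp: aff_dim_eq_0)
  then have D0: "D = {0}" using cone_zero_in D(2,3) by blast
  \<comment> \<open>The empty face is seen vacuously, as it has no points.\<close>
  have "cone_facets D = {{}}" unfolding cone_facets_def D0 by (auto simp: aff_dim_empty[symmetric])
  moreover have "sees D u {}" by (simp add: sees_def)
  ultimately have "{G \<in> cone_facets D. sees D u G} = {{}}" by auto
  then show ?thesis unfolding visible_first_def using \<open>cone_facets D = {{}}\<close> shell_singleton_empty
    by (intro exI[of _ "[{}]"]) auto
next
  case False
  have "aff_dim D \<ge> 0" using D(3) aff_dim_negative_iff[of D] by linarith
  then have cf: "cone_facets D = {G. G facet_of D}" using False by (intro cone_facets_eq) simp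
  obtain K where "facet_normals D K" using ex_facet_normals D by blast
  then interpret polyhedral_cone D K using D by unfold_locales
  have un: "a \<bullet> u \<noteq> 0" if "a \<in> K" for a using transversal_ne[OF T u that] .
  \<comment> \<open>\<open>q\<close> has to avoid the hyperplanes orthogonal to these vectors, on
    which \<open>l\<close> would take the same value at two normals.\<close>
  define W where "W = (\<lambda>(a, b). (a \<bullet> u) *\<^sub>R b - (b \<bullet> u) *\<^sub>R a) ` {(a, b). a \<in> K \<and> b \<in> K \<and> a \<noteq> b}"
  have "{(a, b). a \<in> K \<and> b \<in> K \<and> a \<noteq> b} \<subseteq> K \<times> K" by blast
  then have "finite {(a, b). a \<in> K \<and> b \<in> K \<and> a \<noteq> b}"
    using finite_cartesian_product[OF K_rules(1) K_rules(1)] by (rule finite_subset)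
  then have "finite W" unfolding W_def by (rule finite_imageI)
  moreover have "W \<subseteq> span D"
  proof
    fix v assume "v \<in> W"
    then obtain a b where "a \<in> K" "b \<in> K" "v = (a \<bullet> u) *\<^sub>R b - (b \<bullet> u) *\<^sub>R a" by (auto simp: W_def)
    then show "v \<in> span D" using K_rules(2) by (auto intro: span_diff span_scale)
  qed
  moreover have "0 \<notin> W"
  proof
    assume "0 \<in> W"
    then obtain a b where ab: "a \<in> K" "b \<in> K" "a \<noteq> b" "(a \<bullet> u) *\<^sub>R b = (b \<bullet> u) *\<^sub>R a"
      by (auto simp: W_def)
    obtain w where w: "a \<bullet> w = 0" "b \<bullet> w < 0" using K_rules(6)[OF ab(1)] ab by blast
    have "(a \<bullet> u) * (b \<bullet> w) = (b \<bullet> u) * (a \<bullet> w)" using ab(4) by (metis inner_scaleR_left)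
    then show False using w un[OF ab(1)] by simp
  qed
  ultimately have "\<exists>q\<in>D. (\<forall>c\<in>K. c \<bullet> q < 0) \<and> (\<forall>w\<in>W. w \<bullet> q \<noteq> 0)" by (rule generic_point)
  then obtain q where q': "q \<in> D" "\<forall>c\<in>K. c \<bullet> q < 0" "\<forall>w\<in>W. w \<bullet> q \<noteq> 0" by (elim bexE conjE)
  note q = q'(1) bspec[OF q'(2)] bspec[OF q'(3)]
  define l where "l a = (a \<bullet> u) / - (a \<bullet> q)" for a
  have inj: "inj_on l K"
  proof (rule inj_onI, rule ccontr)
    fix a b assume ab: "a \<in> K" "b \<in> K" "l a = l b" "a \<noteq> b"
    then have "(a \<bullet> u) * (b \<bullet> q) = (b \<bullet> u) * (a \<bullet> q)"
      using q(2)[of a] q(2)[of b] by (simp add: l_def field_simps)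
    then have "((a \<bullet> u) *\<^sub>R b - (b \<bullet> u) *\<^sub>R a) \<bullet> q = 0" by (simp add: inner_diff_left)
    moreover have "(a \<bullet> u) *\<^sub>R b - (b \<bullet> u) *\<^sub>R a \<in> W" unfolding W_def using ab by force
    ultimately show False using q(3) by blast
  qed
  obtain xs where xs: "distinct xs" "set xs = K" "sorted_wrt (\<lambda>a b. l b < l a) xs"
    using ex_sorted_enumeration[OF K_rules(1) inj] by blast
  let ?Gs = "map facet xs"
  have cfK: "cone_facets D = facet ` K" using cf K_rules(4) by simp
  have pos: "sees D u (facet a) \<longleftrightarrow> 0 < l a" if "a \<in> K" for a
    using sees_facet[OF that u] q(2)[OF that] by (auto simp: l_def divide_less_0_iff)
  have V: "{G \<in> cone_facets D. sees D u G} = facet ` {a \<in> K. 0 < l a}"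
    unfolding cfK using pos by auto
  have "card (facet ` {a \<in> K. 0 < l a}) = card {a \<in> K. 0 < l a}"
    by (rule card_image) (use facet_inj in \<open>auto simp: inj_on_def\<close>)
  also have "\<dots> = length (filter (\<lambda>c. 0 < l c) xs)"
    using distinct_card[OF distinct_filter[OF xs(1)], of "\<lambda>c. 0 < l c"] xs(2) by simp
  finally have "take (card (facet ` {a \<in> K. 0 < l a})) ?Gs = map facet (filter (\<lambda>c. 0 < l c) xs)"
    using sorted_wrt_take_positive[OF xs(3)] by (simp add: take_map)
  then have first: "set (take (card {G \<in> cone_facets D. sees D u G}) ?Gs) = {G \<in> cone_facets D. sees D u G}"
    unfolding V using xs(2) by simp
  have dist: "distinct ?Gs" using xs facet_inj by (simp add: distinct_map)
  have "shell k ?Gs"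
  proof (cases k)
    case (Suc k')
    define w where "w a = u + l a *\<^sub>R q" for a
    have wD: "w a \<in> span D" for a unfolding w_def using u q(1) by (intro span_add span_scale) (auto simp: span_base)
    have cw: "c \<bullet> w a = - (c \<bullet> q) * (l c - l a)" if "c \<in> K" for a c
    proof -
      have "(c \<bullet> q) * l c = - (c \<bullet> u)" using q(2)[OF that] by (simp add: l_def)
      then show ?thesis by (simp add: w_def inner_add_right right_diff_distrib)
    qed
    have aw: "a \<bullet> w a = 0" if "a \<in> K" for a using cw[OF that] by simp
    \<comment> \<open>On \<open>facet a\<close>, the direction \<open>w a\<close> leads out through
      the hyperplane of \<open>c\<close> exactly if \<open>c\<close> comes before \<open>a\<close>
      in the list. So \<open>w a\<close> is the direction for the induction: the part of the
      boundary of \<open>facet a\<close> shared with earlier facets is the part it sees.\<close>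
    have cwpos: "0 < c \<bullet> w a \<longleftrightarrow> l a < l c" if "c \<in> K" for a c
      using q(2)[OF that] unfolding cw[OF that] by (simp add: mult_less_0_iff)
    have cwne: "c \<bullet> w a \<noteq> 0" if "c \<in> K" "a \<in> K" "c \<noteq> a" for a c
      using q(2)[OF that(1)] inj that unfolding cw[OF that(1)] by (auto simp: inj_on_def)
    have step_in: "p + e *\<^sub>R w a \<in> facet a \<longleftrightarrow> p + e *\<^sub>R w a \<in> D" if "a \<in> K" "a \<bullet> p = 0" for a p e
      using aw[OF that(1)] that(2) by (simp add: facet_def inner_add_right)
    have fpoly: "polyhedron (facet a)" "cone (facet a)" "facet a \<noteq> {}" if "a \<in> K" for a
    proof -
      have f: "facet a facet_of D" using facet_facet[OF that] .
      then show "polyhedron (facet a)" using poly face_of_polyhedron_polyhedron unfolding facet_of_def by blast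
      show "facet a \<noteq> {}" using f unfolding facet_of_def by blast
      show "cone (facet a)" using cone unfolding cone_def facet_def by auto
    qed
    have wspan: "w a \<in> span (facet a)" if "a \<in> K" for a
      using span_facet[OF that wD aw[OF that]] .
    have wtrans: "transversal (facet a) (w a)" if a: "a \<in> K" for a
      unfolding transversal_def
    proof (intro allI impI ballI)
      fix G' p and e :: real
      assume G': "G' facet_of facet a" and p: "p \<in> rel_interior G'" and e: "0 < e"
      have G'f: "G' face_of facet a" "G' \<noteq> facet a" using G' by (auto simp: facet_of_def)
      have pG': "p \<in> G'" using p rel_interior_subset by blast
      then have pf: "p \<in> facet a" using G'f(1) face_of_imp_subset by blast
      then have pD: "p \<in> D" "a \<bullet> p = 0" by (auto simp: facet_def)
      \<comment> \<open>Without a second tight constraint one could step from \<open>p\<close> away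
        from any \<open>x\<close> in \<open>facet a\<close>, and \<open>G'\<close> would be all of
        \<open>facet a\<close>.\<close>
      have "\<exists>c. c \<in> K \<and> c \<noteq> a \<and> c \<bullet> p = 0"
      proof (rule ccontr)
        assume neg: "\<not> (\<exists>c. c \<in> K \<and> c \<noteq> a \<and> c \<bullet> p = 0)"
        have only: "c = a" if "c \<in> K" "c \<bullet> p = 0" for c using neg that by blast
        have "x \<in> G'" if x: "x \<in> facet a" for x
        proof -
          have xD: "x \<in> D" "a \<bullet> x = 0" using x by (auto simp: facet_def)
          have "p - x \<in> span D" using xD pD by (intro span_diff) (auto simp: span_base)
          moreover have "c \<bullet> (p - x) \<le> 0" if "c \<in> K" "c \<bullet> p = 0" for c
            using only[OF that] pD(2) xD(2) by (simp add: inner_diff_right)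
          ultimately obtain t where t: "t > 0" "p + t *\<^sub>R (p - x) \<in> D"
            using step[OF pD(1), of "p - x"] by blast
          have "p + t *\<^sub>R (p - x) \<in> facet a"
            using t xD pD by (simp add: facet_def inner_diff_right inner_add_right)
          then show ?thesis using face_extend[OF G'f(1) pG' x t(1)] by blast
        qed
        then show False using G'f face_of_imp_subset by blast
      qed
      then obtain c where c: "c \<in> K" "c \<noteq> a" "c \<bullet> p = 0" by blast
      have "\<not> (p + e *\<^sub>R w a \<in> D \<and> p - e *\<^sub>R w a \<in> D)"
      proof
        assume "p + e *\<^sub>R w a \<in> D \<and> p - e *\<^sub>R w a \<in> D"
        then have "c \<bullet> (p + e *\<^sub>R w a) \<le> 0" "c \<bullet> (p - e *\<^sub>R w a) \<le> 0" using K_le[OF c(1)] by blast+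
        then have "e * (c \<bullet> w a) = 0" using c(3) by (simp add: inner_add_right inner_diff_right)
        then show False using e cwne[OF c(1) a c(2)] by simp
      qed
      then show "p + e *\<^sub>R w a \<notin> facet a \<or> p - e *\<^sub>R w a \<notin> facet a" by (auto simp: facet_def)
    qed
    note IHa = IH[OF Suc fpoly wspan wtrans]
    have len: "length ?Gs = length xs" by simp
    have nth: "?Gs ! j = facet (xs ! j)" "xs ! j \<in> K" if "j < length xs" for j
      using that xs(2) by auto
    show ?thesis
      unfolding Suc shell.simps Let_def
    proof (intro conjI impI allI)
      assume "?Gs \<noteq> []"
      then have ne': "xs \<noteq> []" by simp
      have 1: "hd ?Gs = facet (hd xs)" using ne' by (simp add: hd_map)
      have 2: "hd xs \<in> K" using hd_in_set[OF ne'] xs(2) by simp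
      show "\<exists>Gs. distinct Gs \<and> set Gs = cone_facets (hd ?Gs) \<and> shell k' Gs"
        using IHa[OF 2 2 2 2 2] unfolding visible_first_def 1 by blast
    next
      fix j assume j: "0 < j \<and> j < length ?Gs"
      define a where "a = xs ! j"
      define U where "U = \<Union>(set (take j ?Gs))"
      define I where "I = {G \<in> cone_facets (facet a). G \<subseteq> U}"
      have jl: "j < length xs" using j by simp
      have a: "a \<in> K" "?Gs ! j = facet a" using nth[OF jl] by (auto simp: a_def)
      have "set (take j ?Gs) = facet ` set (take j xs)" by (simp add: take_map)
      then have U: "U = \<Union>(facet ` {c \<in> K. l a < l c})"
        unfolding U_def using sorted_wrt_take[OF xs(3) jl] xs(2) by (simp add: a_def)
      have "take j xs \<noteq> []" using j jl by auto
      then obtain c0 where c0: "c0 \<in> K" "l a < l c0"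
        using sorted_wrt_take[OF xs(3) jl] xs(2) last_in_set[of "take j xs"] unfolding a_def by blast
      have z: "0 \<in> facet c" for c using cone_zero_in[OF cone ne] by (simp add: facet_def)
      \<comment> \<open>If facets were points, all of them would be \<open>{0}\<close>, but
        \<open>c0\<close> gives a different, earlier one. Hence the empty face is not among the
        cells in the boundary of \<open>facet a\<close>.\<close>
      have "aff_dim (facet a) \<noteq> 0"
      proof
        assume a0: "aff_dim (facet a) = 0"
        have "aff_dim (facet c0) = aff_dim (facet a)"
          using facet_facet[OF c0(1)] facet_facet[OF a(1)] by (simp add: facet_of_def)
        then have "\<exists>x. facet c0 = {x}" "\<exists>x. facet a = {x}" using a0 by (auto simp: aff_dim_eq_0)
        then have "facet c0 = facet a" using z[of c0] z[of a] by auto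
        then show False using facet_inj c0 a(1) by (auto simp: inj_on_def)
      qed
      moreover have "aff_dim (facet a) \<ge> 0"
        using z[of a] aff_dim_negative_iff[of "facet a"] by (metis empty_iff not_less)
      ultimately have cfa: "cone_facets (facet a) = {G. G facet_of facet a}"
        by (intro cone_facets_eq) simp
      \<comment> \<open>At a point of an earlier facet some \<open>c\<close> with
        \<open>c \<bullet> w a > 0\<close> is tight, so \<open>w a\<close> leaves. Conversely,
        leaving along \<open>w a\<close> violates a constraint tight at \<open>p\<close>; being
        tight at a relative interior point it vanishes on all of \<open>G\<close>, and it belongs to
        an earlier facet.\<close>
      have I_sees: "I = {G \<in> cone_facets (facet a). sees (facet a) (w a) G}"
      proof -
        have "G \<subseteq> U \<longleftrightarrow> sees (facet a) (w a) G" if G: "G facet_of facet a" for G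
        proof
          assume GU: "G \<subseteq> U"
          show "sees (facet a) (w a) G" unfolding sees_def
          proof (intro ballI allI impI notI)
            fix p and e :: real
            assume p: "p \<in> rel_interior G" and e: "0 < e" and pin: "p + e *\<^sub>R w a \<in> facet a"
            have "p \<in> U" using p GU rel_interior_subset by blast
            then obtain c where c: "c \<in> K" "l a < l c" "c \<bullet> p = 0" unfolding U by (auto simp: facet_def)
            have "0 < c \<bullet> (p + e *\<^sub>R w a)" using cwpos[OF c(1)] c e by (simp add: inner_add_right)
            then show False using K_le[OF c(1)] pin by (force simp: facet_def)
          qed
        next
          assume S: "sees (facet a) (w a) G"
          have Gf: "G face_of facet a" "G \<noteq> {}" using G by (auto simp: facet_of_def)
          have Gc: "convex G" using Gf(1) face_of_imp_convex by blast
          have GD: "G \<subseteq> facet a" using Gf(1) face_of_imp_subset by blast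
          obtain p where p: "p \<in> rel_interior G"
            using Gf(2) Gc by (auto simp: rel_interior_eq_empty[symmetric])
          have pf: "p \<in> facet a" using p rel_interior_subset GD by blast
          then have pD: "p \<in> D" "a \<bullet> p = 0" by (auto simp: facet_def)
          have "p + e *\<^sub>R w a \<notin> D" if "0 < e" for e
            using S p that step_in[OF a(1) pD(2)] unfolding sees_def by blast
          then obtain c where c: "c \<in> K" "c \<bullet> p = 0" "0 < c \<bullet> w a"
            using seen_facet_at[OF pD(1) wD] by blast
          have "c \<bullet> x = 0" if "x \<in> G" for x
            using rel_interior_supporting[OF Gc p _ c(2) that] K_le[OF c(1)] GD by (auto simp: facet_def)
          then have "G \<subseteq> facet c" using GD by (auto simp: facet_def)
          then show "G \<subseteq> U" unfolding U using c cwpos by blast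
        qed
        then show ?thesis unfolding I_def cfa by blast
      qed
      interpret f: polyhedral_cone "facet a" "SOME K. facet_normals (facet a) K"
        using fpoly[OF a(1)] ex_facet_normals[OF fpoly[OF a(1)]] by unfold_locales (auto intro: someI_ex)
      \<comment> \<open>This concerns single points: where \<open>facet a\<close> meets an earlier
        facet, \<open>w a\<close> leaves \<open>facet a\<close>, and it does so through one of the
        seen facets of \<open>facet a\<close>.\<close>
      have un: "facet a \<inter> U = \<Union>I"
      proof
        show "\<Union>I \<subseteq> facet a \<inter> U" unfolding I_def cfa facet_of_def using face_of_imp_subset by blast
        show "facet a \<inter> U \<subseteq> \<Union>I"
        proof
          fix p assume p: "p \<in> facet a \<inter> U"
          then obtain c where c: "c \<in> K" "l a < l c" "c \<bullet> p = 0" unfolding U by (auto simp: facet_def)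
          have "p + e *\<^sub>R w a \<notin> facet a" if "0 < e" for e
          proof
            assume "p + e *\<^sub>R w a \<in> facet a"
            moreover have "0 < c \<bullet> (p + e *\<^sub>R w a)" using cwpos[OF c(1)] c that by (simp add: inner_add_right)
            ultimately show False using K_le[OF c(1)] by (force simp: facet_def)
          qed
          then obtain c' where c': "c' \<in> (SOME K. facet_normals (facet a) K)" "c' \<bullet> p = 0" "0 < c' \<bullet> w a"
            using f.seen_facet_at[of p "w a"] p wspan[OF a(1)] by blast
          have "f.facet c' \<in> I" unfolding I_sees cfa
            using f.facet_facet[OF c'(1)] f.sees_facet[OF c'(1) wspan[OF a(1)]] c'(3) by blast
          moreover have "p \<in> f.facet c'" using p c'(2) by (simp add: f.facet_def)
          ultimately show "p \<in> \<Union>I" by blast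
        qed
      qed
      have "0 \<in> facet a \<inter> U" unfolding U using z c0 by blast
      then have "I \<noteq> {}" unfolding un by blast
      moreover obtain Gs where "distinct Gs" "set Gs = cone_facets (facet a)" "shell k' Gs" "set (take (card I) Gs) = I"
        using IHa[OF a(1) a(1) a(1) a(1) a(1)] unfolding I_sees visible_first_def by blast
      ultimately show "{G \<in> cone_facets (?Gs ! j). G \<subseteq> \<Union>(set (take j ?Gs))} \<noteq> {}"
        "?Gs ! j \<inter> \<Union>(set (take j ?Gs)) = \<Union>{G \<in> cone_facets (?Gs ! j). G \<subseteq> \<Union>(set (take j ?Gs))}"
        "\<exists>Gs'. distinct Gs' \<and> set Gs' = cone_facets (?Gs ! j) \<and> shell k' Gs' \<and>
          set (take (card {G \<in> cone_facets (?Gs ! j). G \<subseteq> \<Union>(set (take j ?Gs))}) Gs')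
            = {G \<in> cone_facets (?Gs ! j). G \<subseteq> \<Union>(set (take j ?Gs))}"
        using un unfolding a(2) U_def[symmetric] I_def[symmetric] by blast+
    qed
  qed simp
  then show ?thesis unfolding visible_first_def using dist first cfK xs(2) by (intro exI[of _ ?Gs]) simp
qed

text \<open>One step serves both cases: its induction hypothesis is conditional on
  \<open>k = Suc k'\<close>, which is void at depth 0.\<close>

lemma ex_visible_first:
  fixes D :: "'a::euclidean_space set"
  assumes "polyhedron D" "cone D" "D \<noteq> {}" "u \<in> span D" "transversal D u"
  shows "visible_first k D u"
  using assms
proof (induction k arbitrary: D u)
  case 0
  show ?case by (rule visible_first_step[OF 0]) simp
next
  case (Suc k)
  show ?case by (rule visible_first_step[OF Suc.prems]) (use Suc.IH in auto)
qed

section \<open>Regions of an arrangement and their quotients\<close>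

text \<open>The ratio test: among the constraints that decrease along \<open>u\<close>, the one with
  the smallest ratio \<open>(n \<bullet> r) / - (n \<bullet> u)\<close> is the first to become
  tight.\<close>

lemma ray_exit:
  fixes r u :: "'a::real_inner"
  assumes M: "finite M" "\<And>n. n \<in> M \<Longrightarrow> 0 < n \<bullet> r" and n0: "n0 \<in> M" "n0 \<bullet> u < 0"
  shows "\<exists>t>0. (\<forall>n\<in>M. 0 \<le> n \<bullet> (r + t *\<^sub>R u)) \<and> (\<exists>n\<in>M. n \<bullet> (r + t *\<^sub>R u) = 0 \<and> n \<bullet> u < 0)"
proof -
  define S where "S = {n \<in> M. n \<bullet> u < 0}"
  define f where "f n = (n \<bullet> r) / - (n \<bullet> u)" for n
  have S: "finite S" "S \<noteq> {}" using assms by (auto simp: S_def)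
  define t where "t = Min (f ` S)"
  have "t \<in> f ` S" unfolding t_def using S by (intro Min_in) auto
  then obtain n where n: "n \<in> S" "t = f n" by blast
  have nM: "n \<in> M" "n \<bullet> u < 0" using n by (auto simp: S_def)
  have "t > 0" unfolding n(2) f_def using M(2)[OF nM(1)] nM(2) by (intro divide_pos_pos) auto
  moreover have "n \<bullet> (r + t *\<^sub>R u) = 0"
    unfolding n(2) f_def using nM(2) by (simp add: inner_add_right inner_diff_right)
  moreover have "0 \<le> n' \<bullet> (r + t *\<^sub>R u)" if n': "n' \<in> M" for n'
  proof (cases "n' \<bullet> u < 0")
    case True
    then have "t \<le> f n'" unfolding t_def using S n' by (intro Min_le) (auto simp: S_def)
    then have "t * - (n' \<bullet> u) \<le> f n' * - (n' \<bullet> u)" using True by (intro mult_right_mono) auto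
    also have "\<dots> = n' \<bullet> r" using True by (simp add: f_def)
    finally show ?thesis by (simp add: inner_add_right)
  next
    case False
    have "0 \<le> t * (n' \<bullet> u)" using False \<open>t > 0\<close> by simp
    then show ?thesis using M(2)[OF n'] by (simp add: inner_add_right)
  qed
  ultimately show ?thesis using nM by blast
qed

lemma inner_unit_less_1:
  fixes m n :: "'a::real_inner"
  assumes "norm m = 1" "norm n = 1" "m \<noteq> n"
  shows "m \<bullet> n < 1"
proof -
  have "m \<bullet> m = 1" "n \<bullet> n = 1" using assms by (simp_all add: dot_square_norm)
  then have "(m - n) \<bullet> (m - n) = 2 - 2 * (m \<bullet> n)" by (simp add: inner_diff inner_commute)
  moreover have "0 < (m - n) \<bullet> (m - n)" using assms by simp
  ultimately show ?thesis by simp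
qed

lemma small_positive_step:
  fixes p v :: "'a::real_inner"
  assumes "finite M" "\<And>n. n \<in> M \<Longrightarrow> 0 < n \<bullet> p"
  shows "\<exists>e>0. \<forall>t. 0 < t \<and> t \<le> e \<longrightarrow> (\<forall>n\<in>M. 0 < n \<bullet> (p + t *\<^sub>R v))"
  using assms
proof (induction M rule: finite_induct)
  case empty
  show ?case by (intro exI[of _ 1]) auto
next
  case (insert b M)
  then obtain e where e: "e > 0" "\<And>t n. 0 < t \<Longrightarrow> t \<le> e \<Longrightarrow> n \<in> M \<Longrightarrow> 0 < n \<bullet> (p + t *\<^sub>R v)" by blast
  have b: "0 < b \<bullet> p" using insert.prems by simp
  define d where "d = (b \<bullet> p) / (\<bar>b \<bullet> v\<bar> + 1)"
  have d: "d > 0" "d * (\<bar>b \<bullet> v\<bar> + 1) = b \<bullet> p" using b by (auto simp: d_def add_nonneg_pos)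
  have "0 < b \<bullet> (p + t *\<^sub>R v)" if t: "0 < t" "t \<le> d" for t
  proof -
    have "t * (\<bar>b \<bullet> v\<bar> + 1) \<le> b \<bullet> p" using mult_right_mono[OF t(2), of "\<bar>b \<bullet> v\<bar> + 1"] d by simp
    then have "t * \<bar>b \<bullet> v\<bar> < b \<bullet> p" using t by (simp add: distrib_left)
    moreover have "- (t * (b \<bullet> v)) \<le> t * \<bar>b \<bullet> v\<bar>" 
      using mult_left_mono[OF abs_ge_minus_self[of "b \<bullet> v"], of t] t(1) by simp
    ultimately show ?thesis by (simp add: inner_add_right)
  qed
  then show ?case using e d by (intro exI[of _ "min d e"]) auto
qed

text \<open>Take a boundary point \<open>p\<close> of the cone on the segment from \<open>r\<close> to \<open>y\<close> and move it inside the cone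
  until only one constraint is tight.\<close>
lemma separating_facet:
  fixes r y :: "'a::real_inner"
  assumes M: "finite M" "\<And>n. n \<in> M \<Longrightarrow> norm n = 1" "\<And>n. n \<in> M \<Longrightarrow> 0 < n \<bullet> r"
    and n0: "n0 \<in> M" "n0 \<bullet> y < 0"
  shows "\<exists>n\<in>M. n \<bullet> y < 0 \<and> (\<exists>p. n \<bullet> p = 0 \<and> (\<forall>n'\<in>M - {n}. 0 < n' \<bullet> p))"
proof -
  define Z where "Z p = {n \<in> M. n \<bullet> p = 0}" for p
  define ok where "ok p \<longleftrightarrow> (\<forall>n\<in>M. 0 \<le> n \<bullet> p) \<and> Z p \<noteq> {} \<and> (\<forall>n\<in>Z p. n \<bullet> y < 0)" for p
  have "\<exists>p. ok p"
  proof -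
    have "n0 \<bullet> (y - r) < 0" using n0 M(3)[OF n0(1)] by (simp add: inner_diff_right)
    then obtain t n where t: "t > 0" "\<And>n. n \<in> M \<Longrightarrow> 0 \<le> n \<bullet> (r + t *\<^sub>R (y - r))"
      "n \<in> M" "n \<bullet> (r + t *\<^sub>R (y - r)) = 0"
      using ray_exit[OF M(1,3) n0(1), of "y - r"] by blast
    let ?p = "r + t *\<^sub>R (y - r)"
    have e: "m \<bullet> ?p = (1 - t) * (m \<bullet> r) + t * (m \<bullet> y)" for m
      by (simp add: inner_add_right inner_diff_right algebra_simps)
    have "t < 1"
    proof (rule ccontr)
      assume "\<not> t < 1"
      then have "(1 - t) * (n0 \<bullet> r) \<le> 0" "t * (n0 \<bullet> y) < 0"
        using M(3)[OF n0(1)] n0 t(1) by (auto simp: mult_le_0_iff mult_less_0_iff)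
      then show False using t(2)[OF n0(1)] e[of n0] by simp
    qed
    have "m \<bullet> y < 0" if "m \<in> Z ?p" for m
    proof -
      have m: "m \<in> M" "(1 - t) * (m \<bullet> r) + t * (m \<bullet> y) = 0" using that e[of m] by (auto simp: Z_def)
      have "0 < (1 - t) * (m \<bullet> r)" using M(3)[OF m(1)] \<open>t < 1\<close> by simp
      then have "t * (m \<bullet> y) < 0" using m(2) by simp
      then show ?thesis using t(1) by (simp add: mult_less_0_iff)
    qed
    moreover have "n \<in> Z ?p" using t by (simp add: Z_def)
    ultimately have "ok ?p" unfolding ok_def using t(2) by blast
    then show ?thesis by blast
  qed
  then obtain p where p: "ok p" "\<And>p'. ok p' \<Longrightarrow> card (Z p) \<le> card (Z p')"
    using ex_has_least_nat[of ok _ "\<lambda>p. card (Z p)"] by blast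
  have fZ: "finite (Z p)" using M(1) by (simp add: Z_def)
  have ge: "0 \<le> n \<bullet> p" if "n \<in> M" for n using p(1) that by (simp add: ok_def)
  have single: "n1 = n2" if n12: "n1 \<in> Z p" "n2 \<in> Z p" for n1 n2
  proof (rule ccontr)
    assume ne: "n1 \<noteq> n2"
    have nM: "n1 \<in> M" "n2 \<in> M" using n12 by (auto simp: Z_def)
    \<comment> \<open>Along \<open>n2 - n1\<close> the value of \<open>n1\<close> falls and that of
      \<open>n2\<close> rises. Where the ray from \<open>r\<close> leaves the cone of the
      constraints in \<open>Z p\<close>, some \<open>m\<close> is zero while \<open>n2\<close> is
      positive; a small step from \<open>p\<close> in the direction of that point makes
      \<open>n2\<close> slack and keeps \<open>m\<close> tight, against the minimality of
      \<open>Z p\<close>.\<close>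
    have u: "n1 \<bullet> (n2 - n1) < 0" "0 < n2 \<bullet> (n2 - n1)"
      using inner_unit_less_1[OF M(2)[OF nM(1)] M(2)[OF nM(2)] ne] M(2)[OF nM(1)] M(2)[OF nM(2)]
      by (simp_all add: inner_diff_right dot_square_norm inner_commute)
    obtain t m where t: "t > 0" "\<And>n. n \<in> Z p \<Longrightarrow> 0 \<le> n \<bullet> (r + t *\<^sub>R (n2 - n1))"
      "m \<in> Z p" "m \<bullet> (r + t *\<^sub>R (n2 - n1)) = 0"
      using ray_exit[OF fZ _ n12(1) u(1), of r] M(3) by (auto simp: Z_def)
    let ?v = "r + t *\<^sub>R (n2 - n1)"
    have "0 < t * (n2 \<bullet> (n2 - n1))" using t(1) u(2) by simp
    then have n2v: "0 < n2 \<bullet> ?v" using M(3)[OF nM(2)] by (simp add: inner_add_right)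
    have "finite (M - Z p)" using M(1) by simp
    moreover have "0 < n \<bullet> p" if "n \<in> M - Z p" for n using ge[of n] that by (auto simp: Z_def less_le)
    ultimately obtain e where e: "e > 0" "\<And>n. n \<in> M - Z p \<Longrightarrow> 0 < n \<bullet> (p + e *\<^sub>R ?v)"
      using small_positive_step[of "M - Z p" p ?v] by blast
    let ?p = "p + e *\<^sub>R ?v"
    have onZ: "n \<bullet> ?p = e * (n \<bullet> ?v)" if "n \<in> Z p" for n
      using that by (simp add: Z_def inner_add_right)
    have Zsub: "Z ?p \<subseteq> Z p" using e(2) by (force simp: Z_def)
    have "0 \<le> n \<bullet> ?p" if "n \<in> M" for n
    proof (cases "n \<in> Z p")
      case True
      then show ?thesis using onZ[OF True] t(2)[OF True] e(1) by simp
    next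
      case False
      then show ?thesis using e(2)[of n] that by simp
    qed
    moreover have "m \<in> Z ?p" using onZ[OF t(3)] t(3,4) by (simp add: Z_def)
    moreover have "n \<bullet> y < 0" if "n \<in> Z ?p" for n using that Zsub p(1) unfolding ok_def by blast
    ultimately have "ok ?p" unfolding ok_def by blast
    moreover have "n2 \<notin> Z ?p" using onZ[OF n12(2)] n2v e(1) by (simp add: Z_def)
    then have "card (Z ?p) < card (Z p)" using Zsub n12(2) fZ by (intro psubset_card_mono) blast+
    ultimately show False using p(2)[of ?p] by simp
  qed
  obtain n where n: "n \<in> Z p" using p(1) by (auto simp: ok_def)
  have "n \<in> M" "n \<bullet> p = 0" using n by (auto simp: Z_def)
  moreover have "n \<bullet> y < 0" using p(1) n by (auto simp: ok_def)
  moreover have "0 < n' \<bullet> p" if "n' \<in> M - {n}" for n'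
    using ge[of n'] single[OF n, of n'] that by (auto simp: Z_def less_le)
  ultimately show ?thesis by blast
qed

section \<open>Regions as sign sets\<close>

text \<open>The arrangement is encoded by the unit normals \<open>N\<close> of its hyperplanes, oriented so that they are
  positive on a point \<open>\<beta>\<close> in the interior of the base region. A region is then determined by the
  set \<open>sg R\<close> of the normals that are negative on it.\<close>

locale normals =
  fixes N :: "'a::euclidean_space set" and \<beta> :: 'a
  assumes finN: "finite N" and unit: "n \<in> N \<Longrightarrow> norm n = 1" and pos: "n \<in> N \<Longrightarrow> 0 < n \<bullet> \<beta>"
begin

definition "neg x = {n \<in> N. n \<bullet> x < 0}"
definition "zer x = {n \<in> N. n \<bullet> x = 0}"
definition "reg S = {x. (\<forall>n\<in>S. n \<bullet> x \<le> 0) \<and> (\<forall>n\<in>N - S. 0 \<le> n \<bullet> x)}"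
definition "Regs = {reg (neg z) |z. zer z = {}}"
definition "sg R = {n \<in> N. \<forall>x\<in>R. n \<bullet> x \<le> 0}"

lemma neg_zer: "neg x \<subseteq> N" "zer x \<subseteq> N" "neg x \<inter> zer x = {}"
  by (auto simp: neg_def zer_def)

lemma self_in_reg: "x \<in> reg (neg x)"
  by (auto simp: reg_def neg_def)

lemma sg_reg:
  assumes "zer z = {}"
  shows "sg (reg (neg z)) = neg z"
proof
  show "sg (reg (neg z)) \<subseteq> neg z"
  proof
    fix n assume "n \<in> sg (reg (neg z))"
    then have "n \<in> N" "n \<bullet> z \<le> 0" using self_in_reg[of z] by (auto simp: sg_def)
    moreover have "n \<bullet> z \<noteq> 0" using assms \<open>n \<in> N\<close> by (auto simp: zer_def)
    ultimately show "n \<in> neg z" by (auto simp: neg_def)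
  qed
  show "neg z \<subseteq> sg (reg (neg z))" by (auto simp: sg_def reg_def neg_def)
qed

lemma Regs_I: "zer z = {} \<Longrightarrow> reg (neg z) \<in> Regs"
  by (auto simp: Regs_def)

lemma Regs_E:
  assumes "R \<in> Regs"
  obtains z where "zer z = {}" "neg z = sg R" "R = reg (sg R)"
proof -
  obtain z where "zer z = {}" "R = reg (neg z)" using assms by (auto simp: Regs_def)
  then show thesis using that[of z] sg_reg[of z] by simp
qed

lemma sg_N: "sg R \<subseteq> N"
  by (auto simp: sg_def)

lemma sg_inj: "R \<in> Regs \<Longrightarrow> R' \<in> Regs \<Longrightarrow> sg R = sg R' \<Longrightarrow> R = R'"
  by (metis Regs_E)

lemma finite_Regs: "finite Regs"
proof -
  have "inj_on sg Regs" by (rule inj_onI) (rule sg_inj)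
  moreover have "sg ` Regs \<subseteq> Pow N" using sg_N by blast
  ultimately show ?thesis using inj_on_finite[of sg Regs "Pow N"] finN by simp
qed

lemma mem_region:
  assumes "R \<in> Regs"
  shows "x \<in> R \<longleftrightarrow> neg x \<subseteq> sg R \<and> sg R \<subseteq> neg x \<union> zer x"
proof -
  have "R = reg (sg R)" using Regs_E[OF assms] by metis
  then have "x \<in> R \<longleftrightarrow> x \<in> reg (sg R)" by simp
  also have "\<dots> \<longleftrightarrow> neg x \<subseteq> sg R \<and> sg R \<subseteq> neg x \<union> zer x"
    using sg_N[of R] by (force simp: reg_def neg_def zer_def not_less)
  finally show ?thesis .
qed

text \<open>Composition of sign vectors: signs at \<open>p\<close> win and ties are resolved by
  \<open>v\<close>. Nearly all regions and points on walls used later arise from such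
  displacements.\<close>

lemma perturb:
  "\<exists>e>0. \<forall>t. 0 < t \<and> t \<le> e \<longrightarrow> neg (p + t *\<^sub>R v) = neg p \<union> (zer p \<inter> neg v) \<and>
     zer (p + t *\<^sub>R v) = zer p \<inter> zer v"
proof -
  define Q where "Q = {n \<in> N. 0 < n \<bullet> p} \<union> uminus ` neg p"
  have "finite Q" using finN by (simp add: Q_def neg_def)
  moreover have "0 < n \<bullet> p" if "n \<in> Q" for n using that by (auto simp: Q_def neg_def)
  ultimately obtain e where e: "e > 0" "\<forall>t. 0 < t \<and> t \<le> e \<longrightarrow> (\<forall>n\<in>Q. 0 < n \<bullet> (p + t *\<^sub>R v))"
    using small_positive_step[of Q p v] by blast
  have "neg (p + t *\<^sub>R v) = neg p \<union> (zer p \<inter> neg v) \<and> zer (p + t *\<^sub>R v) = zer p \<inter> zer v"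
    if t: "0 < t \<and> t \<le> e" for t
  proof -
    have q: "0 < n \<bullet> (p + t *\<^sub>R v)" if "n \<in> Q" for n using e(2) t that by blast
    have 1: "n \<bullet> (p + t *\<^sub>R v) < 0" if "n \<in> neg p" for n
      using q[of "- n"] that by (simp add: Q_def)
    have 2: "0 < n \<bullet> (p + t *\<^sub>R v)" if "n \<in> N" "0 < n \<bullet> p" for n using q[of n] that by (simp add: Q_def)
    have 3: "n \<bullet> (p + t *\<^sub>R v) = t * (n \<bullet> v)" if "n \<in> zer p" for n
      using that by (simp add: zer_def inner_add_right)
    have "(n \<bullet> (p + t *\<^sub>R v) < 0 \<longleftrightarrow> n \<in> neg p \<union> (zer p \<inter> neg v)) \<and>
        (n \<bullet> (p + t *\<^sub>R v) = 0 \<longleftrightarrow> n \<in> zer p \<inter> zer v)" if n: "n \<in> N" for n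
    proof -
      consider "n \<bullet> p < 0" | "n \<bullet> p = 0" | "0 < n \<bullet> p" by linarith
      then show ?thesis
      proof cases
        case 1
        then have "n \<in> neg p" "n \<notin> zer p" using n by (auto simp: neg_def zer_def)
        then show ?thesis using \<open>n \<in> neg p \<Longrightarrow> n \<bullet> (p + t *\<^sub>R v) < 0\<close> by auto
      next
        case 2
        then have z: "n \<in> zer p" "n \<notin> neg p" using n by (auto simp: neg_def zer_def)
        then show ?thesis using 3[OF z(1)] t n by (auto simp: neg_def zer_def mult_less_0_iff)
      next
        case 3
        then have "n \<notin> neg p" "n \<notin> zer p" using n by (auto simp: neg_def zer_def)
        then show ?thesis using 2[OF n 3] by auto
      qed
    qed
    then show ?thesis unfolding neg_def[of "p + t *\<^sub>R v"] zer_def[of "p + t *\<^sub>R v"]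
      using neg_zer(1)[of p] neg_zer(2)[of p] by blast
  qed
  then show ?thesis using e(1) by blast
qed

lemma neg_zer_base: "neg \<beta> = {}" "zer \<beta> = {}" "neg (- \<beta>) = N" "zer (- \<beta>) = {}"
  using pos by (force simp: neg_def zer_def)+

text \<open>The lowest and the highest region containing \<open>p\<close>.\<close>
definition "mreg p = reg (neg p)"
definition "Mreg p = reg (neg p \<union> zer p)"

text \<open>All normals are positive at \<open>\<beta>\<close>, so a small step towards it makes
  every tie positive and a step away from it makes every tie negative.\<close>

lemma perturb_base:
  "\<exists>e>0. \<forall>t. 0 < t \<and> t \<le> e \<longrightarrow> neg (p + t *\<^sub>R \<beta>) = neg p \<and> zer (p + t *\<^sub>R \<beta>) = {} \<and>
      neg (p - t *\<^sub>R \<beta>) = neg p \<union> zer p \<and> zer (p - t *\<^sub>R \<beta>) = {}"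
proof -
  obtain e where e: "e > 0" "\<forall>t. 0 < t \<and> t \<le> e \<longrightarrow> neg (p + t *\<^sub>R \<beta>) = neg p \<union> (zer p \<inter> neg \<beta>) \<and>
     zer (p + t *\<^sub>R \<beta>) = zer p \<inter> zer \<beta>"
    using perturb[of p \<beta>] by (elim exE conjE)
  obtain e' where e': "e' > 0" "\<forall>t. 0 < t \<and> t \<le> e' \<longrightarrow> neg (p + t *\<^sub>R (- \<beta>)) = neg p \<union> (zer p \<inter> neg (- \<beta>)) \<and>
     zer (p + t *\<^sub>R (- \<beta>)) = zer p \<inter> zer (- \<beta>)"
    using perturb[of p "- \<beta>"] by (elim exE conjE)
  show ?thesis
  proof (intro exI[of _ "min e e'"] conjI allI impI)
    fix t assume "0 < t \<and> t \<le> min e e'"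
    then have t: "0 < t" "t \<le> e" "t \<le> e'" by auto
    show "neg (p + t *\<^sub>R \<beta>) = neg p" "zer (p + t *\<^sub>R \<beta>) = {}"
      using e(2)[rule_format, OF conjI[OF t(1,2)]] by (simp_all add: neg_zer_base)
    show "neg (p - t *\<^sub>R \<beta>) = neg p \<union> zer p" "zer (p - t *\<^sub>R \<beta>) = {}"
      using e'(2)[rule_format, OF conjI[OF t(1,3)]] neg_zer(2)[of p] by (auto simp: neg_zer_base)
  qed (use e(1) e'(1) in simp)
qed

lemma mreg: "mreg p \<in> Regs" "sg (mreg p) = neg p" "Mreg p \<in> Regs" "sg (Mreg p) = neg p \<union> zer p"
proof -
  obtain t where t: "t > 0" "neg (p + t *\<^sub>R \<beta>) = neg p" "zer (p + t *\<^sub>R \<beta>) = {}"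
      "neg (p - t *\<^sub>R \<beta>) = neg p \<union> zer p" "zer (p - t *\<^sub>R \<beta>) = {}"
    using perturb_base[of p] by (meson order_refl)
  show "mreg p \<in> Regs" "sg (mreg p) = neg p"
    using Regs_I[OF t(3)] sg_reg[OF t(3)] by (simp_all add: mreg_def t(2))
  show "Mreg p \<in> Regs" "sg (Mreg p) = neg p \<union> zer p"
    using Regs_I[OF t(5)] sg_reg[OF t(5)] by (simp_all add: Mreg_def t(4))
qed

lemma mem_mreg: "p \<in> mreg p" "p \<in> Mreg p"
  using mem_region[OF mreg(1), of p p] mem_region[OF mreg(3), of p p] mreg(2,4) by auto

lemma region_of_generic:
  assumes "R \<in> Regs" "zer z = {}"
  shows "z \<in> R \<longleftrightarrow> R = mreg z"
proof
  assume "z \<in> R"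
  then have "sg R = neg z" using mem_region[OF assms(1)] assms(2) by auto
  then show "R = mreg z" using sg_inj[OF assms(1) mreg(1)] mreg(2) by simp
qed (use mem_mreg in simp)

lemma generic_interior:
  assumes "zer z = {}"
  shows "z \<in> interior (mreg z)"
proof -
  let ?O = "(\<Inter>n\<in>neg z. {x. n \<bullet> x < 0}) \<inter> (\<Inter>n\<in>N - neg z. {x. 0 < n \<bullet> x})"
  have "finite (neg z)" "finite (N - neg z)" using finN finite_subset[OF neg_zer(1)] by auto
  then have "open ?O" by (intro open_Int open_INT ballI open_halfspace_lt open_halfspace_gt)
  moreover have "z \<in> ?O" using assms by (auto simp: neg_def zer_def less_le)
  moreover have "?O \<subseteq> mreg z" by (auto simp: mreg_def reg_def less_imp_le)
  ultimately show ?thesis by (rule interiorI)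
qed

lemma sg_reg_points: "R \<in> Regs \<Longrightarrow> n \<in> sg R \<Longrightarrow> x \<in> R \<Longrightarrow> n \<bullet> x \<le> 0"
  and not_sg_points: "R \<in> Regs \<Longrightarrow> n \<in> N - sg R \<Longrightarrow> x \<in> R \<Longrightarrow> 0 \<le> n \<bullet> x"
proof -
  assume R: "R \<in> Regs" "x \<in> R"
  have "R = reg (sg R)" using Regs_E[OF R(1)] by metis
  then have "x \<in> reg (sg R)" using R(2) by simp
  then show "n \<in> sg R \<Longrightarrow> n \<bullet> x \<le> 0" "n \<in> N - sg R \<Longrightarrow> 0 \<le> n \<bullet> x" by (auto simp: reg_def)
qed

text \<open>Negating the normals along with \<open>\<beta>\<close> describes the same regions as
  seen from the opposite one, with every set \<open>sg R\<close> complemented. Combined with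
  \<open>dual\<close> it exchanges upper and lower walls.\<close>

lemma negated: "normals (uminus ` N) (- \<beta>)"
  using finN unit pos by unfold_locales auto

lemma negated_neg: "normals.neg (uminus ` N) x = uminus ` (N - neg x - zer x)"
  and negated_zer: "normals.zer (uminus ` N) x = uminus ` zer x"
proof -
  interpret d: normals "uminus ` N" "- \<beta>" by (rule negated)
  show "d.neg x = uminus ` (N - neg x - zer x)" "d.zer x = uminus ` zer x"
    by (auto simp: d.neg_def neg_def zer_def d.zer_def image_iff)
qed

lemma negated_reg: "S \<subseteq> N \<Longrightarrow> normals.reg (uminus ` N) (uminus ` (N - S)) = reg S"
proof -
  assume "S \<subseteq> N"
  interpret d: normals "uminus ` N" "- \<beta>" by (rule negated)
  have "uminus ` N - uminus ` (N - S) = uminus ` S" using \<open>S \<subseteq> N\<close> by (auto simp: image_iff)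
  then show ?thesis unfolding d.reg_def reg_def by auto
qed

lemma negated_Regs: "normals.Regs (uminus ` N) = Regs"
proof -
  interpret d: normals "uminus ` N" "- \<beta>" by (rule negated)
  have "d.reg (d.neg z) = reg (neg z)" "d.zer z = {} \<longleftrightarrow> zer z = {}" if "zer z = {} \<or> d.zer z = {}" for z
    using negated_reg[OF neg_zer(1)[of z]] that by (auto simp: negated_neg negated_zer)
  then show ?thesis unfolding d.Regs_def Regs_def by metis
qed

lemma negated_sg: "R \<in> Regs \<Longrightarrow> normals.sg (uminus ` N) R = uminus ` (N - sg R)"
proof -
  assume R: "R \<in> Regs"
  interpret d: normals "uminus ` N" "- \<beta>" by (rule negated)
  obtain z where z: "zer z = {}" "neg z = sg R" "R = reg (sg R)" using Regs_E[OF R] .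
  have "R = d.reg (d.neg z)" using negated_reg[OF neg_zer(1)[of z]] z by (simp add: negated_neg)
  then have "d.sg R = d.neg z" using d.sg_reg[of z] z(1) by (simp add: negated_zer)
  then show ?thesis using z by (simp add: negated_neg)
qed

end

context normals
begin

text \<open>Near \<open>p\<close> only the normals vanishing at \<open>p\<close> matter. Oriented to
  be positive at \<open>r\<close>, they bound a cone that excludes \<open>y\<close>;
  \<open>separating_facet\<close> finds one of them that separates \<open>r\<close> from
  \<open>y\<close> and is alone tight at some \<open>q\<close>, and a small step from
  \<open>p\<close> along \<open>q\<close> reaches that wall of \<open>R\<close>. With
  \<open>p = 0\<close> no hyperplane is left out.\<close>

lemma local_wall:
  assumes r: "zer r = {}" "neg r = sg R" and p: "neg p \<subseteq> sg R" "sg R \<subseteq> neg p \<union> zer p"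
    and n: "n \<in> zer p" "0 < (n \<bullet> r) * - (n \<bullet> y)"
  shows "\<exists>m\<in>zer p. 0 < (m \<bullet> r) * - (m \<bullet> y) \<and> (\<exists>q. zer q = {m} \<and> neg q - {m} = sg R - {m})"
proof -
  define o1 where "o1 m = sgn (m \<bullet> r) *\<^sub>R m" for m
  have rn: "m \<bullet> r \<noteq> 0" if "m \<in> N" for m using r that by (auto simp: zer_def)
  have zN: "zer p \<subseteq> N" by (rule neg_zer)
  have fin: "finite (o1 ` zer p)" using finN zN finite_subset by blast
  have o_eq: "sgn (m \<bullet> r) * (m \<bullet> x) > 0 \<longleftrightarrow> (m \<bullet> r) * (m \<bullet> x) > 0" for m x
    by (cases "m \<bullet> r" "0::real" rule: linorder_cases) (auto simp: zero_less_mult_iff mult_less_0_iff)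
  have o_eq': "sgn (m \<bullet> r) * (m \<bullet> x) < 0 \<longleftrightarrow> (m \<bullet> r) * - (m \<bullet> x) > 0" for m x
    using o_eq[of m "- x"] by simp
  have "\<exists>n'\<in>o1 ` zer p. n' \<bullet> y < 0 \<and> (\<exists>q. n' \<bullet> q = 0 \<and> (\<forall>n''\<in>o1 ` zer p - {n'}. 0 < n'' \<bullet> q))"
  proof (rule separating_facet[OF fin])
    show "norm n' = 1" if "n' \<in> o1 ` zer p" for n'
      using that rn unit zN by (auto simp: o1_def)
    show "0 < n' \<bullet> r" if n': "n' \<in> o1 ` zer p" for n'
    proof -
      obtain m where m: "m \<in> zer p" "n' = o1 m" using n' by blast
      have "m \<bullet> r \<noteq> 0" using rn m(1) zN by blast
      then have "0 < (m \<bullet> r) * (m \<bullet> r)" using not_real_square_gt_zero by blast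
      then show ?thesis using o_eq[of m r] m(2) by (simp add: o1_def)
    qed
    show "o1 n \<in> o1 ` zer p" using n(1) by blast
    show "o1 n \<bullet> y < 0" using n(2) o_eq'[of n y] by (simp add: o1_def)
  qed
  then obtain m q where m: "m \<in> zer p" "o1 m \<bullet> y < 0" "o1 m \<bullet> q = 0"
    "\<And>n''. n'' \<in> o1 ` zer p - {o1 m} \<Longrightarrow> 0 < n'' \<bullet> q" by blast
  have mN: "m \<in> N" using m(1) zN by blast
  have m0: "m \<bullet> q = 0" using m(3) rn[OF mN] by (auto simp: o1_def sgn_zero_iff)
  have other: "0 < (m' \<bullet> r) * (m' \<bullet> q)" if m': "m' \<in> zer p - {m}" for m'
  proof -
    have m'N: "m' \<in> N" using m' zN by blast
    \<comment> \<open>Distinct members of \<open>N\<close> are never opposite, both being positive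
      at \<open>\<beta>\<close>.\<close>
    have "o1 m' \<noteq> o1 m"
    proof
      assume "o1 m' = o1 m"
      then have "m' = m \<or> m' = - m"
        using rn[OF mN] rn[OF m'N] by (auto simp: o1_def sgn_if split: if_splits)
      then show False using m' pos[OF m'N] pos[OF mN] by auto
    qed
    then have "0 < o1 m' \<bullet> q" using m(4) m' by blast
    then show ?thesis using o_eq[of m' q] by (simp add: o1_def)
  qed
  have negq: "m' \<in> neg q \<longleftrightarrow> m' \<in> sg R" "m' \<notin> zer q" if m': "m' \<in> zer p - {m}" for m'
  proof -
    have "m' \<bullet> r < 0 \<longleftrightarrow> m' \<in> sg R" unfolding r(2)[symmetric] neg_def using m' zN by auto
    moreover have "(0 < m' \<bullet> r \<and> 0 < m' \<bullet> q) \<or> (m' \<bullet> r < 0 \<and> m' \<bullet> q < 0)"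
      using other[OF m'] by (simp add: zero_less_mult_iff)
    ultimately show "m' \<in> neg q \<longleftrightarrow> m' \<in> sg R" "m' \<notin> zer q" using m' zN by (auto simp: neg_def zer_def)
  qed
  obtain t where t: "t > 0" "neg (p + t *\<^sub>R q) = neg p \<union> (zer p \<inter> neg q)" "zer (p + t *\<^sub>R q) = zer p \<inter> zer q"
    using perturb[of p q] by blast
  have "m \<in> zer q" using m0 mN by (simp add: zer_def)
  then have "zer (p + t *\<^sub>R q) = {m}" using t(3) negq(2) m(1) by blast
  moreover have "neg (p + t *\<^sub>R q) - {m} = sg R - {m}"
    unfolding t(2) using negq(1) p by blast
  moreover have "0 < (m \<bullet> r) * - (m \<bullet> y)" using m(2) o_eq'[of m y] by (simp add: o1_def)
  ultimately show ?thesis using m(1) by blast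
qed

end

lemma polyhedron_inequalities:
  fixes S T :: "'a::euclidean_space set"
  assumes "finite S" "finite T"
  shows "polyhedron {x. (\<forall>n\<in>S. n \<bullet> x \<le> 0) \<and> (\<forall>n\<in>T. 0 \<le> n \<bullet> x)}" (is "polyhedron ?D")
proof -
  have "?D = \<Inter>((\<lambda>n. {x. n \<bullet> x \<le> 0}) ` S \<union> (\<lambda>n. {x. n \<bullet> x \<ge> 0}) ` T)" by auto
  moreover have "polyhedron (\<Inter>((\<lambda>n. {x. n \<bullet> x \<le> 0}) ` S \<union> (\<lambda>n. {x. n \<bullet> x \<ge> 0}) ` T))"
    using assms by (intro polyhedron_Inter) (auto intro: polyhedron_halfspace_le polyhedron_halfspace_ge)
  ultimately show ?thesis by simp
qed

lemma cone_inequalities: "cone {x. (\<forall>n\<in>S. n \<bullet> x \<le> 0) \<and> (\<forall>n\<in>T. 0 \<le> n \<bullet> x)}"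
  unfolding cone_def by (auto simp: mult_nonneg_nonpos)

section \<open>Cones spanned by the classes\<close>

locale region_lattice = normals N \<beta> + lattice_quotient "normals.Regs N" le k P
  for N :: "'a::euclidean_space set" and \<beta> and le and k :: "'a set \<Rightarrow> 'c" and P +
  assumes le_iff: "\<lbrakk>R \<in> normals.Regs N; R' \<in> normals.Regs N\<rbrakk> \<Longrightarrow> le R R' \<longleftrightarrow> normals.sg N R \<subseteq> normals.sg N R'"
begin

lemma dual_region_lattice: "region_lattice (uminus ` N) (- \<beta>) (\<lambda>x y. le y x) k (\<lambda>x y. P y x)"
proof -
  interpret d: normals "uminus ` N" "- \<beta>" by (rule negated)
  interpret l: lattice_quotient Regs "\<lambda>x y. le y x" k "\<lambda>x y. P y x" by (rule dual)
  have "le R' R \<longleftrightarrow> d.sg R \<subseteq> d.sg R'" if "R \<in> Regs" "R' \<in> Regs" for R R'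
  proof -
    have "d.sg R \<subseteq> d.sg R' \<longleftrightarrow> N - sg R \<subseteq> N - sg R'"
      unfolding negated_sg[OF that(1)] negated_sg[OF that(2)] by (rule inj_image_subset_iff) simp
    also have "\<dots> \<longleftrightarrow> sg R' \<subseteq> sg R" using sg_N[of R] sg_N[of R'] by blast
    finally show ?thesis using le_iff[OF that(2,1)] by simp
  qed
  then show ?thesis
    using l.lattice_quotient_axioms d.normals_axioms
    unfolding region_lattice_def region_lattice_axioms_def negated_Regs by blast
qed

definition "D C = \<Union>{R \<in> Regs. k R = C}"

lemma k_iff: "\<lbrakk>C \<in> M; R \<in> Regs\<rbrakk> \<Longrightarrow> k R = C \<longleftrightarrow> sg (bt C) \<subseteq> sg R \<and> sg R \<subseteq> sg (tp C)"
  using k_eq_iff le_iff bt(1) tp(1) by simp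

lemma bt_tp: "C \<in> M \<Longrightarrow> sg (bt C) \<subseteq> sg (tp C)"
  using k_iff[of C "bt C"] bt[of C] by simp

text \<open>A solution \<open>x\<close> of the inequalities, displaced slightly in the direction of
  a point inside \<open>a\<close>, lands in a region that still contains \<open>x\<close>. Ties are
  resolved as in \<open>a\<close>, so its sign set lies between those of \<open>a\<close> and
  \<open>b\<close>.\<close>

lemma Union_interval:
  assumes a: "a \<in> Regs" and b: "b \<in> Regs" and ab: "sg a \<subseteq> sg b"
  shows "\<Union>{R \<in> Regs. sg a \<subseteq> sg R \<and> sg R \<subseteq> sg b} = {x. (\<forall>n\<in>sg a. n \<bullet> x \<le> 0) \<and> (\<forall>n\<in>N - sg b. 0 \<le> n \<bullet> x)}"
proof
  show "\<Union>{R \<in> Regs. sg a \<subseteq> sg R \<and> sg R \<subseteq> sg b} \<subseteq> {x. (\<forall>n\<in>sg a. n \<bullet> x \<le> 0) \<and> (\<forall>n\<in>N - sg b. 0 \<le> n \<bullet> x)}"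
  proof
    fix x assume "x \<in> \<Union>{R \<in> Regs. sg a \<subseteq> sg R \<and> sg R \<subseteq> sg b}"
    then obtain R where R: "R \<in> Regs" "sg a \<subseteq> sg R" "sg R \<subseteq> sg b" "x \<in> R" by blast
    have "n \<bullet> x \<le> 0" if "n \<in> sg a" for n using sg_reg_points[OF R(1) _ R(4)] R(2) that by blast
    moreover have "0 \<le> n \<bullet> x" if "n \<in> N - sg b" for n using not_sg_points[OF R(1) _ R(4)] R(3) that by blast
    ultimately show "x \<in> {x. (\<forall>n\<in>sg a. n \<bullet> x \<le> 0) \<and> (\<forall>n\<in>N - sg b. 0 \<le> n \<bullet> x)}" by blast
  qed
  show "{x. (\<forall>n\<in>sg a. n \<bullet> x \<le> 0) \<and> (\<forall>n\<in>N - sg b. 0 \<le> n \<bullet> x)} \<subseteq> \<Union>{R \<in> Regs. sg a \<subseteq> sg R \<and> sg R \<subseteq> sg b}"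
  proof
    fix x assume "x \<in> {x. (\<forall>n\<in>sg a. n \<bullet> x \<le> 0) \<and> (\<forall>n\<in>N - sg b. 0 \<le> n \<bullet> x)}"
    then have x: "\<And>n. n \<in> sg a \<Longrightarrow> n \<bullet> x \<le> 0" "\<And>n. n \<in> N - sg b \<Longrightarrow> 0 \<le> n \<bullet> x" by blast+
    obtain z where z: "zer z = {}" "neg z = sg a" using Regs_E[OF a] by metis
    obtain t where t: "neg (x + t *\<^sub>R z) = neg x \<union> (zer x \<inter> neg z)" "zer (x + t *\<^sub>R z) = {}"
      using perturb[of x z] z(1) by auto
    let ?R = "mreg (x + t *\<^sub>R z)"
    have sgR: "sg ?R = neg x \<union> (zer x \<inter> sg a)" using mreg(2) t(1) z(2) by simp
    have "x \<in> ?R" using mem_region[OF mreg(1)] sgR by blast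
    moreover have "sg a \<subseteq> sg ?R"
    proof
      fix n assume n: "n \<in> sg a"
      then have "n \<in> N" "n \<bullet> x \<le> 0" using x(1) sg_N by auto
      then have "n \<in> neg x \<or> n \<in> zer x" by (auto simp: neg_def zer_def)
      then show "n \<in> sg ?R" using n sgR by blast
    qed
    moreover have "neg x \<subseteq> sg b"
    proof
      fix n assume n: "n \<in> neg x"
      then show "n \<in> sg b" using x(2)[of n] by (force simp: neg_def)
    qed
    then have "sg ?R \<subseteq> sg b" using sgR ab by blast
    ultimately show "x \<in> \<Union>{R \<in> Regs. sg a \<subseteq> sg R \<and> sg R \<subseteq> sg b}" using mreg(1) by blast
  qed
qed

lemma D_eq:
  assumes "C \<in> M"
  shows "D C = {x. (\<forall>n\<in>sg (bt C). n \<bullet> x \<le> 0) \<and> (\<forall>n\<in>N - sg (tp C). 0 \<le> n \<bullet> x)}"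
proof -
  have "{R \<in> Regs. k R = C} = {R \<in> Regs. sg (bt C) \<subseteq> sg R \<and> sg R \<subseteq> sg (tp C)}"
    using k_iff[OF assms] by blast
  then show ?thesis unfolding D_def using Union_interval[OF bt(1) tp(1) bt_tp] assms by simp
qed

lemma D_polyhedron: "C \<in> M \<Longrightarrow> polyhedron (D C)"
  unfolding D_eq by (intro polyhedron_inequalities) (use finN finite_subset[OF sg_N] in auto)

lemma D_cone: "C \<in> M \<Longrightarrow> cone (D C)"
  unfolding D_eq by (rule cone_inequalities)

lemma D_convex: "C \<in> M \<Longrightarrow> convex (D C)" and D_closed: "C \<in> M \<Longrightarrow> closed (D C)"
  using D_polyhedron polyhedron_imp_convex polyhedron_imp_closed by blast+

lemma D_add: "\<lbrakk>C \<in> M; x \<in> D C; y \<in> D C\<rbrakk> \<Longrightarrow> x + y \<in> D C"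
  unfolding D_eq by (simp add: inner_add_right add_nonpos_nonpos)

lemma D_scale: "\<lbrakk>C \<in> M; x \<in> D C; 0 \<le> t\<rbrakk> \<Longrightarrow> t *\<^sub>R x \<in> D C"
  using D_cone unfolding cone_def by blast

lemma region_in_D: "R \<in> Regs \<Longrightarrow> R \<subseteq> D (k R)"
  unfolding D_def by blast

lemma generic_in_D: "\<lbrakk>C \<in> M; zer z = {}\<rbrakk> \<Longrightarrow> z \<in> D C \<longleftrightarrow> k (mreg z) = C"
  unfolding D_def using region_of_generic[of _ z] mreg(1)[of z] by blast

lemma generic_interior_D: "\<lbrakk>C \<in> M; zer z = {}; z \<in> D C\<rbrakk> \<Longrightarrow> z \<in> interior (D C)"
proof -
  assume z: "C \<in> M" "zer z = {}" "z \<in> D C"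
  then have "k (mreg z) = C" using generic_in_D by simp
  then have "mreg z \<subseteq> D C" using region_in_D[OF mreg(1)[of z]] by simp
  then show "z \<in> interior (D C)" using interior_mono generic_interior[OF z(2)] by blast
qed

lemma ex_generic:
  assumes "R \<in> Regs"
  obtains z where "zer z = {}" "neg z = sg R" "mreg z = R" "z \<in> R"
proof -
  obtain z where z: "zer z = {}" "neg z = sg R" using Regs_E[OF assms] by metis
  then have "mreg z = R" using sg_inj[OF mreg(1) assms] mreg(2) by simp
  then show thesis using that z mem_mreg by blast
qed

lemma D_inj: "\<lbrakk>C \<in> M; C' \<in> M; D C = D C'\<rbrakk> \<Longrightarrow> C = C'"
proof -
  assume C: "C \<in> M" "C' \<in> M" "D C = D C'"
  obtain z where z: "zer z = {}" "mreg z = tp C" "z \<in> tp C" using ex_generic[OF tp(1)[OF C(1)]] by metis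
  have "z \<in> D C" using region_in_D[OF tp(1)[OF C(1)]] tp(2)[OF C(1)] z(3) by auto
  then have "k (mreg z) = C" "k (mreg z) = C'"
    using generic_in_D[OF C(1) z(1)] generic_in_D[OF C(2) z(1)] unfolding C(3) by blast+
  then show "C = C'" by blast
qed

text \<open>The regions containing \<open>p\<close> are those between \<open>mreg p\<close> and
  \<open>Mreg p\<close>, and by \<open>interval_lift\<close> an interval of regions meets exactly an
  interval of classes.\<close>

lemma star:
  assumes "C \<in> M"
  shows "p \<in> D C \<longleftrightarrow> P (k (mreg p)) C \<and> P C (k (Mreg p))"
proof -
  have "le (mreg p) (Mreg p)" using le_iff mreg by auto
  then have "P (k (mreg p)) C \<and> P C (k (Mreg p)) \<longleftrightarrow> (\<exists>z\<in>Regs. k z = C \<and> le (mreg p) z \<and> le z (Mreg p))"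
    using interval_lift[OF mreg(1,3) _ assms] by blast
  also have "\<dots> \<longleftrightarrow> (\<exists>z\<in>Regs. k z = C \<and> p \<in> z)"
  proof (intro bex_cong refl)
    fix z assume z: "z \<in> Regs"
    show "(k z = C \<and> le (mreg p) z \<and> le z (Mreg p)) \<longleftrightarrow> (k z = C \<and> p \<in> z)"
      using le_iff[OF mreg(1) z] le_iff[OF z mreg(3)] mreg(2,4) mem_region[OF z] by simp
  qed
  finally show ?thesis unfolding D_def by blast
qed

lemma star_mono: "P (k (mreg p)) (k (Mreg p))"
proof -
  have "le (mreg p) (Mreg p)" using le_iff mreg by auto
  then show ?thesis using P_mono mreg by blast
qed

text \<open>Move from \<open>p\<close> a little along \<open>v\<close> and then slightly into
  \<open>R\<close>. If \<open>p + v\<close> is in the cone of the class of \<open>R\<close>, the end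
  point is there too by convexity, and being generic it determines the class.\<close>

lemma ex_tilted:
  assumes R: "R \<in> Regs" "p \<in> R"
  shows "\<exists>R'\<in>Regs. sg R' = neg p \<union> (zer p \<inter> neg v) \<union> (sg R \<inter> zer p \<inter> zer v) \<and> (p + v \<in> D (k R) \<longrightarrow> k R' = k R)"
proof -
  obtain z where z: "zer z = {}" "neg z = sg R" "z \<in> R" using ex_generic[OF R(1)] by metis
  obtain e where e: "e > 0" "\<forall>t. 0 < t \<and> t \<le> e \<longrightarrow> neg (p + t *\<^sub>R v) = neg p \<union> (zer p \<inter> neg v) \<and>
     zer (p + t *\<^sub>R v) = zer p \<inter> zer v" using perturb[of p v] by (elim exE conjE)
  define t where "t = min e 1"
  have t: "0 < t" "t \<le> 1" "t \<le> e" using e(1) by (auto simp: t_def)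
  obtain s where s: "s > 0" "neg ((p + t *\<^sub>R v) + s *\<^sub>R z) = neg (p + t *\<^sub>R v) \<union> (zer (p + t *\<^sub>R v) \<inter> neg z)"
     "zer ((p + t *\<^sub>R v) + s *\<^sub>R z) = zer (p + t *\<^sub>R v) \<inter> zer z"
    using perturb[of "p + t *\<^sub>R v" z] by blast
  let ?q = "(p + t *\<^sub>R v) + s *\<^sub>R z"
  have q: "neg ?q = neg p \<union> (zer p \<inter> neg v) \<union> (sg R \<inter> zer p \<inter> zer v)" "zer ?q = {}"
    using s e(2)[rule_format, OF conjI[OF t(1,3)]] z by auto
  have kq: "k (mreg ?q) = k R" if "p + v \<in> D (k R)"
  proof -
    have pv: "p + v \<in> D (k R)" "k R \<in> M" using that R(1) by auto
    have RD: "p \<in> D (k R)" "z \<in> D (k R)" using region_in_D[OF R(1)] R(2) z(3) by auto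
    have "p + t *\<^sub>R v = (1 - t) *\<^sub>R p + t *\<^sub>R (p + v)" by (simp add: algebra_simps)
    then have "p + t *\<^sub>R v \<in> D (k R)" using D_add D_scale pv RD t by simp
    then have "?q \<in> D (k R)" using D_add[OF pv(2)] D_scale[OF pv(2) RD(2)] s(1) by (simp add: less_imp_le)
    then show ?thesis using generic_in_D[OF pv(2) q(2)] by simp
  qed
  show ?thesis
  proof (intro bexI[OF _ mreg(1)[of ?q]] conjI impI)
    show "sg (mreg ?q) = neg p \<union> (zer p \<inter> neg v) \<union> (sg R \<inter> zer p \<inter> zer v)"
      using mreg(2) q(1) by simp
  qed (rule kq)
qed

text \<open>The direction \<open>v\<close> is linear at \<open>p\<close> for a cone iff the lowest regions containing \<open>p\<close>, \<open>p + \<epsilon>v\<close> and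
  \<open>p - \<epsilon>v\<close> are congruent, and this condition does not involve the cone.\<close>
lemma common_lineality:
  assumes C: "C \<in> M" "C' \<in> M" and p: "p \<in> D C" "p \<in> D C'" and v: "p + v \<in> D C" "p - v \<in> D C"
  shows "\<exists>e>0. \<forall>t. 0 < t \<and> t \<le> e \<longrightarrow> p + t *\<^sub>R v \<in> D C'"
proof -
  define A1 where "A1 = zer p \<inter> neg v"
  define A2 where "A2 = zer p \<inter> neg (- v)"
  define Z where "Z = zer p \<inter> zer v"
  have dis: "A1 \<inter> A2 = {}" "A1 \<inter> Z = {}" "A2 \<inter> Z = {}" "zer p = A1 \<union> A2 \<union> Z" "neg p \<inter> zer p = {}"
    by (auto simp: A1_def A2_def Z_def neg_def zer_def)
  have zm: "zer (- v) = zer v" by (simp add: zer_def)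
  obtain R where R: "R \<in> Regs" "k R = C" "p \<in> R" using p(1) by (auto simp: D_def)
  obtain R' where R': "R' \<in> Regs" "k R' = C'" "p \<in> R'" using p(2) by (auto simp: D_def)
  obtain R1 where R1: "R1 \<in> Regs" "sg R1 = neg p \<union> A1 \<union> (sg R \<inter> Z)" "k R1 = C"
    using ex_tilted[OF R(1,3), of v] R(2) v(1) by (auto simp: A1_def Z_def Int_assoc)
  obtain R2 where R2: "R2 \<in> Regs" "sg R2 = neg p \<union> A2 \<union> (sg R \<inter> Z)" "k R2 = C"
    using ex_tilted[OF R(1,3), of "- v"] R(2) v(2) zm by (auto simp: A2_def Z_def Int_assoc)
  have ex1: "\<exists>S\<in>Regs. sg S = neg p \<union> A1 \<union> (sg T \<inter> Z)"
    and ex2: "\<exists>S\<in>Regs. sg S = neg p \<union> A2 \<union> (sg T \<inter> Z)" if T: "T \<in> Regs" "p \<in> T" for T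
    using ex_tilted[OF T, of v] ex_tilted[OF T, of "- v"] zm
    unfolding A1_def A2_def Z_def by (auto simp: Int_assoc)
  obtain S1 where S1: "S1 \<in> Regs" "sg S1 = neg p \<union> A1 \<union> (sg R' \<inter> Z)" using ex1[OF R'(1,3)] by blast
  obtain S2 where S2: "S2 \<in> Regs" "sg S2 = neg p \<union> A2 \<union> (sg R' \<inter> Z)" using ex2[OF R'(1,3)] by blast
  have npZ: "neg p \<inter> Z = {}" using dis(4,5) by blast
  define m0 where "m0 = mreg p"
  have m0: "m0 \<in> Regs" "sg m0 = neg p" "p \<in> m0" using mreg mem_mreg by (auto simp: m0_def)
  obtain m1 where m1: "m1 \<in> Regs" "sg m1 = neg p \<union> A1" using ex1[OF m0(1,3)] m0(2) npZ by auto
  obtain m2 where m2: "m2 \<in> Regs" "sg m2 = neg p \<union> A2" using ex2[OF m0(1,3)] m0(2) npZ by auto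
  \<comment> \<open>Meeting the congruent pair \<open>T\<close>, \<open>Tm\<close> with
    \<open>m\<close>, which lies below \<open>Tm\<close> and shares with \<open>T\<close> only
    normals of \<open>m0\<close>, gives \<open>m0\<close> and \<open>m\<close>. The pair will be
    \<open>R1\<close>, \<open>R2\<close> in either order.\<close>
  have bot: "k m = k m0" if m: "m \<in> Regs" "m0 \<in> Regs" "le m Tm" "Tm \<in> Regs" "T \<in> Regs" "le m0 T" "le m0 m"
    "sg T \<inter> sg m \<subseteq> sg m0" "k T = k Tm" for m T Tm
  proof -
    have "sg (mt T m) \<subseteq> sg m0"
      using mt_lb1[OF m(5,1)] mt_lb2[OF m(5,1)] m(8) le_iff[OF mt_in[OF m(5,1)]] m(1,5) by blast
    then have "mt T m = m0"
      using le_antisym[OF mt_in[OF m(5,1)] m(2)] mt_greatest[OF m(5,1,2,6,7)]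
        le_iff[OF mt_in[OF m(5,1)] m(2)] by blast
    moreover have "k (mt T m) = k (mt Tm m)" using meet_cong[OF m(5,4,1,9)] .
    moreover have "mt Tm m = m" using mt_absorb2[OF m(4,1,3)] .
    ultimately show ?thesis by simp
  qed
  have "k m2 = k m0"
    by (rule bot[of m2 R2 R1]) (use R1 R2 m0 m2 dis le_iff in auto)
  moreover have "k m1 = k m0"
    by (rule bot[of m1 R1 R2]) (use R1 R2 m0 m1 dis le_iff in auto)
  ultimately have mk: "k m1 = k m0" "k m2 = k m0" by simp_all
  \<comment> \<open>\<open>S1\<close> and \<open>S2\<close> are \<open>R'\<close> tilted along
    \<open>v\<close> and \<open>- v\<close>. As \<open>m1\<close> and \<open>m2\<close> are
    congruent to \<open>m0\<close>, the join \<open>u\<close> is congruent to \<open>S2\<close> and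
    \<open>w\<close> to \<open>S1\<close>. The two joins coincide, so \<open>S1\<close> and
    \<open>S2\<close> are congruent, and \<open>R'\<close> lies between their meet and
    \<open>u\<close>.\<close>
  define u where "u = jn m1 S2"
  define w where "w = jn m2 S1"
  have uw: "u \<in> Regs" "w \<in> Regs" using m1 m2 S1 S2 by (simp_all add: u_def w_def)
  have sgR': "neg p \<subseteq> sg R'" "sg R' \<subseteq> neg p \<union> zer p" using mem_region[OF R'(1)] R'(3) by blast+
  have u1: "le m1 u" "le S2 u" and w1: "le m2 w" "le S1 w"
    using jn_ub1 jn_ub2 m1(1) m2(1) S1(1) S2(1) by (auto simp: u_def w_def)
  have su: "neg p \<union> A1 \<union> A2 \<union> (sg R' \<inter> Z) \<subseteq> sg u"
    using u1 le_iff[OF m1(1) uw(1)] le_iff[OF S2(1) uw(1)] m1(2) S2(2) by blast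
  have sw: "neg p \<union> A1 \<union> A2 \<union> (sg R' \<inter> Z) \<subseteq> sg w"
    using w1 le_iff[OF m2(1) uw(2)] le_iff[OF S1(1) uw(2)] m2(2) S1(2) by blast
  have "le w u" unfolding w_def
    by (rule jn_least) (use m2 S1 uw(1) su le_iff in auto)
  moreover have "le u w" unfolding u_def
    by (rule jn_least) (use m1 S2 uw(2) sw le_iff in auto)
  ultimately have "u = w" using le_antisym uw by blast
  have "k u = k (jn m0 S2)" unfolding u_def using join_cong[OF m1(1) m0(1) S2(1) mk(1)] .
  also have "jn m0 S2 = S2" using jn_absorb[OF m0(1) S2(1)] le_iff[OF m0(1) S2(1)] m0 S2 by blast
  finally have ku: "k u = k S2" .
  have "k w = k (jn m0 S1)" unfolding w_def using join_cong[OF m2(1) m0(1) S1(1) mk(2)] .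
  also have "jn m0 S1 = S1" using jn_absorb[OF m0(1) S1(1)] le_iff[OF m0(1) S1(1)] m0 S1 by blast
  finally have kw: "k w = k S1" .
  have S12: "k S1 = k S2" using ku kw \<open>u = w\<close> by simp
  let ?m = "mt S1 S2"
  have m: "?m \<in> Regs" using S1 S2 by simp
  have "k ?m = k (mt S2 S2)" using meet_cong[OF S1(1) S2(1) S2(1) S12] .
  then have km: "k ?m = k u" using ku mt_absorb[OF S2(1) S2(1) le_refl[OF S2(1)]] by simp
  have "sg ?m \<subseteq> sg S1 \<inter> sg S2"
    using mt_lb1[OF S1(1) S2(1)] mt_lb2[OF S1(1) S2(1)] le_iff[OF m S1(1)] le_iff[OF m S2(1)] by blast
  then have "le ?m R'" using le_iff[OF m R'(1)] S1(2) S2(2) dis sgR' by blast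
  moreover have "le R' u" using le_iff[OF R'(1) uw(1)] su sgR' dis(4) by blast
  ultimately have "k R' = k ?m" using k_between[OF m R'(1) uw(1)] km by blast
  then have kS1: "k S1 = C'" using km ku S12 R'(2) by simp
  obtain e where e: "e > 0" "\<forall>t. 0 < t \<and> t \<le> e \<longrightarrow> neg (p + t *\<^sub>R v) = neg p \<union> A1 \<and> zer (p + t *\<^sub>R v) = Z"
    using perturb[of p v] unfolding A1_def Z_def by (elim exE conjE)
  have "p + t *\<^sub>R v \<in> D C'" if "0 < t \<and> t \<le> e" for t
  proof -
    have "p + t *\<^sub>R v \<in> S1"
      using mem_region[OF S1(1), of "p + t *\<^sub>R v"] e(2)[rule_format, OF that] S1(2) by blast
    then show ?thesis using region_in_D[OF S1(1)] kS1 by blast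
  qed
  then show ?thesis using e(1) by blast
qed

end

lemma last_point_in_closed_convex:
  fixes S :: "'a::euclidean_space set"
  assumes "closed S" "x \<in> S"
  obtains t where "0 \<le> t" "t \<le> 1" "x + t *\<^sub>R v \<in> S" "\<And>s. t < s \<Longrightarrow> s \<le> 1 \<Longrightarrow> x + s *\<^sub>R v \<notin> S"
proof -
  let ?T = "{0..1} \<inter> (\<lambda>t. x + t *\<^sub>R v) -` S"
  have "continuous_on UNIV (\<lambda>t. x + t *\<^sub>R v)" by (intro continuous_intros)
  then have "closed ((\<lambda>t. x + t *\<^sub>R v) -` S)" using closed_vimage[OF assms(1)] by blast
  then have "compact ?T" by (intro compact_Int_closed) auto
  moreover have "0 \<in> ?T" using assms(2) by simp
  ultimately obtain t where t: "t \<in> ?T" "\<And>s. s \<in> ?T \<Longrightarrow> s \<le> t" using compact_attains_sup[of ?T] by blast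
  show thesis
  proof (rule that[of t])
    show "x + s *\<^sub>R v \<notin> S" if "t < s" "s \<le> 1" for s
      using t(2)[of s] t(1) that by force
  qed (use t(1) in auto)
qed

context region_lattice
begin

text \<open>From the common point \<open>x\<close>, slide towards \<open>a\<close> to the last point
  in \<open>D C'\<close>. As long as this is not \<open>a\<close>, the line can be followed both
  ways inside \<open>D C\<close>, so \<open>common_lineality\<close> allows going further in
  \<open>D C'\<close>.\<close>

lemma face_Int:
  assumes C: "C \<in> M" "C' \<in> M"
  shows "(D C \<inter> D C') face_of D C"
proof -
  have key: "a \<in> D C'" if h: "a \<in> D C" "b \<in> D C" "x \<in> D C" "x \<in> D C'" "x \<in> open_segment a b" for a b x
  proof -
    obtain l where l: "0 < l" "l < 1" "x = (1 - l) *\<^sub>R a + l *\<^sub>R b" using h(5) by (auto simp: in_segment)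
    let ?v = "a - x"
    obtain t where t: "0 \<le> t" "t \<le> 1" "x + t *\<^sub>R ?v \<in> D C'"
      "\<And>s. t < s \<Longrightarrow> s \<le> 1 \<Longrightarrow> x + s *\<^sub>R ?v \<notin> D C'"
      using last_point_in_closed_convex[OF D_closed[OF C(2)] h(4), of ?v] by blast
    have "t = 1"
    proof (rule ccontr)
      assume "t \<noteq> 1"
      then have t1: "t < 1" using t(2) by simp
      \<comment> \<open>Chosen so that \<open>b\<close> is \<open>x - d *\<^sub>R ?v\<close>; the
        segment is the parameter range from \<open>- d\<close> to \<open>1\<close>.\<close>
      define d where "d = (1 - l) / l"
      have d: "0 < d" "l * d = 1 - l" using l by (auto simp: d_def)
      define s where "s = min (1 - t) d"
      have s: "0 < s" "s \<le> 1 - t" "s \<le> d" using t1 d by (auto simp: s_def)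
      let ?y = "x + t *\<^sub>R ?v"
      have b: "x - d *\<^sub>R ?v = b"
      proof -
        have "?v = l *\<^sub>R (a - b)" unfolding l(3) by (simp add: algebra_simps)
        then have "d *\<^sub>R ?v = (1 - l) *\<^sub>R (a - b)" using d(2) by (simp add: mult.commute)
        then show ?thesis unfolding l(3) by (simp add: algebra_simps)
      qed
      have line: "x + r *\<^sub>R ?v \<in> D C" if r: "- d \<le> r" "r \<le> 1" for r
      proof -
        define c where "c = (r + d) / (1 + d)"
        have c: "0 \<le> c" "c \<le> 1" "c * (1 + d) = r + d" using r d(1) by (auto simp: c_def)
        have "(1 - c) *\<^sub>R b + c *\<^sub>R a = x + (c * (1 + d) - d) *\<^sub>R ?v"
          unfolding b[symmetric] by (simp add: algebra_simps)
        then have "x + r *\<^sub>R ?v = (1 - c) *\<^sub>R b + c *\<^sub>R a" using c(3) by simp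
        then show ?thesis using D_add[OF C(1)] D_scale[OF C(1)] h(1,2) c(1,2) by simp
      qed
      have y: "?y \<in> D C" using line[of t] t(1,2) d(1) by simp
      have "?y + s *\<^sub>R ?v \<in> D C" "?y - s *\<^sub>R ?v \<in> D C"
        using line[of "t + s"] line[of "t - s"] t(1,2) s d(1) by (simp_all add: algebra_simps)
      then obtain e where e: "e > 0" "\<forall>q. 0 < q \<and> q \<le> e \<longrightarrow> ?y + q *\<^sub>R (s *\<^sub>R ?v) \<in> D C'"
        using common_lineality[OF C y t(3)] by blast
      define q where "q = min e 1"
      have q: "0 < q" "q \<le> e" "q \<le> 1" using e(1) by (auto simp: q_def)
      have "?y + q *\<^sub>R (s *\<^sub>R ?v) \<in> D C'" using e(2) q by blast
      moreover have "?y + q *\<^sub>R (s *\<^sub>R ?v) = x + (t + q * s) *\<^sub>R ?v" by (simp add: scaleR_add_left)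
      ultimately have in': "x + (t + q * s) *\<^sub>R ?v \<in> D C'" by (simp only:)
      have "0 < q * s" "q * s \<le> 1 * s" using q s by (auto intro: mult_right_mono)
      then have "t < t + q * s" "t + q * s \<le> 1" using s(2) by linarith+
      then show False using t(4)[of "t + q * s"] in' by blast
    qed
    then show ?thesis using t(3) by simp
  qed
  show ?thesis unfolding face_of_def
  proof (intro conjI ballI impI)
    show "convex (D C \<inter> D C')" using D_convex C by (simp add: convex_Int)
    fix a b x assume h: "a \<in> D C" "b \<in> D C" "x \<in> D C \<inter> D C'" "x \<in> open_segment a b"
    then show "a \<in> D C \<inter> D C'" "b \<in> D C \<inter> D C'"
      using key[of a b x] key[of b a x] by (auto simp: open_segment_commute)
  qed simp
qed

section \<open>Walls of a class and its neighbours across them\<close>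

lemma N_minus: "n \<in> N \<Longrightarrow> - n \<notin> N"
  using pos[of n] pos[of "- n"] by auto

lemma N_ne: "n \<in> N \<Longrightarrow> n \<noteq> 0"
  using pos by force

text \<open>The upper and lower walls of \<open>R\<close>, witnessed by points in their relative interior, and the region
  across an upper wall.\<close>
definition "uw R = {n \<in> N. \<exists>p. neg p = sg R \<and> zer p = {n}}"
definition "lw R = {n \<in> N. \<exists>p. zer p = {n} \<and> sg R = insert n (neg p)}"
definition "up R n = reg (insert n (sg R))"

lemma uw_N: "uw R \<subseteq> N" and lw_N: "lw R \<subseteq> N"
  by (auto simp: uw_def lw_def)

lemma uw_not_sg: "n \<in> uw R \<Longrightarrow> n \<notin> sg R"
  unfolding uw_def using neg_zer(3) by blast

lemma lw_sg: "n \<in> lw R \<Longrightarrow> n \<in> sg R"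
  unfolding lw_def by blast

lemma up:
  assumes "n \<in> uw R"
  shows "up R n \<in> Regs" "sg (up R n) = insert n (sg R)"
proof -
  obtain p where p: "neg p = sg R" "zer p = {n}" using assms by (auto simp: uw_def)
  have "up R n = Mreg p" using p by (simp add: up_def Mreg_def)
  then show "up R n \<in> Regs" "sg (up R n) = insert n (sg R)" using mreg(3,4)[of p] p by auto
qed

lemma wall_cases:
  assumes "m \<in> N" "zer q = {m}" "neg q - {m} = sg R - {m}"
  shows "m \<in> sg R \<Longrightarrow> m \<in> lw R" "m \<notin> sg R \<Longrightarrow> m \<in> uw R"
proof -
  have mq: "m \<notin> neg q" using assms(2) neg_zer(3)[of q] by blast
  show "m \<in> lw R" if "m \<in> sg R"
  proof -
    have "sg R = insert m (neg q)" using assms(3) that mq by blast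
    then show ?thesis using assms(1,2) unfolding lw_def by blast
  qed
  show "m \<in> uw R" if "m \<notin> sg R"
  proof -
    have "neg q = sg R" using assms(3) that mq by blast
    then show ?thesis using assms(1,2) unfolding uw_def by blast
  qed
qed

text \<open>At the origin all hyperplanes are tight, so \<open>local_wall\<close> yields a wall of
  \<open>R\<close> that separates it from \<open>R'\<close>; by the inclusion of sign sets it can
  only be an upper one.\<close>

lemma wall_between:
  assumes R: "R \<in> Regs" "R' \<in> Regs" "sg R \<subset> sg R'"
  shows "\<exists>n\<in>uw R. n \<in> sg R'"
proof -
  obtain r where r: "zer r = {}" "neg r = sg R" using ex_generic[OF R(1)] by metis
  obtain y where y: "zer y = {}" "neg y = sg R'" using ex_generic[OF R(2)] by metis
  have sep: "0 < (n \<bullet> r) * - (n \<bullet> y) \<longleftrightarrow> n \<in> sg R' - sg R" if "n \<in> N" for n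
  proof -
    have "n \<bullet> r \<noteq> 0" "n \<bullet> y \<noteq> 0" using that r(1) y(1) by (auto simp: zer_def)
    moreover have "n \<bullet> r < 0 \<longleftrightarrow> n \<in> sg R" "n \<bullet> y < 0 \<longleftrightarrow> n \<in> sg R'"
      unfolding r(2)[symmetric] y(2)[symmetric] neg_def using that by simp_all
    moreover have "n \<in> sg R \<Longrightarrow> n \<in> sg R'" using R(3) by blast
    ultimately show ?thesis by (auto simp: mult_less_0_iff)
  qed
  obtain n0 where n0: "n0 \<in> sg R'" "n0 \<notin> sg R" using R(3) by blast
  then have "n0 \<in> N" using sg_N by blast
  have z0: "zer 0 = N" "neg 0 = {}" by (auto simp: zer_def neg_def)
  have "\<exists>m\<in>zer 0. 0 < (m \<bullet> r) * - (m \<bullet> y) \<and> (\<exists>q. zer q = {m} \<and> neg q - {m} = sg R - {m})"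
    by (rule local_wall[OF r, of 0 n0]) (use z0 n0 sep[OF \<open>n0 \<in> N\<close>] \<open>n0 \<in> N\<close> sg_N in auto)
  then obtain m where m: "m \<in> N" "0 < (m \<bullet> r) * - (m \<bullet> y)" "\<exists>q. zer q = {m} \<and> neg q - {m} = sg R - {m}"
    using z0 by blast
  have "m \<in> sg R'" "m \<notin> sg R" using sep[OF m(1)] m(2) by blast+
  then show ?thesis using wall_cases(2)[OF m(1)] m(3) by blast
qed

text \<open>The tops of the classes are comparable and distinct, and crossing a wall of
  \<open>tp C\<close> that separates them stays below \<open>tp C'\<close>.\<close>

lemma upper_wall_below:
  assumes "C \<in> M" "C' \<in> M" "P C C'" "C \<noteq> C'"
  shows "\<exists>n\<in>uw (tp C). P (k (up (tp C) n)) C'"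
proof -
  have t: "tp C \<in> Regs" "tp C' \<in> Regs" using tp assms by auto
  have le: "le (tp C) (tp C')" using P_tp assms by simp
  have "tp C \<noteq> tp C'" using tp(2)[OF assms(1)] tp(2)[OF assms(2)] assms(4) by metis
  then have "sg (tp C) \<subset> sg (tp C')" using sg_inj[OF t] le le_iff[OF t] by blast
  then obtain n where n: "n \<in> uw (tp C)" "n \<in> sg (tp C')" using wall_between[OF t] by blast
  have "le (up (tp C) n) (tp C')"
    using le_iff[OF up(1)[OF n(1)] t(2)] up(2)[OF n(1)] n(2) \<open>sg (tp C) \<subset> sg (tp C')\<close>
    by (simp add: psubset_imp_subset)
  then show ?thesis using tp(3)[OF assms(2) up(1)[OF n(1)]] n(1) by blast
qed

lemma upper_neighbour:
  assumes C: "C \<in> M" and n: "n \<in> uw (tp C)"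
  shows "k (up (tp C) n) \<in> M" "P C (k (up (tp C) n))" "k (up (tp C) n) \<noteq> C"
    "x \<in> D (k (up (tp C) n)) \<Longrightarrow> n \<bullet> x \<le> 0" "x \<in> D C \<Longrightarrow> 0 \<le> n \<bullet> x"
proof -
  let ?U = "up (tp C) n"
  have U: "?U \<in> Regs" "sg ?U = insert n (sg (tp C))" using up[OF n] by auto
  have t: "tp C \<in> Regs" "k (tp C) = C" using tp[OF C] by auto
  show M1: "k ?U \<in> M" using U(1) by simp
  have "le (tp C) ?U" using le_iff[OF t(1) U(1)] U(2) by blast
  then show "P C (k ?U)" using P_mono[OF t(1) U(1)] t(2) by simp
  have nle: "\<not> P (k ?U) C"
    using tp(3)[OF C U(1)] le_iff[OF U(1) t(1)] U(2) uw_not_sg[OF n] by blast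
  then show "k ?U \<noteq> C" using P_refl[OF C] by metis
  have b: "bt (k ?U) \<in> Regs" "k (bt (k ?U)) = k ?U" using bt[OF M1] by auto
  have bU: "sg (bt (k ?U)) \<subseteq> sg ?U" using bt_le[OF U(1)] le_iff[OF b(1) U(1)] by blast
  \<comment> \<open>Otherwise the bottom of the neighbouring class would be below
    \<open>tp C\<close>, and the neighbour below \<open>C\<close>.\<close>
  have "n \<in> sg (bt (k ?U))"
  proof (rule ccontr)
    assume "n \<notin> sg (bt (k ?U))"
    then have "sg (bt (k ?U)) \<subseteq> sg (tp C)" using bU unfolding U(2) by blast
    then have "P (k (bt (k ?U))) C" using tp(3)[OF C b(1)] le_iff[OF b(1) t(1)] by blast
    then show False using nle b(2) by simp
  qed
  then show "x \<in> D (k ?U) \<Longrightarrow> n \<bullet> x \<le> 0" using D_eq[OF M1] by blast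
  have "n \<in> N - sg (tp C)" using n uw_N uw_not_sg by blast
  then show "x \<in> D C \<Longrightarrow> 0 \<le> n \<bullet> x" using D_eq[OF C] by blast
qed

text \<open>No region lies strictly between \<open>tp C\<close> and \<open>up (tp C) n\<close>, and
  any class in between would be represented by a region in between.\<close>

lemma covers_up:
  assumes C: "C \<in> M" and n: "n \<in> uw (tp C)"
  shows "covers M P C (k (up (tp C) n))"
proof -
  let ?U = "up (tp C) n"
  have U: "?U \<in> Regs" "sg ?U = insert n (sg (tp C))" using up[OF n] by auto
  have t: "tp C \<in> Regs" "k (tp C) = C" using tp[OF C] by auto
  note u = upper_neighbour(1-3)[OF C n]
  have le: "le (tp C) ?U" using le_iff[OF t(1) U(1)] U(2) by blast
  have "Z = C \<or> Z = k ?U" if Z: "Z \<in> M" "P C Z" "P Z (k ?U)" for Z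
  proof -
    obtain z where z: "z \<in> Regs" "k z = Z" "le (tp C) z" "le z ?U"
      using interval_lift[OF t(1) U(1) le Z(1)] Z(2,3) t(2) by auto
    have "sg (tp C) \<subseteq> sg z" "sg z \<subseteq> insert n (sg (tp C))"
      using z le_iff[OF t(1) z(1)] le_iff[OF z(1) U(1)] U(2) by auto
    then have "sg z = sg (tp C) \<or> sg z = sg ?U" unfolding U(2) subset_insert_iff
      by (auto split: if_splits)
    then have "z = tp C \<or> z = ?U" using sg_inj[OF z(1) t(1)] sg_inj[OF z(1) U(1)] by blast
    then show ?thesis using z(2) t(2) by blast
  qed
  then have "open_interval M P C (k ?U) = {}" unfolding open_interval_def by auto
  then show ?thesis unfolding covers_def using u C by auto
qed

lemma covers_iff:
  assumes C: "C \<in> M"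
  shows "covers M P C C' \<longleftrightarrow> (\<exists>n\<in>uw (tp C). C' = k (up (tp C) n))"
proof
  assume c: "covers M P C C'"
  then have h: "C' \<in> M" "P C C'" "C \<noteq> C'" "open_interval M P C C' = {}" by (auto simp: covers_def)
  obtain n where n: "n \<in> uw (tp C)" "P (k (up (tp C) n)) C'"
    using upper_wall_below[OF C h(1-3)] by blast
  have "k (up (tp C) n) \<notin> open_interval M P C C'" using h(4) by simp
  then have "k (up (tp C) n) = C'"
    using upper_neighbour(1-3)[OF C n(1)] n(2) unfolding open_interval_def by simp
  then show "\<exists>n\<in>uw (tp C). C' = k (up (tp C) n)" using n(1) by blast
qed (use covers_up[OF C] in blast)

text \<open>When \<open>C\<close> is not the highest class at \<open>p\<close>, some neighbour
  across an upper wall lies between \<open>C\<close> and the highest one, so it contains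
  \<open>p\<close> too.\<close>

lemma upper_exit:
  assumes C: "C \<in> M" and p: "p \<in> D C" "k (Mreg p) \<noteq> C"
  shows "\<exists>n\<in>uw (tp C). n \<bullet> p \<le> 0"
proof -
  have st: "P (k (mreg p)) C" "P C (k (Mreg p))" using star[OF C] p(1) by blast+
  have M': "k (Mreg p) \<in> M" "k (mreg p) \<in> M" using mreg by simp_all
  obtain n where n: "n \<in> uw (tp C)" "P (k (up (tp C) n)) (k (Mreg p))"
    using upper_wall_below[OF C M'(1) st(2)] p(2) by metis
  note u = upper_neighbour[OF C n(1)]
  have "P (k (mreg p)) (k (up (tp C) n))" using P_trans[OF M'(2) C u(1) st(1) u(2)] .
  then have "p \<in> D (k (up (tp C) n))" using star[OF u(1)] n(2) by blast
  then show ?thesis using u(4) n(1) by blast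
qed

text \<open>Dictionary for the dual instance, whose tops are bottoms and whose upper walls are
  negated lower walls.\<close>

lemma dual_simps:
  "lattice_quotient.M (normals.Regs (uminus ` N)) k = M"
  "region_lattice.D (uminus ` N) k = D"
  "lattice_quotient.tp (normals.Regs (uminus ` N)) (\<lambda>x y. le y x) k (\<lambda>x y. P y x) = bt"
  "normals.Mreg (uminus ` N) p = mreg p"
  "C \<in> M \<Longrightarrow> region_lattice.uw (uminus ` N) (bt C) = uminus ` lw (bt C)"
proof -
  interpret d: region_lattice "uminus ` N" "- \<beta>" "\<lambda>x y. le y x" k "\<lambda>x y. P y x" by (rule dual_region_lattice)
  show "d.M = M" by (simp add: d.M_def M_def negated_Regs)
  show "d.D = D" by (intro ext) (simp add: d.D_def D_def negated_Regs)
  show "d.tp = bt" by (intro ext) (unfold d.tp_def, simp only: bt_def negated_Regs)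
  have "N - neg p - zer p \<union> zer p = N - neg p" using neg_zer by blast
  then have "d.neg p \<union> d.zer p = uminus ` (N - neg p)"
    unfolding negated_neg negated_zer by (metis image_Un)
  then show "d.Mreg p = mreg p" using negated_reg[OF neg_zer(1)[of p]] by (simp add: d.Mreg_def mreg_def)
  show "d.uw (bt C) = uminus ` lw (bt C)" if C: "C \<in> M"
  proof -
    have b: "bt C \<in> Regs" using bt C by blast
    have e: "(d.neg q = d.sg (bt C) \<and> d.zer q = {- n}) \<longleftrightarrow> (zer q = {n} \<and> sg (bt C) = insert n (neg q))" for q n
    proof -
      have z: "d.zer q = {- n} \<longleftrightarrow> zer q = {n}"
      proof -
        have "uminus ` zer q = uminus ` {n} \<longleftrightarrow> zer q = {n}" by (rule inj_image_eq_iff) simp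
        then show ?thesis by (simp add: negated_zer)
      qed
      have "d.neg q = d.sg (bt C) \<longleftrightarrow> N - neg q - zer q = N - sg (bt C)"
        unfolding negated_neg negated_sg[OF b] by (rule inj_image_eq_iff) simp
      also have "\<dots> \<longleftrightarrow> sg (bt C) = neg q \<union> zer q"
        using sg_N[of "bt C"] neg_zer(1,2)[of q] by blast
      finally show ?thesis using z by auto
    qed
    show ?thesis
    proof (rule set_eqI)
      fix n
      have "n \<in> d.uw (bt C) \<longleftrightarrow> - n \<in> N \<and> (\<exists>q. d.neg q = d.sg (bt C) \<and> d.zer q = {- (- n)})"
      proof -
        have "n \<in> uminus ` N \<longleftrightarrow> - n \<in> N" by (metis image_iff minus_minus)
        then show ?thesis unfolding d.uw_def by simp
      qed
      also have "\<dots> \<longleftrightarrow> - n \<in> lw (bt C)" unfolding e lw_def by blast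
      also have "\<dots> \<longleftrightarrow> n \<in> uminus ` lw (bt C)" by (metis image_iff minus_minus)
      finally show "n \<in> d.uw (bt C) \<longleftrightarrow> n \<in> uminus ` lw (bt C)" .
    qed
  qed
qed

lemma lower_exit:
  assumes C: "C \<in> M" and p: "p \<in> D C" "k (mreg p) \<noteq> C"
  shows "\<exists>n\<in>lw (bt C). 0 \<le> n \<bullet> p"
proof -
  interpret d: region_lattice "uminus ` N" "- \<beta>" "\<lambda>x y. le y x" k "\<lambda>x y. P y x" by (rule dual_region_lattice)
  have "\<exists>n\<in>d.uw (d.tp C). n \<bullet> p \<le> 0"
    by (rule d.upper_exit) (use C p in \<open>simp_all add: dual_simps\<close>)
  then show ?thesis using dual_simps(5)[OF C] by (auto simp: dual_simps(3))
qed

text \<open>Regions near \<open>p\<close> lie between \<open>mreg p\<close> and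
  \<open>Mreg p\<close>; when these two are congruent, convexity of the class puts all of them into
  it.\<close>

lemma star_constant_open:
  assumes "C \<in> M" "k (mreg p) = C" "k (Mreg p) = C"
  shows "\<exists>e>0. \<forall>t. 0 < t \<and> t \<le> e \<longrightarrow> p + t *\<^sub>R v \<in> D C"
proof -
  obtain e where e: "e > 0" "\<forall>t. 0 < t \<and> t \<le> e \<longrightarrow> neg (p + t *\<^sub>R v) = neg p \<union> (zer p \<inter> neg v) \<and>
     zer (p + t *\<^sub>R v) = zer p \<inter> zer v" using perturb[of p v] by (elim exE conjE)
  have "p + t *\<^sub>R v \<in> D C" if t: "0 < t \<and> t \<le> e" for t
  proof -
    let ?q = "p + t *\<^sub>R v"
    have "neg p \<subseteq> neg ?q" "neg ?q \<subseteq> neg p \<union> zer p" using e(2)[rule_format, OF t] by auto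
    then have "le (mreg p) (mreg ?q)" "le (mreg ?q) (Mreg p)" using le_iff mreg by simp_all
    then have "k (mreg ?q) = k (mreg p)"
      using k_between[OF mreg(1) mreg(1) mreg(3)] assms(2,3) by simp
    then show ?thesis using region_in_D[OF mreg(1)[of ?q]] mem_mreg(1)[of ?q] assms(2) by auto
  qed
  then show ?thesis using e(1) by blast
qed

text \<open>Follow the segment from a point inside \<open>tp C\<close> to a solution
  \<open>x\<close> of the wall inequalities, up to the last point in \<open>D C\<close>. If this
  comes before \<open>x\<close>, all wall inequalities are strict there, so by
  \<open>upper_exit\<close> and \<open>lower_exit\<close> only \<open>C\<close> occurs nearby and
  the segment continues in \<open>D C\<close>.\<close>

lemma D_walls:
  assumes C: "C \<in> M"
  shows "D C = {x. (\<forall>n\<in>uw (tp C). 0 \<le> n \<bullet> x) \<and> (\<forall>n\<in>lw (bt C). n \<bullet> x \<le> 0)}"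
proof
  have u: "uw (tp C) \<subseteq> N - sg (tp C)" using uw_N uw_not_sg by blast
  have l: "lw (bt C) \<subseteq> sg (bt C)" using lw_sg by blast
  show "D C \<subseteq> {x. (\<forall>n\<in>uw (tp C). 0 \<le> n \<bullet> x) \<and> (\<forall>n\<in>lw (bt C). n \<bullet> x \<le> 0)}"
    unfolding D_eq[OF C] using u l by blast
  show "{x. (\<forall>n\<in>uw (tp C). 0 \<le> n \<bullet> x) \<and> (\<forall>n\<in>lw (bt C). n \<bullet> x \<le> 0)} \<subseteq> D C"
  proof (rule subsetI, rule ccontr)
    fix x assume x: "x \<in> {x. (\<forall>n\<in>uw (tp C). 0 \<le> n \<bullet> x) \<and> (\<forall>n\<in>lw (bt C). n \<bullet> x \<le> 0)}" "x \<notin> D C"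
    obtain r where r: "zer r = {}" "neg r = sg (tp C)" "mreg r = tp C" "r \<in> tp C"
      using ex_generic[OF tp(1)[OF C]] by metis
    have rD: "r \<in> D C" using region_in_D[OF tp(1)[OF C]] r(4) tp(2)[OF C] by auto
    obtain t where t: "0 \<le> t" "t \<le> 1" "r + t *\<^sub>R (x - r) \<in> D C"
      "\<And>s. t < s \<Longrightarrow> s \<le> 1 \<Longrightarrow> r + s *\<^sub>R (x - r) \<notin> D C"
      using last_point_in_closed_convex[OF D_closed[OF C] rD, of "x - r"] by blast
    let ?p = "r + t *\<^sub>R (x - r)"
    have t1: "t < 1" using t(2,3) x(2) by (cases "t = 1") auto
    have p: "n \<bullet> ?p = (1 - t) * (n \<bullet> r) + t * (n \<bullet> x)" for n
      by (simp add: inner_add_right inner_diff_right algebra_simps)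
    have upos: "0 < n \<bullet> r" if "n \<in> uw (tp C)" for n
    proof -
      have "n \<in> N" "n \<notin> neg r" "n \<notin> zer r" using that u r by auto
      then show ?thesis by (auto simp: neg_def zer_def)
    qed
    have lneg: "n \<bullet> r < 0" if "n \<in> lw (bt C)" for n
    proof -
      have "n \<in> neg r" using that l bt_tp[OF C] r(2) by blast
      then show ?thesis by (simp add: neg_def)
    qed
    have "k (Mreg ?p) = C"
    proof (rule ccontr)
      assume "k (Mreg ?p) \<noteq> C"
      then obtain n where n: "n \<in> uw (tp C)" "n \<bullet> ?p \<le> 0" using upper_exit[OF C t(3)] by blast
      have "0 < (1 - t) * (n \<bullet> r)" "0 \<le> t * (n \<bullet> x)" using upos[OF n(1)] t1 t(1) x(1) n(1) by simp_all
      then show False using n(2) p[of n] by linarith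
    qed
    moreover have "k (mreg ?p) = C"
    proof (rule ccontr)
      assume "k (mreg ?p) \<noteq> C"
      then obtain n where n: "n \<in> lw (bt C)" "0 \<le> n \<bullet> ?p" using lower_exit[OF C t(3)] by blast
      have "(1 - t) * (n \<bullet> r) < 0" "t * (n \<bullet> x) \<le> 0"
        using lneg[OF n(1)] t1 t(1) x(1) n(1) by (simp_all add: mult_pos_neg mult_nonneg_nonpos)
      then show False using n(2) p[of n] by linarith
    qed
    ultimately obtain e where e: "e > 0" "\<forall>s. 0 < s \<and> s \<le> e \<longrightarrow> ?p + s *\<^sub>R (x - r) \<in> D C"
      using star_constant_open[OF C, of ?p "x - r"] by blast
    define s where "s = min e (1 - t)"
    have s: "0 < s" "s \<le> e" "s \<le> 1 - t" using e(1) t1 by (auto simp: s_def)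
    have "?p + s *\<^sub>R (x - r) \<in> D C" using e(2) s by blast
    moreover have "?p + s *\<^sub>R (x - r) = r + (t + s) *\<^sub>R (x - r)" by (simp add: scaleR_add_left)
    ultimately have "r + (t + s) *\<^sub>R (x - r) \<in> D C" by (simp only:)
    moreover have "t < t + s" "t + s \<le> 1" using s by linarith+
    ultimately show False using t(4)[of "t + s"] by blast
  qed
qed

end

section \<open>The quotient fan\<close>

lemma unit_normals_eq:
  fixes n \<nu> :: "'a::real_inner"
  assumes "norm n = 1" "norm \<nu> = 1" "\<And>w. n \<bullet> w = 0 \<Longrightarrow> \<nu> \<bullet> w = 0"
  shows "\<nu> = n \<or> \<nu> = - n"
proof -
  have n: "n \<bullet> n = 1" and v: "\<nu> \<bullet> \<nu> = 1" using assms by (simp_all add: dot_square_norm)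
  let ?w = "\<nu> - (n \<bullet> \<nu>) *\<^sub>R n"
  have nw: "n \<bullet> ?w = 0" by (simp add: inner_diff_right n)
  then have "?w \<bullet> ?w = 0" using assms(3)[of ?w] by (simp add: inner_diff_left)
  then have eq: "\<nu> = (n \<bullet> \<nu>) *\<^sub>R n" by simp
  have "\<nu> \<bullet> \<nu> = (n \<bullet> \<nu>) * (n \<bullet> \<nu>)" by (subst (1) eq) simp
  then have "(n \<bullet> \<nu>)\<^sup>2 = 1" using v by (simp add: power2_eq_square)
  then have "n \<bullet> \<nu> = 1 \<or> n \<bullet> \<nu> = - 1" by (simp add: power2_eq_1_iff)
  then show ?thesis using eq by (metis scaleR_minus1_left scaleR_one)
qed

text \<open>Take a face of least dimension containing \<open>p\<close>: if \<open>p\<close> were on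
  its relative boundary, a facet of it would contain \<open>p\<close>.\<close>

lemma ex_face_rel_interior:
  fixes C :: "'a::euclidean_space set"
  assumes "polyhedron C" "p \<in> C"
  shows "\<exists>G. G face_of C \<and> p \<in> rel_interior G"
proof -
  have "C face_of C \<and> p \<in> C" using assms by (simp add: face_of_refl polyhedron_imp_convex)
  then obtain G where G: "G face_of C" "p \<in> G" "\<And>G'. G' face_of C \<Longrightarrow> p \<in> G' \<Longrightarrow> nat (aff_dim G) \<le> nat (aff_dim G')"
    using ex_has_least_nat[of "\<lambda>G. G face_of C \<and> p \<in> G" C "\<lambda>G. nat (aff_dim G)"] by blast
  have "p \<in> rel_interior G"
  proof (rule ccontr)
    assume "p \<notin> rel_interior G"
    then have "p \<in> \<Union>{F. F facet_of G}"
      using rel_boundary_of_polyhedron[OF face_of_polyhedron_polyhedron[OF assms(1) G(1)]] G(2) by blast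
    then obtain G' where G': "G' facet_of G" "p \<in> G'" by blast
    then have "G' face_of C" "aff_dim G' = aff_dim G - 1"
      using face_of_trans G(1) unfolding facet_of_def by blast+
    moreover have "0 \<le> aff_dim G'" using G'(2) aff_dim_negative_iff[of G'] by (metis empty_iff not_less)
    ultimately show False using G(3)[OF _ G'(2)] by simp
  qed
  then show ?thesis using G(1) by blast
qed

text \<open>Here \<open>k\<close> takes a region to the cone of its class, so that the quotient
  lattice and the set of maximal cones are the same set \<open>M\<close>.\<close>

locale region_cones = region_lattice N \<beta> le k P
  for N :: "'a::euclidean_space set" and \<beta> and le and k :: "'a set \<Rightarrow> 'a set" and P +
  assumes k_D: "R \<in> normals.Regs N \<Longrightarrow> k R = region_lattice.D N k (k R)"
begin

lemma D_id: "C \<in> M \<Longrightarrow> D C = C"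
  using k_D M_cases by metis

lemma M_polyhedron: "C \<in> M \<Longrightarrow> polyhedron C" and M_cone: "C \<in> M \<Longrightarrow> cone C"
  and M_convex: "C \<in> M \<Longrightarrow> convex C"
  using D_polyhedron D_cone D_convex D_id by metis+

lemma M_star: "C \<in> M \<Longrightarrow> p \<in> C \<longleftrightarrow> P (k (mreg p)) C \<and> P C (k (Mreg p))"
  using star D_id by metis

lemma M_generic: "\<lbrakk>C \<in> M; zer z = {}\<rbrakk> \<Longrightarrow> z \<in> C \<longleftrightarrow> k (mreg z) = C"
  using generic_in_D D_id by metis

lemma M_face_Int: "\<lbrakk>C \<in> M; C' \<in> M\<rbrakk> \<Longrightarrow> (C \<inter> C') face_of C"
  using face_Int D_id by metis

lemma region_subset: "R \<in> Regs \<Longrightarrow> R \<subseteq> k R"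
  using region_in_D D_id k_in_M by metis

lemma ex_generic_M:
  assumes "C \<in> M"
  obtains z where "zer z = {}" "z \<in> C" "z \<in> interior C"
proof -
  obtain z where z: "zer z = {}" "z \<in> tp C" using ex_generic[OF tp(1)[OF assms]] by metis
  have "z \<in> C" using region_subset[OF tp(1)[OF assms]] tp(2)[OF assms] z(2) by auto
  then show thesis using that z(1) generic_interior_D[OF assms z(1)] D_id[OF assms] by simp
qed

lemma zero_in_M: "C \<in> M \<Longrightarrow> 0 \<in> C"
  using cone_zero_in M_cone ex_generic_M by (metis empty_iff)

lemma span_M: "C \<in> M \<Longrightarrow> span C = UNIV" and aff_dim_M: "C \<in> M \<Longrightarrow> aff_dim C = DIM('a)"
proof -
  assume C: "C \<in> M"
  then have "interior C \<noteq> {}" using ex_generic_M by blast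
  then show a: "aff_dim C = DIM('a)" using low_dim_interior by blast
  have "0 \<in> affine hull C" using zero_in_M[OF C] by (simp add: hull_inc)
  then have "dim C = DIM('a)" using a aff_dim_zero by force
  then show "span C = UNIV" by (simp add: dim_eq_full)
qed

definition "F = {G. G \<noteq> {} \<and> (\<exists>C\<in>M. G face_of C)}"

lemma F_E:
  assumes "G \<in> F"
  obtains C where "C \<in> M" "G face_of C" "G \<noteq> {}" "G \<subseteq> C" "convex G"
  using assms face_of_imp_subset face_of_imp_convex unfolding F_def by blast

lemma M_F: "C \<in> M \<Longrightarrow> C \<in> F"
  unfolding F_def using face_of_refl M_convex zero_in_M by blast

lemma zero_in_F: "G \<in> F \<Longrightarrow> 0 \<in> G"
  using F_E[of G] face_of_cone M_cone cone_zero_in by metis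

text \<open>Intersected with the common face \<open>C \<inter> C'\<close> of their cones,
  \<open>G\<close> and \<open>H\<close> become faces of it, and so does
  \<open>G \<inter> H\<close>.\<close>

lemma F_Int: assumes "G \<in> F" "H \<in> F" shows "(G \<inter> H) face_of G"
proof -
  obtain C where C: "C \<in> M" "G face_of C" "G \<subseteq> C" using F_E[OF assms(1)] by metis
  obtain C' where C': "C' \<in> M" "H face_of C'" "H \<subseteq> C'" using F_E[OF assms(2)] by metis
  have 1: "(C \<inter> C') face_of C" using M_face_Int C(1) C'(1) by blast
  have 2: "(C \<inter> C') face_of C'" using M_face_Int[OF C'(1) C(1)] by (simp add: Int_commute)
  have "(G \<inter> (C \<inter> C')) face_of (C \<inter> C')"
    using face_of_subset[OF face_of_Int[OF C(2) 1]] by blast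
  moreover have "(H \<inter> (C \<inter> C')) face_of (C \<inter> C')"
    using face_of_subset[OF face_of_Int[OF C'(2) 2]] by blast
  ultimately have "(G \<inter> (C \<inter> C') \<inter> (H \<inter> (C \<inter> C'))) face_of (C \<inter> C')" by (rule face_of_Int)
  moreover have "G \<inter> (C \<inter> C') \<inter> (H \<inter> (C \<inter> C')) = G \<inter> H" using C(3) C'(3) by blast
  ultimately have "(G \<inter> H) face_of C" using 1 face_of_trans by simp
  then show ?thesis using face_of_subset[OF _ _ C(3)] by blast
qed

lemma fan_F: "fan F"
  unfolding fan_def
proof (intro conjI ballI allI impI)
  fix G assume G: "G \<in> F"
  obtain C where C: "C \<in> M" "G face_of C" "G \<noteq> {}" using F_E[OF G] by metis
  show "G \<noteq> {}" using C(3) .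
  show p: "polyhedron G" using face_of_polyhedron_polyhedron[OF M_polyhedron] C by blast
  then show "closed G" by (rule polyhedron_imp_closed)
  show "cone G" using face_of_cone[OF C(2) M_cone[OF C(1)]] .
  show "H \<in> F" if "H face_of G \<and> H \<noteq> {}" for H
    using that C face_of_trans unfolding F_def by blast
  show "(G \<inter> H) face_of G" "(G \<inter> H) face_of H" if "H \<in> F" for H
    using F_Int[OF G that] F_Int[OF that G] by (simp_all add: Int_commute)
qed

lemma complete_F: "complete_fan F"
proof -
  have "x \<in> \<Union>F" for x
  proof -
    have "x \<in> k (mreg x)" using region_subset[OF mreg(1)[of x]] mem_mreg(1)[of x] by blast
    then show ?thesis using M_F[OF k_in_M[OF mreg(1)]] by blast
  qed
  then show ?thesis unfolding complete_fan_def using fan_F by blast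
qed

text \<open>A generic point lies in only one cone of \<open>M\<close>, so none of these cones is
  contained in another.\<close>

lemma max_cones_F: "max_cones F = M"
proof
  show "max_cones F \<subseteq> M"
  proof
    fix G assume G: "G \<in> max_cones F"
    then have "G \<in> F" by (simp add: max_cones_def)
    then obtain C where "C \<in> M" "G \<subseteq> C" by (rule F_E)
    then show "G \<in> M" using G M_F unfolding max_cones_def by blast
  qed
  show "M \<subseteq> max_cones F"
  proof
    fix C assume C: "C \<in> M"
    have "G = C" if G: "G \<in> F" "C \<subseteq> G" for G
    proof -
      obtain C' where C': "C' \<in> M" "G \<subseteq> C'" using F_E[OF G(1)] by metis
      obtain z where z: "zer z = {}" "z \<in> C" using ex_generic_M[OF C] by metis
      then have "C' = C" using M_generic[OF C z(1)] M_generic[OF C'(1) z(1)] G(2) C'(2) by blast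
      then show ?thesis using G(2) C'(2) by blast
    qed
    then show "C \<in> max_cones F" unfolding max_cones_def using M_F[OF C] by blast
  qed
qed

text \<open>\<open>G \<inter> C\<close> is a face of \<open>G\<close>, and a face meeting the
  relative interior is everything. Stars of faces thus become stars of points.\<close>

lemma star_rel_interior:
  assumes G: "G \<in> F" and p: "p \<in> rel_interior G" and C: "C \<in> M"
  shows "G \<subseteq> C \<longleftrightarrow> p \<in> C"
proof
  assume "p \<in> C"
  moreover have "p \<in> G" using p rel_interior_subset by blast
  ultimately have "G \<subseteq> G \<inter> C"
    using subset_of_face_of[OF F_Int[OF G M_F[OF C]], of G] p by blast
  then show "G \<subseteq> C" by blast
qed (use p rel_interior_subset in blast)

lemma star_interval: "{C \<in> M. p \<in> C} = interval M P (k (mreg p)) (k (Mreg p))"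
  unfolding interval_def using M_star by blast

lemma star_F: "\<lbrakk>G \<in> F; p \<in> rel_interior G\<rbrakk> \<Longrightarrow> {C \<in> M. G \<subseteq> C} = interval M P (k (mreg p)) (k (Mreg p))"
  using star_rel_interior unfolding star_interval[symmetric] by blast

lemma F_rel_interior: "G \<in> F \<Longrightarrow> \<exists>p. p \<in> rel_interior G"
  using F_E[of G] rel_interior_eq_empty by (metis ex_in_conv)

lemma Union_M_interval:
  assumes "x \<in> M" "y \<in> M" "P x y"
  shows "\<Union>(interval M P x y) = {v. (\<forall>n\<in>sg (bt x). n \<bullet> v \<le> 0) \<and> (\<forall>n\<in>N - sg (tp y). 0 \<le> n \<bullet> v)}"
proof -
  have b: "bt x \<in> Regs" "tp y \<in> Regs" using bt tp assms by auto
  have "P x (k (tp y))" using tp(2)[OF assms(2)] assms(3) by simp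
  then have sub: "sg (bt x) \<subseteq> sg (tp y)" using bt(3)[OF assms(1) b(2)] le_iff[OF b] by simp
  have in_iff: "k R \<in> interval M P x y \<longleftrightarrow> sg (bt x) \<subseteq> sg R \<and> sg R \<subseteq> sg (tp y)" if R: "R \<in> Regs" for R
    unfolding interval_def
    using bt(3)[OF assms(1) R] tp(3)[OF assms(2) R] le_iff[OF b(1) R] le_iff[OF R b(2)] k_in_M[OF R] by simp
  have "\<Union>(interval M P x y) = \<Union>{R \<in> Regs. sg (bt x) \<subseteq> sg R \<and> sg R \<subseteq> sg (tp y)}"
  proof
    show "\<Union>(interval M P x y) \<subseteq> \<Union>{R \<in> Regs. sg (bt x) \<subseteq> sg R \<and> sg R \<subseteq> sg (tp y)}"
    proof
      fix v assume "v \<in> \<Union>(interval M P x y)"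
      then obtain C where C: "C \<in> interval M P x y" "v \<in> C" by blast
      then have "C \<in> M" by (simp add: interval_def)
      then obtain R where R: "R \<in> Regs" "k R = C" "v \<in> R" using D_id[of C] C(2) unfolding D_def by blast
      then show "v \<in> \<Union>{R \<in> Regs. sg (bt x) \<subseteq> sg R \<and> sg R \<subseteq> sg (tp y)}" using in_iff C(1) by blast
    qed
    show "\<Union>{R \<in> Regs. sg (bt x) \<subseteq> sg R \<and> sg R \<subseteq> sg (tp y)} \<subseteq> \<Union>(interval M P x y)"
      using in_iff region_subset by blast
  qed
  then show ?thesis using Union_interval[OF b sub] by simp
qed

lemma fan_lattice_F: "fan_lattice F P"
proof -
  have "polyhedron (\<Union>(interval M P x y)) \<and> cone (\<Union>(interval M P x y))"
    if "x \<in> M" "y \<in> M" "P x y" for x y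
    unfolding Union_M_interval[OF that]
    using finN finite_subset[OF sg_N] by (intro conjI polyhedron_inequalities cone_inequalities) auto
  moreover have "\<exists>x\<in>M. \<exists>y\<in>M. P x y \<and> {C \<in> M. G \<subseteq> C} = interval M P x y" if "G \<in> F" for G
    using F_rel_interior[OF that] star_F[OF that] star_mono k_in_M[OF mreg(1)] k_in_M[OF mreg(3)] by metis
  ultimately show ?thesis
    unfolding fan_lattice_def fan_poset_def max_cones_F using complete_F poset_M lattice_M by blast
qed

lemma polyhedron_region: "R \<in> Regs \<Longrightarrow> polyhedron R"
proof -
  assume "R \<in> Regs"
  then have R: "R = reg (sg R)" using Regs_E by metis
  have f: "finite (sg R)" "finite (N - sg R)" using finN finite_subset[OF sg_N] by auto
  have "polyhedron (reg (sg R))" unfolding reg_def by (rule polyhedron_inequalities[OF f])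
  then show "polyhedron R" by (subst R)
qed

lemma convex_region: "R \<in> Regs \<Longrightarrow> convex R"
  using polyhedron_region polyhedron_imp_convex by blast

text \<open>Slicing a face of the larger cone by a region \<open>R\<close> inside that cone gives a
  face of \<open>R\<close>.\<close>

lemma refined: "refined_by F {G. \<exists>R\<in>Regs. G face_of R \<and> G \<noteq> {}}"
  unfolding refined_by_def
proof
  fix G assume G: "G \<in> F"
  obtain C where C: "C \<in> M" "G face_of C" "G \<subseteq> C" using F_E[OF G] by metis
  let ?S = "{G \<inter> R |R. R \<in> Regs \<and> k R = C \<and> G \<inter> R \<noteq> {}}"
  have "(G \<inter> R) face_of R" if R: "R \<in> Regs" "k R = C" for R
  proof -
    have "R \<subseteq> C" using region_subset R by blast
    then have "C \<inter> R = R" by blast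
    then show ?thesis using face_of_slice[OF C(2) convex_region[OF R(1)]] by simp
  qed
  then have "?S \<subseteq> {G. \<exists>R\<in>Regs. G face_of R \<and> G \<noteq> {}}" by blast
  moreover have "G = \<Union>?S"
  proof
    show "G \<subseteq> \<Union>?S"
    proof
      fix v assume v: "v \<in> G"
      then have "v \<in> D C" using C(3) D_id[OF C(1)] by blast
      then obtain R where "R \<in> Regs" "k R = C" "v \<in> R" unfolding D_def by blast
      then show "v \<in> \<Union>?S" using v by blast
    qed
  qed blast
  ultimately show "\<exists>S\<subseteq>{G. \<exists>R\<in>Regs. G face_of R \<and> G \<noteq> {}}. G = \<Union>S" by blast
qed

text \<open>A neighbourhood of \<open>p\<close> within the hyperplane of \<open>n\<close> belongs to
  both cones, so \<open>\<nu>\<close> vanishes on that hyperplane; a generic point of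
  \<open>tp C\<close>, where \<open>n\<close> is positive, leaves only \<open>- n\<close>.\<close>

lemma separating_normal_of_cover:
  assumes c: "covers M P C C'" and \<nu>: "norm \<nu> = 1" "C \<subseteq> {x. \<nu> \<bullet> x \<le> 0}" "C' \<subseteq> {x. 0 \<le> \<nu> \<bullet> x}"
  shows "- \<nu> \<in> N"
proof -
  have C: "C \<in> M" using c by (simp add: covers_def)
  obtain n where n: "n \<in> uw (tp C)" "C' = k (up (tp C) n)" using covers_iff[OF C] c by blast
  obtain p where p: "n \<in> N" "neg p = sg (tp C)" "zer p = {n}" using n(1) by (auto simp: uw_def)
  have sub: "tp C \<subseteq> C" "up (tp C) n \<subseteq> C'"
    using region_subset[OF tp(1)[OF C]] tp(2)[OF C] region_subset[OF up(1)[OF n(1)]] n(2) by auto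
  have both: "\<nu> \<bullet> q = 0" if "neg q = neg p" "zer q = {n}" for q
  proof -
    have "q \<in> tp C" "q \<in> up (tp C) n"
      using mem_region[OF tp(1)[OF C], of q] mem_region[OF up(1)[OF n(1)], of q] up(2)[OF n(1)] that p(2) by auto
    then have "\<nu> \<bullet> q \<le> 0" "0 \<le> \<nu> \<bullet> q" using sub \<nu>(2,3) by blast+
    then show ?thesis by simp
  qed
  have "\<nu> \<bullet> w = 0" if w: "n \<bullet> w = 0" for w
  proof -
    obtain t where t: "t > 0" "neg (p + t *\<^sub>R w) = neg p \<union> (zer p \<inter> neg w)" "zer (p + t *\<^sub>R w) = zer p \<inter> zer w"
      using perturb[of p w] by blast
    have "n \<notin> neg w" "n \<in> zer w" using w p(1) by (auto simp: neg_def zer_def)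
    then have "\<nu> \<bullet> (p + t *\<^sub>R w) = 0" using both t p(3) by auto
    then show ?thesis using both[of p] p(3) t(1) by (simp add: inner_add_right)
  qed
  then have "\<nu> = n \<or> \<nu> = - n" using unit_normals_eq[OF unit[OF p(1)] \<nu>(1)] by blast
  moreover have "\<nu> \<noteq> n"
  proof
    assume "\<nu> = n"
    obtain z where z: "zer z = {}" "neg z = sg (tp C)" "z \<in> tp C" using ex_generic[OF tp(1)[OF C]] by metis
    have "n \<bullet> z \<le> 0" using z(3) sub(1) \<nu>(2) \<open>\<nu> = n\<close> by blast
    moreover have "n \<notin> neg z" "n \<notin> zer z" using z uw_not_sg[OF n(1)] by auto
    ultimately show False using p(1) by (auto simp: neg_def zer_def)
  qed
  ultimately show ?thesis using p(1) by auto
qed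

section \<open>Leaving a cone towards the base region, and the shelling\<close>

lemma small_base_step:
  "\<exists>e>0. \<forall>t. 0 < t \<and> t \<le> e \<longrightarrow> p + t *\<^sub>R \<beta> \<in> k (mreg p) \<and> p - t *\<^sub>R \<beta> \<in> k (Mreg p) \<and>
     (\<forall>C\<in>M. (p + t *\<^sub>R \<beta> \<in> C \<longrightarrow> C = k (mreg p)) \<and> (p - t *\<^sub>R \<beta> \<in> C \<longrightarrow> C = k (Mreg p)))"
proof -
  obtain e where e: "e > 0" "\<forall>t. 0 < t \<and> t \<le> e \<longrightarrow> neg (p + t *\<^sub>R \<beta>) = neg p \<and> zer (p + t *\<^sub>R \<beta>) = {} \<and>
      neg (p - t *\<^sub>R \<beta>) = neg p \<union> zer p \<and> zer (p - t *\<^sub>R \<beta>) = {}"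
    using perturb_base[of p] by (elim exE conjE)
  have "p + t *\<^sub>R \<beta> \<in> k (mreg p) \<and> p - t *\<^sub>R \<beta> \<in> k (Mreg p) \<and>
     (\<forall>C\<in>M. (p + t *\<^sub>R \<beta> \<in> C \<longrightarrow> C = k (mreg p)) \<and> (p - t *\<^sub>R \<beta> \<in> C \<longrightarrow> C = k (Mreg p)))"
    if t: "0 < t \<and> t \<le> e" for t
  proof -
    have nz: "neg (p + t *\<^sub>R \<beta>) = neg p" "zer (p + t *\<^sub>R \<beta>) = {}"
      "neg (p - t *\<^sub>R \<beta>) = neg p \<union> zer p" "zer (p - t *\<^sub>R \<beta>) = {}" using e(2) t by blast+
    have "mreg (p + t *\<^sub>R \<beta>) = mreg p" "mreg (p - t *\<^sub>R \<beta>) = Mreg p"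
      by (simp_all add: mreg_def Mreg_def nz)
    then show ?thesis
      using M_generic[OF _ nz(2)] M_generic[OF _ nz(4)] k_in_M[OF mreg(1)[of p]] k_in_M[OF mreg(3)[of p]] by auto
  qed
  then show ?thesis using e(1) by blast
qed

text \<open>A small step from \<open>p\<close> towards \<open>\<beta>\<close> enters the lowest cone
  containing \<open>p\<close> and no other.\<close>

lemma leaves_iff:
  assumes C: "C \<in> M" and p: "p \<in> C"
  shows "(\<forall>e>0. p + e *\<^sub>R \<beta> \<notin> C) \<longleftrightarrow> k (mreg p) \<noteq> C"
proof -
  obtain e where e: "e > 0" "\<And>t. 0 < t \<Longrightarrow> t \<le> e \<Longrightarrow> p + t *\<^sub>R \<beta> \<in> k (mreg p)"
    "\<And>t. 0 < t \<Longrightarrow> t \<le> e \<Longrightarrow> p + t *\<^sub>R \<beta> \<in> C \<Longrightarrow> C = k (mreg p)"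
    using small_base_step[of p] C by metis
  show ?thesis
  proof
    assume "\<forall>e>0. p + e *\<^sub>R \<beta> \<notin> C"
    then show "k (mreg p) \<noteq> C" using e(1) e(2)[of e] by auto
  next
    assume ne: "k (mreg p) \<noteq> C"
    show "\<forall>e>0. p + e *\<^sub>R \<beta> \<notin> C"
    proof (intro allI impI notI)
      fix s :: real assume s: "0 < s" "p + s *\<^sub>R \<beta> \<in> C"
      define t where "t = min e s"
      have t: "0 < t" "t \<le> e" "t \<le> s" using e(1) s(1) by (auto simp: t_def)
      have "p + t *\<^sub>R \<beta> = (1 - t / s) *\<^sub>R p + (t / s) *\<^sub>R (p + s *\<^sub>R \<beta>)"
        using s(1) by (simp add: scaleR_add_right scaleR_diff_left)
      moreover have "0 \<le> t / s" "t / s \<le> 1" using t s(1) by auto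
      ultimately have "p + t *\<^sub>R \<beta> \<in> C"
        using M_convex[OF C] p s(2) unfolding convex_alt by metis
      then show False using e(3)[OF t(1,2)] ne by blast
    qed
  qed
qed

text \<open>If both directions along \<open>\<beta>\<close> stayed in \<open>C\<close>, the lowest
  and the highest cone at \<open>p\<close> would be \<open>C\<close>. Then every direction could be
  followed from \<open>p\<close> inside \<open>C\<close>, and the facet would be all of
  \<open>C\<close>.\<close>

lemma transversal_base:
  assumes C: "C \<in> M"
  shows "transversal C \<beta>"
  unfolding transversal_def
proof (intro allI impI ballI, rule ccontr)
  fix G p and e :: real
  assume G: "G facet_of C" and p: "p \<in> rel_interior G" and e: "0 < e"
    and both: "\<not> (p + e *\<^sub>R \<beta> \<notin> C \<or> p - e *\<^sub>R \<beta> \<notin> C)"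
  have Gf: "G face_of C" "G \<noteq> C" using G by (auto simp: facet_of_def)
  have pG: "p \<in> G" using p rel_interior_subset by blast
  then have pC: "p \<in> C" using Gf(1) face_of_imp_subset by blast
  have 1: "k (mreg p) = C" using leaves_iff[OF C pC] both e by blast
  obtain t where t: "t > 0" "t \<le> e" "p - t *\<^sub>R \<beta> \<in> C \<Longrightarrow> C = k (Mreg p)"
  proof -
    obtain e' where e': "e' > 0" "\<And>t. 0 < t \<Longrightarrow> t \<le> e' \<Longrightarrow> p - t *\<^sub>R \<beta> \<in> C \<Longrightarrow> C = k (Mreg p)"
      using small_base_step[of p] C by metis
    show thesis using that[of "min e e'"] e'(2)[of "min e e'"] e e'(1) by simp
  qed
  have "p - t *\<^sub>R \<beta> = (1 - t / e) *\<^sub>R p + (t / e) *\<^sub>R (p - e *\<^sub>R \<beta>)"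
    using e by (simp add: scaleR_diff_right scaleR_diff_left)
  moreover have "0 \<le> t / e" "t / e \<le> 1" using t e by auto
  ultimately have "p - t *\<^sub>R \<beta> \<in> C" using M_convex[OF C] pC both unfolding convex_alt by metis
  then have 2: "k (Mreg p) = C" using t(3) by simp
  have "x \<in> G" if x: "x \<in> C" for x
  proof -
    obtain s where "s > 0" "p + s *\<^sub>R (p - x) \<in> D C" using star_constant_open[OF C 1 2, of "p - x"] by blast
    then show ?thesis using face_extend[OF Gf(1) pG x] D_id[OF C] by simp
  qed
  then show False using Gf face_of_imp_subset by blast
qed

text \<open>A point of \<open>C\<close> lies in some earlier cone exactly if \<open>C\<close> is not
  the lowest cone there, that is, if \<open>\<beta>\<close> leads out of \<open>C\<close>. The depth
  \<open>j\<close> is arbitrary because \<open>visible_first\<close> holds at every depth.\<close>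

lemma shelling:
  assumes L: "linear_extension M P L"
  shows "shell j L"
proof (cases j)
  case (Suc j')
  have Ls: "distinct L" "set L = M" "\<And>i i'. i < length L \<Longrightarrow> i' < length L \<Longrightarrow> P (L ! i) (L ! i') \<Longrightarrow> i \<le> i'"
    using L unfolding linear_extension_def by auto
  have vf: "visible_first j' C \<beta>" if "C \<in> M" for C
    by (rule ex_visible_first) (use M_polyhedron M_cone zero_in_M span_M transversal_base that in auto)
  show ?thesis unfolding Suc shell.simps Let_def
  proof (intro conjI impI allI)
    assume "L \<noteq> []"
    then have "hd L \<in> M" using hd_in_set Ls(2) by blast
    from vf[OF this] show "\<exists>Gs. distinct Gs \<and> set Gs = cone_facets (hd L) \<and> shell j' Gs"
      unfolding visible_first_def by blast
  next
    fix i assume i: "0 < i \<and> i < length L"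
    define C where "C = L ! i"
    define U where "U = \<Union>(set (take i L))"
    have C: "C \<in> M" using i Ls(2) nth_mem unfolding C_def by blast
    have early: "C' \<in> M \<and> \<not> P C C'" if "C' \<in> set (take i L)" for C'
    proof -
      obtain i' where "i' < i" "C' = L ! i'" using \<open>C' \<in> set (take i L)\<close> i by (auto simp: in_set_conv_nth)
      then have "C' \<in> M" "\<not> P (L ! i) (L ! i')" using Ls(2) Ls(3)[of i i'] i nth_mem[of i' L] by auto
      then show ?thesis using \<open>C' = L ! i'\<close> by (simp add: C_def)
    qed
    have smaller: "C' \<in> set (take i L)" if "C' \<in> M" "P C' C" "C' \<noteq> C" for C'
    proof -
      obtain i' where i': "i' < length L" "C' = L ! i'" using \<open>C' \<in> M\<close> Ls(2) by (metis in_set_conv_nth)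
      then have "i' \<le> i" using Ls(3)[of i' i] i \<open>P C' C\<close> by (simp add: C_def)
      moreover have "i' \<noteq> i" using i'(2) \<open>C' \<noteq> C\<close> by (auto simp: C_def)
      ultimately show ?thesis using i' i by (auto simp: in_set_conv_nth intro!: exI[of _ i'])
    qed
    \<comment> \<open>Were \<open>C\<close> the lowest cone at \<open>p\<close>, it would be below
      the earlier \<open>C'\<close>.\<close>
    have notin: "k (mreg p) \<noteq> C" if "p \<in> C'" "C' \<in> set (take i L)" for p C'
      using early[OF that(2)] M_star[of C' p] that(1) by metis
    have cf: "cone_facets C = {G. G facet_of C}"
      by (rule cone_facets_eq) (simp add: aff_dim_M[OF C])
    have seesU: "G \<subseteq> U \<longleftrightarrow> sees C \<beta> G" if G: "G facet_of C" for G
    proof -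
      have GF: "G \<in> F" using G C unfolding F_def facet_of_def by blast
      have GC: "G \<subseteq> C" using G face_of_imp_subset unfolding facet_of_def by blast
      show ?thesis
      proof
        assume GU: "G \<subseteq> U"
        show "sees C \<beta> G" unfolding sees_def
        proof (rule ballI)
          fix p assume "p \<in> rel_interior G"
          then have pG: "p \<in> G" using rel_interior_subset by blast
          then obtain C' where "p \<in> C'" "C' \<in> set (take i L)" using GU unfolding U_def by blast
          then have "k (mreg p) \<noteq> C" by (rule notin)
          then show "\<forall>e>0. p + e *\<^sub>R \<beta> \<notin> C" using leaves_iff[OF C] pG GC by blast
        qed
      next
        assume S: "sees C \<beta> G"
        obtain p where p: "p \<in> rel_interior G" using F_rel_interior[OF GF] by blast
        then have pC: "p \<in> C" using rel_interior_subset GC by blast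
        have ne: "k (mreg p) \<noteq> C" using leaves_iff[OF C pC] S p unfolding sees_def by blast
        have kM: "k (mreg p) \<in> M" using mreg(1) by simp
        have "P (k (mreg p)) C" using M_star[OF C] pC by blast
        then have "k (mreg p) \<in> set (take i L)" using smaller[OF kM] ne by blast
        moreover have "p \<in> k (mreg p)" using region_subset[OF mreg(1)[of p]] mem_mreg(1)[of p] by blast
        then have "G \<subseteq> k (mreg p)" using star_rel_interior[OF GF p kM] by blast
        ultimately show "G \<subseteq> U" unfolding U_def by blast
      qed
    qed
    then have I: "{G \<in> cone_facets C. G \<subseteq> U} = {G \<in> cone_facets C. sees C \<beta> G}" unfolding cf by blast
    have "C \<inter> U \<subseteq> \<Union>{G \<in> cone_facets C. G \<subseteq> U}"
    proof
      fix p assume p: "p \<in> C \<inter> U"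
      then obtain C' where "p \<in> C'" "C' \<in> set (take i L)" unfolding U_def by blast
      then have "k (mreg p) \<noteq> C" by (rule notin)
      then have out: "p + e *\<^sub>R \<beta> \<notin> C" if "0 < e" for e using leaves_iff[OF C] p that by blast
      obtain K where K: "facet_normals C K"
        using ex_facet_normals[OF M_polyhedron[OF C] M_cone[OF C]] zero_in_M[OF C] by blast
      interpret pc: polyhedral_cone C K
        using M_polyhedron[OF C] M_cone[OF C] zero_in_M[OF C] K by unfold_locales auto
      have bs: "\<beta> \<in> span C" using span_M[OF C] by simp
      obtain a where a: "a \<in> K" "a \<bullet> p = 0" "0 < a \<bullet> \<beta>" using pc.seen_facet_at[OF _ bs out] p by blast
      have "pc.facet a facet_of C" "sees C \<beta> (pc.facet a)" "p \<in> pc.facet a"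
        using pc.facet_facet[OF a(1)] pc.sees_facet[OF a(1) bs] a p by (auto simp: pc.facet_def)
      then show "p \<in> \<Union>{G \<in> cone_facets C. G \<subseteq> U}" unfolding I unfolding cf by blast
    qed
    moreover have "\<Union>{G \<in> cone_facets C. G \<subseteq> U} \<subseteq> C \<inter> U"
      unfolding cf facet_of_def using face_of_imp_subset by blast
    ultimately have un: "C \<inter> U = \<Union>{G \<in> cone_facets C. G \<subseteq> U}" by blast
    \<comment> \<open>All cones contain the origin, so the first cone alone makes the intersection,
      and with it the set of shared facets, nonempty.\<close>
    have "L ! 0 \<in> set (take i L)" using i by (auto simp: in_set_conv_nth intro!: exI[of _ 0])
    then have "0 \<in> C \<inter> U" using zero_in_M[OF C] zero_in_M early unfolding U_def by blast
    then have ne: "{G \<in> cone_facets C. G \<subseteq> U} \<noteq> {}" unfolding un by blast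
    have "\<exists>Gs. distinct Gs \<and> set Gs = cone_facets C \<and> shell j' Gs \<and>
        set (take (card {G \<in> cone_facets C. G \<subseteq> U}) Gs) = {G \<in> cone_facets C. G \<subseteq> U}"
      using vf[OF C] unfolding I visible_first_def .
    with ne un show "{G \<in> cone_facets (L ! i). G \<subseteq> \<Union>(set (take i L))} \<noteq> {}"
      "L ! i \<inter> \<Union>(set (take i L)) = \<Union>{G \<in> cone_facets (L ! i). G \<subseteq> \<Union>(set (take i L))}"
      "\<exists>Gs. distinct Gs \<and> set Gs = cone_facets (L ! i) \<and> shell j' Gs \<and>
        set (take (card {G \<in> cone_facets (L ! i). G \<subseteq> \<Union>(set (take i L))}) Gs) =
          {G \<in> cone_facets (L ! i). G \<subseteq> \<Union>(set (take i L))}"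
      unfolding C_def U_def by simp_all
  qed
qed simp

end

section \<open>Simplicial arrangements\<close>

lemma independent_prescribed_values:
  fixes B :: "'a::euclidean_space set"
  assumes "independent B"
  shows "\<exists>x. \<forall>b\<in>B. b \<bullet> x = f b"
proof -
  obtain g :: "'a \<Rightarrow> real" where g: "linear g" "\<forall>b\<in>B. g b = f b"
    using linear_independent_extend[OF assms] by blast
  have "b \<bullet> adjoint g 1 = g b" for b
    using adjoint_works[OF g(1), of b 1] by (simp add: inner_commute)
  then show ?thesis using g(2) by (intro exI[of _ "adjoint g 1"]) simp
qed

lemma independent_uminus_image:
  fixes B :: "'a::euclidean_space set"
  assumes "independent (uminus ` B)"
  shows "independent B"
proof -
  have "linear (uminus :: 'a \<Rightarrow> 'a)" by (simp add: linear_uminus)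
  then have "independent (uminus ` (uminus ` B))"
    by (rule linear_independent_injective_image[OF _ assms]) (simp add: inj_on_def)
  then show ?thesis by (simp add: image_image)
qed

lemma aff_dim_hyperplane_piece:
  fixes G :: "'a::euclidean_space set"
  assumes n: "n \<noteq> 0" and G: "0 \<in> G" "G \<subseteq> {x. n \<bullet> x = 0}" "p \<in> G"
    and p: "\<And>w. n \<bullet> w = 0 \<Longrightarrow> \<exists>t>0. p + t *\<^sub>R w \<in> G"
  shows "aff_dim G = int DIM('a) - 1"
proof -
  have "{x. n \<bullet> x = 0} \<subseteq> span G"
  proof
    fix w assume "w \<in> {x. n \<bullet> x = 0}"
    then obtain t where t: "t > 0" "p + t *\<^sub>R w \<in> G" using p by blast
    have "(p + t *\<^sub>R w) - p \<in> span G" using t(2) G(3) by (intro span_diff) (auto simp: span_base)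
    then have "t *\<^sub>R w \<in> span G" by simp
    then have "(1 / t) *\<^sub>R (t *\<^sub>R w) \<in> span G" by (rule span_scale)
    then show "w \<in> span G" using t(1) by simp
  qed
  moreover have "span G \<subseteq> {x. n \<bullet> x = 0}" using G(2) by (rule span_minimal) (rule subspace_hyperplane)
  ultimately have "dim (span G) = dim {x. n \<bullet> x = 0}" by (metis subset_antisym)
  then have "dim G = DIM('a) - 1" using dim_hyperplane[OF n] by (simp add: dim_span)
  moreover have "aff_dim G = int (dim G)" using G(1) by (intro aff_dim_zero) (simp add: hull_inc)
  moreover have "DIM('a) \<ge> 1" by (simp add: Suc_leI)
  ultimately show ?thesis by simp
qed

section \<open>Facet normals of regions and of cones\<close>

context region_cones
begin

lemma zero_in_region: "R \<in> Regs \<Longrightarrow> 0 \<in> R"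
  using mem_region[of R 0] sg_N[of R] by (auto simp: neg_def zer_def)

lemma interior_region: "R \<in> Regs \<Longrightarrow> aff_dim R = int DIM('a)"
  using ex_generic[of R] generic_interior low_dim_interior by (metis empty_iff)

lemma wall_facet_normal:
  assumes R: "R \<in> Regs" and n: "n \<in> N" and q: "zer q = {n}" "q \<in> R"
    and \<nu>: "\<nu> = n \<or> \<nu> = - n" "R \<subseteq> {x. \<nu> \<bullet> x \<le> 0}"
  shows "\<nu> \<in> outward_facet_normals R"
proof -
  have v: "norm \<nu> = 1" "\<nu> \<noteq> 0" and hyp: "{x. \<nu> \<bullet> x = 0} = {x. n \<bullet> x = 0}"
    using \<nu>(1) unit[OF n] by auto
  let ?G = "R \<inter> {x. \<nu> \<bullet> x = 0}"
  have "?G face_of R"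
    by (rule face_of_Int_supporting_hyperplane_le[OF convex_region[OF R]]) (use \<nu>(2) in blast)
  moreover have "aff_dim ?G = int DIM('a) - 1"
  proof (rule aff_dim_hyperplane_piece[OF v(2), of _ q])
    show "0 \<in> ?G" using zero_in_region[OF R] by simp
    have "n \<in> zer q" using q(1) by simp
    then have "n \<bullet> q = 0" by (simp add: zer_def)
    then show "q \<in> ?G" using q(2) hyp by blast
    show "\<exists>t>0. q + t *\<^sub>R w \<in> ?G" if "\<nu> \<bullet> w = 0" for w
    proof -
      have nw: "n \<bullet> w = 0" using that hyp by blast
      obtain t where t: "t > 0" "neg (q + t *\<^sub>R w) = neg q \<union> (zer q \<inter> neg w)" "zer (q + t *\<^sub>R w) = zer q \<inter> zer w"
        using perturb[of q w] by blast
      have "n \<notin> neg w" "n \<in> zer w" using nw n by (auto simp: neg_def zer_def)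
      then have "neg (q + t *\<^sub>R w) = neg q" "zer (q + t *\<^sub>R w) = zer q" using t q(1) by auto
      then have "q + t *\<^sub>R w \<in> R" using mem_region[OF R, of q] mem_region[OF R, of "q + t *\<^sub>R w"] q(2) by simp
      moreover have "n \<bullet> (q + t *\<^sub>R w) = 0" using \<open>n \<bullet> q = 0\<close> nw by (simp add: inner_add_right)
      ultimately show ?thesis using t(1) hyp by blast
    qed
  qed simp
  ultimately have "?G \<in> cone_facets R" unfolding cone_facets_def using interior_region[OF R] by simp
  moreover have "?G \<subseteq> {x. \<nu> \<bullet> x = 0}" by blast
  ultimately show ?thesis unfolding outward_facet_normals_def
    using v(1) \<nu>(2) by (intro CollectI conjI bexI[of _ ?G])
qed

lemma uw_normal: "R \<in> Regs \<Longrightarrow> n \<in> uw R \<Longrightarrow> - n \<in> outward_facet_normals R"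
  and lw_normal: "R \<in> Regs \<Longrightarrow> n \<in> lw R \<Longrightarrow> n \<in> outward_facet_normals R"
proof -
  assume R: "R \<in> Regs"
  show "- n \<in> outward_facet_normals R" if n: "n \<in> uw R"
  proof -
    obtain q where q: "neg q = sg R" "zer q = {n}" "n \<in> N" using n by (auto simp: uw_def)
    have "0 \<le> n \<bullet> x" if "x \<in> R" for x using not_sg_points[OF R _ that, of n] q(3) uw_not_sg[OF n] by blast
    then show ?thesis
      by (intro wall_facet_normal[OF R q(3) q(2)]) (use mem_region[OF R, of q] q in auto)
  qed
  show "n \<in> outward_facet_normals R" if n: "n \<in> lw R"
  proof -
    obtain q where q: "zer q = {n}" "sg R = insert n (neg q)" "n \<in> N" using n by (auto simp: lw_def)
    have "n \<bullet> x \<le> 0" if "x \<in> R" for x using sg_reg_points[OF R lw_sg[OF n] that] .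
    then show ?thesis
      by (intro wall_facet_normal[OF R q(3) q(1)]) (use mem_region[OF R, of q] q in auto)
  qed
qed

lemma M_walls: "C \<in> M \<Longrightarrow> x \<in> C \<longleftrightarrow> (\<forall>n\<in>uw (tp C). 0 \<le> n \<bullet> x) \<and> (\<forall>n\<in>lw (bt C). n \<bullet> x \<le> 0)"
proof -
  assume C: "C \<in> M"
  have "x \<in> D C \<longleftrightarrow> (\<forall>n\<in>uw (tp C). 0 \<le> n \<bullet> x) \<and> (\<forall>n\<in>lw (bt C). n \<bullet> x \<le> 0)"
    unfolding D_walls[OF C] by simp
  then show ?thesis unfolding D_id[OF C] .
qed

lemma not_interior_wall:
  assumes C: "C \<in> M" and p: "p \<in> C" and out: "\<And>t. t > 0 \<Longrightarrow> p + t *\<^sub>R v \<notin> C"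
  shows "(\<exists>n\<in>uw (tp C). n \<bullet> p = 0 \<and> n \<bullet> v < 0) \<or> (\<exists>n\<in>lw (bt C). n \<bullet> p = 0 \<and> 0 < n \<bullet> v)"
proof (rule ccontr)
  assume neg: "\<not> ?thesis"
  let ?K = "uminus ` uw (tp C) \<union> lw (bt C)"
  have memC: "x \<in> C \<longleftrightarrow> (\<forall>a\<in>?K. a \<bullet> x \<le> 0)" for x
    unfolding M_walls[OF C] by (auto simp: ball_Un)
  have "finite ?K" using finN finite_subset[OF uw_N] finite_subset[OF lw_N] by blast
  moreover have "a \<bullet> p \<le> 0" if "a \<in> ?K" for a using memC[of p] p that by blast
  moreover have "a \<bullet> v \<le> 0" if "a \<in> ?K" "a \<bullet> p = 0" for a using neg that by force
  ultimately obtain e where "e > 0" "\<forall>t. 0 < t \<and> t \<le> e \<longrightarrow> (\<forall>a\<in>?K. a \<bullet> (p + t *\<^sub>R v) \<le> 0)"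
    using small_step[of ?K p v] by blast
  then have "p + e *\<^sub>R v \<in> C" using memC by blast
  then show False using out \<open>e > 0\<close> by blast
qed

text \<open>From a relative interior point of the facet, \<open>\<nu>\<close> leads out of
  \<open>C\<close> and so violates a wall inequality that is tight there. That wall vanishes on the
  whole facet, hence equals \<open>\<nu>\<close> up to sign, and a generic point of \<open>C\<close>
  decides the sign.\<close>

lemma facet_normal_cases:
  assumes C: "C \<in> M" and \<nu>: "\<nu> \<in> outward_facet_normals C"
  shows "- \<nu> \<in> uw (tp C) \<or> \<nu> \<in> lw (bt C)"
proof -
  obtain G where G: "norm \<nu> = 1" "G \<in> cone_facets C" "C \<subseteq> {x. \<nu> \<bullet> x \<le> 0}" "G \<subseteq> {x. \<nu> \<bullet> x = 0}"
    using \<nu> by (auto simp: outward_facet_normals_def)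
  have Gf: "G face_of C" "aff_dim G = int DIM('a) - 1" using G(2) aff_dim_M[OF C] by (auto simp: cone_facets_def)
  have "DIM('a) \<ge> 1" by (simp add: Suc_leI)
  then have "G \<noteq> {}" using Gf(2) by auto
  then have GF: "G \<in> F" using Gf(1) C unfolding F_def by blast
  have GC: "G \<subseteq> C" using Gf(1) face_of_imp_subset by blast
  have Gc: "convex G" using Gf(1) face_of_imp_convex by blast
  obtain p where p: "p \<in> rel_interior G" using F_rel_interior[OF GF] by blast
  then have pG: "p \<in> G" using rel_interior_subset by blast
  have pn: "\<nu> \<bullet> p = 0" using pG G(4) by blast
  have vv: "\<nu> \<bullet> \<nu> = 1" using G(1) by (simp add: dot_square_norm)
  have out: "p + t *\<^sub>R \<nu> \<notin> C" if "t > 0" for t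
  proof
    assume "p + t *\<^sub>R \<nu> \<in> C"
    then have "\<nu> \<bullet> (p + t *\<^sub>R \<nu>) \<le> 0" using G(3) by blast
    then show False using that pn vv by (simp add: inner_add_right)
  qed
  have hyp: "\<nu> = n \<or> \<nu> = - n" if n: "n \<in> N" "\<And>x. x \<in> G \<Longrightarrow> n \<bullet> x = 0" for n
  proof -
    have "span G \<subseteq> {x. n \<bullet> x = 0}" by (rule span_minimal) (use n(2) subspace_hyperplane in auto)
    moreover have "dim (span G) = dim {x. n \<bullet> x = 0}"
    proof -
      have "aff_dim G = int (dim G)" by (intro aff_dim_zero hull_inc zero_in_F[OF GF])
      then show ?thesis using Gf(2) dim_hyperplane[OF N_ne[OF n(1)]] \<open>DIM('a) \<ge> 1\<close> by (simp add: dim_span)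
    qed
    ultimately have "span G = {x. n \<bullet> x = 0}"
      using subspace_dim_equal[OF subspace_span subspace_hyperplane] by (metis order_refl)
    moreover have "span G \<subseteq> {x. \<nu> \<bullet> x = 0}" by (rule span_minimal[OF G(4) subspace_hyperplane])
    ultimately show ?thesis using unit_normals_eq[OF unit[OF n(1)] G(1)] by blast
  qed
  obtain z where z: "zer z = {}" "z \<in> C" using ex_generic_M[OF C] by metis
  from not_interior_wall[OF C subsetD[OF GC pG] out]
  consider n where "n \<in> uw (tp C)" "n \<bullet> p = 0" | n where "n \<in> lw (bt C)" "n \<bullet> p = 0" by blast
  then show ?thesis
  proof cases
    case 1
    have ge: "0 \<le> n \<bullet> x" if "x \<in> C" for x using that 1(1) M_walls[OF C] by blast
    have nN: "n \<in> N" using 1(1) uw_N by blast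
    have "n \<bullet> x = 0" if "x \<in> G" for x
      using rel_interior_supporting[OF Gc p, of "- n" x] ge GC 1(2) that by auto
    then have "\<nu> = n \<or> \<nu> = - n" using hyp nN by blast
    moreover have "n \<bullet> z \<noteq> 0" using z(1) nN by (auto simp: zer_def)
    then have "\<nu> \<noteq> n" using ge[OF z(2)] G(3) z(2) by force
    ultimately show ?thesis using 1(1) by auto
  next
    case 2
    have le: "n \<bullet> x \<le> 0" if "x \<in> C" for x using that 2(1) M_walls[OF C] by blast
    have nN: "n \<in> N" using 2(1) lw_N by blast
    have "n \<bullet> x = 0" if "x \<in> G" for x
      using rel_interior_supporting[OF Gc p, of n x] le GC 2(2) that by auto
    then have "\<nu> = n \<or> \<nu> = - n" using hyp nN by blast
    moreover have "n \<bullet> z \<noteq> 0" using z(1) nN by (auto simp: zer_def)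
    then have "\<nu> \<noteq> - n" using le[OF z(2)] G(3) z(2) by force
    ultimately show ?thesis using 2(1) by auto
  qed
qed

end

section \<open>Faces of simplicial top regions and joins of covers\<close>

locale simplicial_region_cones = region_cones +
  assumes simplicial: "R \<in> normals.Regs N \<Longrightarrow> independent (outward_facet_normals R)"
begin

lemma uw_independent: "R \<in> Regs \<Longrightarrow> independent (uw R)"
  and walls_independent: "R \<in> Regs \<Longrightarrow> independent (uminus ` uw R \<union> lw R)"
proof -
  assume R: "R \<in> Regs"
  have "uminus ` uw R \<union> lw R \<subseteq> outward_facet_normals R" using uw_normal[OF R] lw_normal[OF R] by blast
  then show w: "independent (uminus ` uw R \<union> lw R)" using independent_mono simplicial[OF R] by blast
  have "independent (uminus ` uw R)" using independent_mono[OF w] by blast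
  then show "independent (uw R)" by (rule independent_uminus_image)
qed

text \<open>\<open>p\<close> is chosen in the relative interior of the face cut out by the walls in \<open>S\<close>; by the last
  property, the highest region containing \<open>p\<close> is the join of the covers of \<open>R\<close> across these walls.\<close>
lemma ex_face_point:
  assumes R: "R \<in> Regs" and S: "S \<subseteq> uw R"
  shows "\<exists>p. neg p = sg R \<and> zer p \<inter> uw R = S \<and> (\<forall>U\<in>Regs. sg R \<union> S \<subseteq> sg U \<longrightarrow> zer p \<subseteq> sg U)"
proof -
  \<comment> \<open>Any values can be prescribed on the independent outward normals:
    \<open>0\<close> makes the walls in \<open>S\<close> tight, \<open>- 1\<close> puts
    \<open>p\<close> strictly inside all the others.\<close>
  obtain p where p: "\<forall>b\<in>uminus ` uw R \<union> lw R. b \<bullet> p = (if b \<in> uminus ` S then 0 else - 1)"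
    using independent_prescribed_values[OF walls_independent[OF R], of "\<lambda>b. if b \<in> uminus ` S then 0 else - 1"] by blast
  have pu: "n \<bullet> p = (if n \<in> S then 0 else 1)" if "n \<in> uw R" for n
  proof -
    have "- n \<bullet> p = (if - n \<in> uminus ` S then 0 else - 1)" using p that by blast
    moreover have "- n \<in> uminus ` S \<longleftrightarrow> n \<in> S" by (metis image_iff minus_minus)
    ultimately show ?thesis by (auto split: if_splits)
  qed
  have pl: "n \<bullet> p = - 1" if "n \<in> lw R" for n
  proof -
    have "n \<notin> uminus ` S" using that S uw_N lw_N N_minus by force
    moreover have "n \<bullet> p = (if n \<in> uminus ` S then 0 else - 1)" using p that by blast
    ultimately show ?thesis by simp
  qed
  obtain r where r: "zer r = {}" "neg r = sg R" using ex_generic[OF R] by metis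
  have rs: "n \<bullet> r \<noteq> 0" "n \<bullet> r < 0 \<longleftrightarrow> n \<in> sg R" if "n \<in> N" for n
  proof -
    show "n \<bullet> r \<noteq> 0" using r(1) that unfolding zer_def by blast
    show "n \<bullet> r < 0 \<longleftrightarrow> n \<in> sg R" unfolding r(2)[symmetric] neg_def using that by simp
  qed
  have wall: "m \<in> sg R \<Longrightarrow> m \<in> lw R" "m \<notin> sg R \<Longrightarrow> m \<in> uw R"
    if "m \<in> N" "\<exists>q. zer q = {m} \<and> neg q - {m} = sg R - {m}" for m
    using wall_cases that by blast+
  \<comment> \<open>Were \<open>p\<close> outside \<open>R\<close>, a wall of \<open>R\<close> would
    separate it from \<open>r\<close>, but \<open>p\<close> is on the right side of all
    walls.\<close>
  have side: "0 \<le> (n \<bullet> r) * (n \<bullet> p)" if n: "n \<in> N" for n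
  proof (rule ccontr)
    assume "\<not> 0 \<le> (n \<bullet> r) * (n \<bullet> p)"
    then have n': "0 < (n \<bullet> r) * - (n \<bullet> p)" by simp
    have z0: "zer 0 = N" "neg 0 = {}" by (auto simp: zer_def neg_def)
    have "\<exists>m\<in>zer 0. 0 < (m \<bullet> r) * - (m \<bullet> p) \<and> (\<exists>q. zer q = {m} \<and> neg q - {m} = sg R - {m})"
      by (rule local_wall[OF r]) (use z0 n n' sg_N in auto)
    then obtain m where m: "m \<in> N" "0 < (m \<bullet> r) * - (m \<bullet> p)" "\<exists>q. zer q = {m} \<and> neg q - {m} = sg R - {m}"
      using z0 by blast
    show False
    proof (cases "m \<in> sg R")
      case True
      then have "m \<bullet> p = - 1" "m \<bullet> r < 0" using wall(1)[OF m(1,3)] pl rs(2)[OF m(1)] by auto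
      then show False using m(2) by simp
    next
      case False
      then have "0 \<le> m \<bullet> p" "0 < m \<bullet> r"
        using wall(2)[OF m(1,3)] pu[of m] rs[OF m(1)] by (auto split: if_splits)
      then have "0 \<le> (m \<bullet> r) * (m \<bullet> p)" by simp
      then show False using m(2) by simp
    qed
  qed
  have np: "neg p \<subseteq> sg R"
  proof
    fix n assume n: "n \<in> neg p"
    then have nN: "n \<in> N" "n \<bullet> p < 0" by (auto simp: neg_def)
    then have "n \<bullet> r \<le> 0" using side[OF nN(1)] by (simp add: zero_le_mult_iff)
    then show "n \<in> sg R" using rs[OF nN(1)] by force
  qed
  have sp: "sg R \<subseteq> neg p \<union> zer p"
  proof
    fix n assume n: "n \<in> sg R"
    then have nN: "n \<in> N" using sg_N by blast
    then have "n \<bullet> r < 0" using rs(2) n by blast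
    then have "n \<bullet> p \<le> 0" using side[OF nN] by (simp add: zero_le_mult_iff)
    then show "n \<in> neg p \<union> zer p" using nN by (auto simp: neg_def zer_def)
  qed
  have disj: "zer p \<inter> sg R = {}"
  proof (rule ccontr)
    assume "zer p \<inter> sg R \<noteq> {}"
    then obtain n where n: "n \<in> zer p" "n \<in> sg R" by blast
    then have nN: "n \<in> N" using sg_N by blast
    \<comment> \<open>A tight normal in \<open>sg R\<close> separates \<open>r\<close> from
      \<open>\<beta>\<close>, so \<open>local_wall\<close> finds a tight lower wall; but lower walls
      have the value \<open>- 1\<close> at \<open>p\<close>.\<close>
    have "0 < (n \<bullet> r) * - (n \<bullet> \<beta>)" using rs(2)[OF nN] n(2) pos[OF nN] by (simp add: mult_neg_pos)
    then obtain m where m: "m \<in> zer p" "0 < (m \<bullet> r) * - (m \<bullet> \<beta>)" "\<exists>q. zer q = {m} \<and> neg q - {m} = sg R - {m}"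
      using local_wall[OF r np sp n(1)] by blast
    have mN: "m \<in> N" "m \<bullet> p = 0" using m(1) by (auto simp: zer_def)
    have "m \<bullet> r < 0" using m(2) pos[OF mN(1)] by (auto simp: zero_less_mult_iff mult_less_0_iff)
    then have "m \<in> lw R" using wall(1)[OF mN(1) m(3)] rs(2)[OF mN(1)] by blast
    then show False using pl mN(2) by force
  qed
  have "neg p = sg R" using np sp disj by blast
  moreover have "zer p \<inter> uw R = S"
    using pu S uw_N by (force simp: zer_def split: if_splits)
  moreover have "zer p \<subseteq> sg U" if U: "U \<in> Regs" "sg R \<union> S \<subseteq> sg U" for U
  proof (rule ccontr)
    assume "\<not> zer p \<subseteq> sg U"
    then obtain n where n: "n \<in> zer p" "n \<notin> sg U" by blast
    then have nN: "n \<in> N" by (auto simp: zer_def)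
    obtain u where u: "zer u = {}" "neg u = sg U" using ex_generic[OF U(1)] by metis
    have us: "m \<bullet> u \<noteq> 0" "m \<bullet> u < 0 \<longleftrightarrow> m \<in> sg U" if "m \<in> N" for m
    proof -
      show "m \<bullet> u \<noteq> 0" using u(1) that unfolding zer_def by blast
      show "m \<bullet> u < 0 \<longleftrightarrow> m \<in> sg U" unfolding u(2)[symmetric] neg_def using that by simp
    qed
    \<comment> \<open>The target for \<open>local_wall\<close> is \<open>- u\<close>: it yields a
      tight wall with \<open>r\<close> and \<open>u\<close> on the same side. This wall is upper,
      hence in \<open>S\<close>, whereas \<open>U\<close> is beyond all walls in
      \<open>S\<close>.\<close>
    have "0 < n \<bullet> r" using rs[OF nN] n(1) disj by force
    moreover have "0 < n \<bullet> u" using us[OF nN] n(2) by force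
    ultimately have "0 < (n \<bullet> r) * - (n \<bullet> - u)" by simp
    then obtain m where m: "m \<in> zer p" "0 < (m \<bullet> r) * - (m \<bullet> - u)" "\<exists>q. zer q = {m} \<and> neg q - {m} = sg R - {m}"
      using local_wall[OF r np sp n(1)] by blast
    have mN: "m \<in> N" "m \<notin> sg R" using m(1) disj by (auto simp: zer_def)
    have "m \<in> S" using wall(2)[OF mN(1) m(3) mN(2)] m(1) \<open>zer p \<inter> uw R = S\<close> by blast
    then have "m \<bullet> u < 0" using U(2) us(2)[OF mN(1)] by blast
    moreover have "0 < m \<bullet> r" using rs[OF mN(1)] mN(2) by force
    ultimately have "(m \<bullet> r) * (m \<bullet> u) < 0" by (simp add: mult_pos_neg)
    then show False using m(2) by simp
  qed
  ultimately show ?thesis by blast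
qed

definition "face_point R S = (SOME p. neg p = sg R \<and> zer p \<inter> uw R = S \<and>
   (\<forall>U\<in>Regs. sg R \<union> S \<subseteq> sg U \<longrightarrow> zer p \<subseteq> sg U))"

text \<open>The join of \<open>C\<close> and its upper covers across the walls in \<open>S\<close>,
  by \<open>J_le_iff\<close>.\<close>

definition "J C S = k (Mreg (face_point (tp C) S))"

lemma face_point:
  assumes "R \<in> Regs" "S \<subseteq> uw R"
  shows "neg (face_point R S) = sg R" "zer (face_point R S) \<inter> uw R = S"
    "\<And>U. U \<in> Regs \<Longrightarrow> sg R \<subseteq> sg U \<Longrightarrow> S \<subseteq> sg U \<Longrightarrow> zer (face_point R S) \<subseteq> sg U"
    "mreg (face_point R S) = R"
proof -
  have *: "neg (face_point R S) = sg R \<and> zer (face_point R S) \<inter> uw R = S \<and>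
   (\<forall>U\<in>Regs. sg R \<union> S \<subseteq> sg U \<longrightarrow> zer (face_point R S) \<subseteq> sg U)"
    unfolding face_point_def by (rule someI_ex[OF ex_face_point[OF assms]])
  then show 1: "neg (face_point R S) = sg R" and "zer (face_point R S) \<inter> uw R = S"
    and "\<And>U. U \<in> Regs \<Longrightarrow> sg R \<subseteq> sg U \<Longrightarrow> S \<subseteq> sg U \<Longrightarrow> zer (face_point R S) \<subseteq> sg U" by blast+
  show "mreg (face_point R S) = R" using sg_inj[OF mreg(1) assms(1)] mreg(2) 1 by simp
qed

abbreviation "atom C n \<equiv> k (up (tp C) n)"

lemma J_in_M: "J C S \<in> M"
  unfolding J_def using mreg(3) by simp

text \<open>Comparing with \<open>v\<close> means comparing regions with \<open>tp v\<close>, and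
  all normals tight at the face point are in \<open>sg (tp v)\<close> as soon as
  \<open>sg (tp C)\<close> and the walls in \<open>S\<close> are.\<close>

lemma J_le_iff:
  assumes C: "C \<in> M" and S: "S \<subseteq> uw (tp C)" and v: "v \<in> M"
  shows "P (J C S) v \<longleftrightarrow> P C v \<and> (\<forall>n\<in>S. P (atom C n) v)"
proof -
  have t: "tp C \<in> Regs" "tp v \<in> Regs" using tp C v by auto
  note fp = face_point[OF t(1) S]
  let ?Q = "Mreg (face_point (tp C) S)"
  have Q: "?Q \<in> Regs" "sg ?Q = sg (tp C) \<union> zer (face_point (tp C) S)" using mreg fp(1) by auto
  have "P (J C S) v \<longleftrightarrow> sg ?Q \<subseteq> sg (tp v)"
    unfolding J_def using tp(3)[OF v Q(1)] le_iff[OF Q(1) t(2)] by simp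
  also have "\<dots> \<longleftrightarrow> sg (tp C) \<subseteq> sg (tp v) \<and> (\<forall>n\<in>S. sg (up (tp C) n) \<subseteq> sg (tp v))"
  proof -
    have "(\<forall>n\<in>S. sg (up (tp C) n) \<subseteq> sg (tp v)) \<longleftrightarrow> (\<forall>n\<in>S. n \<in> sg (tp v) \<and> sg (tp C) \<subseteq> sg (tp v))"
    proof (intro ball_cong refl)
      fix n assume "n \<in> S"
      then have "sg (up (tp C) n) = insert n (sg (tp C))" using up(2) S by blast
      then show "sg (up (tp C) n) \<subseteq> sg (tp v) \<longleftrightarrow> n \<in> sg (tp v) \<and> sg (tp C) \<subseteq> sg (tp v)" by simp
    qed
    moreover have "S \<subseteq> zer (face_point (tp C) S)" using fp(2) by blast
    ultimately show ?thesis unfolding Q(2) using fp(3)[OF t(2)] by blast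
  qed
  also have "\<dots> \<longleftrightarrow> P C v \<and> (\<forall>n\<in>S. P (atom C n) v)"
  proof -
    have "sg (up (tp C) n) \<subseteq> sg (tp v) \<longleftrightarrow> P (atom C n) v" if "n \<in> S" for n
    proof -
      have n: "n \<in> uw (tp C)" using that S by blast
      show ?thesis using tp(3)[OF v up(1)[OF n]] le_iff[OF up(1)[OF n] t(2)] by simp
    qed
    moreover have "sg (tp C) \<subseteq> sg (tp v) \<longleftrightarrow> P C v" using P_tp[OF C v] le_iff[OF t] by simp
    ultimately show ?thesis by blast
  qed
  finally show ?thesis .
qed

lemma C_le_J: "\<lbrakk>C \<in> M; S \<subseteq> uw (tp C)\<rbrakk> \<Longrightarrow> P C (J C S)"
  and atom_le_J: "\<lbrakk>C \<in> M; S \<subseteq> uw (tp C); n \<in> S\<rbrakk> \<Longrightarrow> P (atom C n) (J C S)"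
  using J_le_iff J_in_M P_refl by blast+

text \<open>For \<open>n\<close> outside \<open>S\<close> the region representing the join has
  \<open>n\<close> nonnegative, so its meet with \<open>up (tp C) n\<close> falls below
  \<open>tp C\<close>. But if the cover is below the join, this meet represents the cover.\<close>

lemma atom_le_J_imp:
  assumes C: "C \<in> M" and S: "S \<subseteq> uw (tp C)" and n: "n \<in> uw (tp C)" and le: "P (atom C n) (J C S)"
  shows "n \<in> S"
proof (rule ccontr)
  assume nS: "n \<notin> S"
  have t: "tp C \<in> Regs" using tp C by auto
  note fp = face_point[OF t S]
  let ?Q = "Mreg (face_point (tp C) S)" and ?U = "up (tp C) n"
  have Q: "?Q \<in> Regs" "sg ?Q = sg (tp C) \<union> zer (face_point (tp C) S)" using mreg fp(1) by auto
  have U: "?U \<in> Regs" "sg ?U = insert n (sg (tp C))" using up[OF n] by auto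
  have m: "mt ?Q ?U \<in> Regs" using Q(1) U(1) by simp
  have km: "k (mt ?Q ?U) = k ?U" using le P_mt[OF U(1) Q(1)] unfolding J_def by blast
  have nQ: "n \<notin> sg ?Q" using nS fp(2) n uw_not_sg[OF n] unfolding Q(2) by blast
  have "sg (mt ?Q ?U) \<subseteq> sg ?Q \<inter> sg ?U"
    using mt_lb1[OF Q(1) U(1)] mt_lb2[OF Q(1) U(1)] le_iff[OF m Q(1)] le_iff[OF m U(1)] by blast
  then have "sg (mt ?Q ?U) \<subseteq> sg (tp C)" using nQ unfolding U(2) by blast
  then have "P (k (mt ?Q ?U)) C" using tp(3)[OF C m] le_iff[OF m t] by blast
  then have "P (k ?U) C" using km by simp
  then show False using upper_neighbour(1-3)[OF C n] P_antisym[OF C] by blast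
qed

lemma atom_inj: "C \<in> M \<Longrightarrow> inj_on (atom C) (uw (tp C))"
proof (rule inj_onI)
  fix n m assume C: "C \<in> M" and nm: "n \<in> uw (tp C)" "m \<in> uw (tp C)" "atom C n = atom C m"
  have "P (atom C n) (J C {m})" using atom_le_J[OF C, of "{m}" m] nm by simp
  then show "n = m" using atom_le_J_imp[OF C _ nm(1), of "{m}"] nm(2) by blast
qed

lemma star_face_point:
  assumes C: "C \<in> M" and S: "S \<subseteq> uw (tp C)"
  shows "{D \<in> M. face_point (tp C) S \<in> D} = interval M P C (J C S)"
  unfolding star_interval J_def using face_point(4)[OF tp(1)[OF C] S] tp(2)[OF C] by simp

text \<open>The face of \<open>C\<close> with the face point in its relative interior has the same
  star as that point.\<close>

lemma J_facial:
  assumes C: "C \<in> M" and S: "S \<subseteq> uw (tp C)"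
  shows "\<exists>G\<in>F. {D \<in> M. G \<subseteq> D} = interval M P C (J C S)"
proof -
  let ?p = "face_point (tp C) S"
  have "C \<in> interval M P C (J C S)" unfolding interval_def using C P_refl C_le_J S by blast
  then have "?p \<in> C" using star_face_point[OF C S] by blast
  then obtain G where G: "G face_of C" "?p \<in> rel_interior G"
    using ex_face_rel_interior[OF M_polyhedron[OF C]] by blast
  have "G \<noteq> {}" using G(2) rel_interior_subset by blast
  then have "G \<in> F" using G(1) C unfolding F_def by blast
  moreover have "{D \<in> M. G \<subseteq> D} = {D \<in> M. ?p \<in> D}" using star_rel_interior[OF \<open>G \<in> F\<close> G(2)] by blast
  ultimately show ?thesis using star_face_point[OF C S] by blast
qed

text \<open>No lower wall of the lowest cone is tight at \<open>p\<close>: a step towards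
  \<open>\<beta>\<close> stays in that cone, yet increases every normal. So only upper walls can
  block a direction.\<close>

lemma step_in_min:
  assumes p: "p \<in> k (mreg p)"
    and v: "\<And>n. n \<in> uw (tp (k (mreg p))) \<Longrightarrow> n \<bullet> p = 0 \<Longrightarrow> 0 \<le> n \<bullet> v"
  shows "\<exists>t>0. p + t *\<^sub>R v \<in> k (mreg p)"
proof (rule ccontr)
  let ?C = "k (mreg p)"
  have C: "?C \<in> M" using mreg(1) by simp
  assume "\<not> ?thesis"
  then have "\<And>t. t > 0 \<Longrightarrow> p + t *\<^sub>R v \<notin> ?C" by blast
  then obtain n where n: "n \<in> lw (bt ?C)" "n \<bullet> p = 0"
    using not_interior_wall[OF C p] v by (meson not_less)
  obtain t where t: "t > 0" "p + t *\<^sub>R \<beta> \<in> ?C" using leaves_iff[OF C p] by blast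
  have "n \<bullet> (p + t *\<^sub>R \<beta>) \<le> 0" using M_walls[OF C] t(2) n(1) by blast
  then have "t * (n \<bullet> \<beta>) \<le> 0" using n(2) by (simp add: inner_add_right)
  moreover have "0 < n \<bullet> \<beta>" using pos lw_N n(1) by blast
  ultimately show False using t(1) by (simp add: mult_le_0_iff)
qed

text \<open>Let \<open>S\<close> be the upper walls tight at a relative interior point
  \<open>p\<close> of \<open>G\<close>. In the lowest cone \<open>C\<close> at \<open>p\<close>,
  this point and the face point of \<open>S\<close> allow the same directions, so each lies in every
  face of \<open>C\<close> that contains the other, and their stars agree. Since
  \<open>span G\<close> is cut out by the independent set \<open>S\<close>, its codimension is
  \<open>card S\<close>.\<close>

lemma facial_form:
  assumes G: "G \<in> F"
  shows "\<exists>C\<in>M. \<exists>S\<subseteq>uw (tp C). {D \<in> M. G \<subseteq> D} = interval M P C (J C S) \<and>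
    aff_dim G = int DIM('a) - int (card S)"
proof -
  obtain p where p: "p \<in> rel_interior G" using F_rel_interior[OF G] by blast
  then have pG: "p \<in> G" using rel_interior_subset by blast
  have Gc: "convex G" using F_E[OF G] by metis
  define C where "C = k (mreg p)"
  have C: "C \<in> M" using mreg(1) by (simp add: C_def)
  have pC: "p \<in> C" using region_subset[OF mreg(1)[of p]] mem_mreg(1)[of p] by (auto simp: C_def)
  define S where "S = {n \<in> uw (tp C). n \<bullet> p = 0}"
  have S: "S \<subseteq> uw (tp C)" by (auto simp: S_def)
  have t: "tp C \<in> Regs" "k (tp C) = C" using tp C by auto
  note fp = face_point[OF t(1) S]
  let ?q = "face_point (tp C) S"
  have kq: "k (mreg ?q) = C" using fp(4) t(2) by simp
  have qC: "?q \<in> C" using region_subset[OF mreg(1)[of ?q]] mem_mreg(1)[of ?q] kq by auto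
  have Sq: "n \<in> S" if "n \<in> uw (tp C)" "n \<bullet> ?q = 0" for n
    using fp(2) that uw_N by (auto simp: zer_def)
  have q0: "n \<bullet> ?q = 0" if "n \<in> S" for n using fp(2) that by (auto simp: zer_def)
  have p0: "n \<bullet> p = 0" if "n \<in> S" for n using that by (simp add: S_def)
  have stepp: "\<exists>t>0. p + t *\<^sub>R v \<in> C" if "\<And>n. n \<in> S \<Longrightarrow> 0 \<le> n \<bullet> v" for v
    using step_in_min[of p v] pC that by (auto simp: C_def S_def)
  have stepq: "\<exists>t>0. ?q + t *\<^sub>R v \<in> C" if "\<And>n. n \<in> S \<Longrightarrow> 0 \<le> n \<bullet> v" for v
    using step_in_min[of ?q v] qC that Sq by (simp add: kq)
  have trans_mem: "y \<in> D" if "D \<in> M" "x \<in> C" "y \<in> C" "x \<in> D" "t > 0" "x + t *\<^sub>R (x - y) \<in> C" for D x y t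
    using face_extend[OF M_face_Int[OF C that(1)], of x y t] that by blast
  have "p \<in> D \<longleftrightarrow> ?q \<in> D" if D: "D \<in> M" for D
  proof
    obtain t where "t > 0" "p + t *\<^sub>R (p - ?q) \<in> C"
      using stepp[of "p - ?q"] p0 q0 by (auto simp: inner_diff_right)
    then show "p \<in> D \<Longrightarrow> ?q \<in> D" using trans_mem[OF D pC qC] by blast
    obtain t where "t > 0" "?q + t *\<^sub>R (?q - p) \<in> C"
      using stepq[of "?q - p"] p0 q0 by (auto simp: inner_diff_right)
    then show "?q \<in> D \<Longrightarrow> p \<in> D" using trans_mem[OF D qC pC] by blast
  qed
  then have "{D \<in> M. G \<subseteq> D} = {D \<in> M. ?q \<in> D}" using star_rel_interior[OF G p] by blast
  then have star: "{D \<in> M. G \<subseteq> D} = interval M P C (J C S)" using star_face_point[OF C S] by simp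
  have GC: "G \<subseteq> C" using star_rel_interior[OF G p C] pC by blast
  have Gface: "G face_of C"
    using F_Int[OF M_F[OF C] G] GC by (simp add: Int_absorb1)
  have "span G = {v. \<forall>n\<in>S. n \<bullet> v = 0}"
  proof
    have "G \<subseteq> {v. \<forall>n\<in>S. n \<bullet> v = 0}"
    proof (intro subsetI CollectI ballI)
      fix x n assume x: "x \<in> G" and n: "n \<in> S"
      have "0 \<le> n \<bullet> y" if "y \<in> G" for y using M_walls[OF C, of y] n S GC that by blast
      then have "- n \<bullet> x = 0"
        using rel_interior_supporting[OF Gc p, of "- n" x] p0[OF n] x by simp
      then show "n \<bullet> x = 0" by simp
    qed
    moreover have "subspace {v. \<forall>n\<in>S. n \<bullet> v = 0}"
      by (auto simp: subspace_def inner_add_right)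
    ultimately show "span G \<subseteq> {v. \<forall>n\<in>S. n \<bullet> v = 0}" by (rule span_minimal)
    show "{v. \<forall>n\<in>S. n \<bullet> v = 0} \<subseteq> span G"
    proof
      fix v assume "v \<in> {v. \<forall>n\<in>S. n \<bullet> v = 0}"
      then have v: "n \<bullet> v = 0" if "n \<in> S" for n using that by blast
      obtain t where t: "t > 0" "p + t *\<^sub>R v \<in> C" using stepp[of v] v by auto
      have "\<exists>s>0. p + s *\<^sub>R (- (t *\<^sub>R v)) \<in> C" by (rule stepp) (simp add: v)
      then obtain s where s: "s > 0" "p + s *\<^sub>R (p - (p + t *\<^sub>R v)) \<in> C" by auto
      have "p + t *\<^sub>R v \<in> G" using face_extend[OF Gface pG t(2) s] .
      then have "(p + t *\<^sub>R v) - p \<in> span G" using pG by (intro span_diff) (auto simp: span_base)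
      then have "t *\<^sub>R v \<in> span G" by simp
      then have "(1 / t) *\<^sub>R (t *\<^sub>R v) \<in> span G" by (rule span_scale)
      then show "v \<in> span G" using t(1) by simp
    qed
  qed
  also have "{v. \<forall>n\<in>S. n \<bullet> v = 0} = {v \<in> UNIV. \<forall>n\<in>span S. orthogonal n v}"
  proof -
    have "(\<forall>n\<in>S. n \<bullet> v = 0) \<longleftrightarrow> (\<forall>n\<in>span S. orthogonal n v)" for v
      using span_minimal[of S "{n. n \<bullet> v = 0}"] span_superset[of S]
      by (auto simp: orthogonal_def subspace_def inner_add_left)
    then show ?thesis by simp
  qed
  finally have "dim (span G) + dim (span S) = dim (UNIV :: 'a set)"
    using dim_subspace_orthogonal_to_vectors[OF subspace_span subspace_UNIV, of S] by simp
  moreover have "independent S" using independent_mono[OF uw_independent[OF t(1)] S] .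
  then have "dim (span S) = card S" by (simp add: dim_span dim_eq_card_independent)
  moreover have "aff_dim G = int (dim G)" by (intro aff_dim_zero hull_inc zero_in_F[OF G])
  ultimately have "aff_dim G = int DIM('a) - int (card S)" by (simp add: dim_span)
  then show ?thesis using star C S by blast
qed

section \<open>Facial and atomic intervals and their homotopy types\<close>

lemma interval_endpoints:
  assumes "x \<in> M" "y \<in> M" "P x y" "x' \<in> M" "y' \<in> M" "P x' y'" "interval M P x y = interval M P x' y'"
  shows "x = x'" "y = y'"
proof -
  have 1: "x \<in> interval M P x y" "y \<in> interval M P x y" "x' \<in> interval M P x' y'" "y' \<in> interval M P x' y'"
    unfolding interval_def using assms(1-6) P_refl by simp_all
  have "P x' x" "P y y'" using 1(1,2)[unfolded assms(7)] by (simp_all add: interval_def)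
  moreover have "P x x'" "P y' y" using 1(3,4)[folded assms(7)] by (simp_all add: interval_def)
  ultimately show "x = x'" "y = y'" using P_antisym assms(1,2,4,5) by simp_all
qed

definition "T x y = {n \<in> uw (tp x). P (atom x n) y}"

lemma T_uw: "T x y \<subseteq> uw (tp x)"
  by (auto simp: T_def)

lemma T_J: "x \<in> M \<Longrightarrow> S \<subseteq> uw (tp x) \<Longrightarrow> T x (J x S) = S"
  unfolding T_def using atom_le_J_imp atom_le_J by blast

lemma J_T_le: "\<lbrakk>x \<in> M; y \<in> M; P x y\<rbrakk> \<Longrightarrow> P (J x (T x y)) y"
  using J_le_iff[OF _ T_uw] by (auto simp: T_def)

lemma atoms_eq: "x \<in> M \<Longrightarrow> {a. covers M P x a \<and> P a y} = atom x ` T x y"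
  using covers_iff by (auto simp: T_def)

lemma facial_interval_iff:
  assumes x: "x \<in> M" "y \<in> M" "P x y"
  shows "facial_interval F P x y \<longleftrightarrow> J x (T x y) = y"
proof
  assume "facial_interval F P x y"
  then obtain G where G: "G \<in> F" "{D \<in> M. G \<subseteq> D} = interval M P x y"
    unfolding facial_interval_def max_cones_F by blast
  obtain C S where C: "C \<in> M" "S \<subseteq> uw (tp C)" "{D \<in> M. G \<subseteq> D} = interval M P C (J C S)"
    using facial_form[OF G(1)] by blast
  have "interval M P x y = interval M P C (J C S)" using G(2) C(3) by simp
  then have "x = C" "y = J C S"
    using interval_endpoints[OF x C(1) J_in_M C_le_J[OF C(1,2)]] by blast+
  then show "J x (T x y) = y" using T_J[OF C(1,2)] by simp
next
  assume "J x (T x y) = y"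
  then show "facial_interval F P x y"
    using J_facial[OF x(1) T_uw, of y] x unfolding facial_interval_def max_cones_F by simp
qed

text \<open>\<open>J x (T x y)\<close> is the join of the atoms of the interval, so the criterion is
  the one for facial intervals.\<close>

lemma atomic_interval_iff:
  assumes x: "x \<in> M" "y \<in> M" "P x y"
  shows "atomic_interval M P x y \<longleftrightarrow> J x (T x y) = y"
proof -
  let ?J = "J x (T x y)"
  have A: "{z \<in> interval M P x y. covers M P x z} = atom x ` T x y"
    unfolding atoms_eq[OF x(1), symmetric] by (auto simp: interval_def covers_def)
  have J: "?J \<in> interval M P x y"
    unfolding interval_def using J_in_M C_le_J[OF x(1) T_uw] J_T_le[OF x] by blast
  have y: "y \<in> interval M P x y" unfolding interval_def using x P_refl by blast
  have ub: "(\<forall>a\<in>atom x ` T x y. P a v) \<longleftrightarrow> P ?J v" if "v \<in> interval M P x y" for v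
    using J_le_iff[OF x(1) T_uw, of v y] that by (auto simp: interval_def)
  have "is_lub (interval M P x y) P (atom x ` T x y) y \<longleftrightarrow> ?J = y"
  proof
    assume "is_lub (interval M P x y) P (atom x ` T x y) y"
    then have "P y ?J" using ub[OF J] J P_refl[OF J_in_M] unfolding is_lub_def by blast
    then show "?J = y" using P_antisym J_in_M x J_T_le[OF x] by blast
  next
    assume "?J = y"
    then show "is_lub (interval M P x y) P (atom x ` T x y) y"
      unfolding is_lub_def using ub y P_refl[OF x(2)] by auto
  qed
  then show ?thesis unfolding atomic_interval_def A using x by blast
qed

lemma atomic_facial_F: "atomic_facial F P"
  unfolding atomic_facial_def max_cones_F
  by (intro ballI impI) (simp add: facial_interval_iff atomic_interval_iff)

text \<open>\<open>J\<close> takes sets of walls, the abstract locale sets of elements; by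
  \<open>atom_inj\<close> passing from atoms back to their walls loses nothing.\<close>

lemma atomic_joins:
  assumes x: "x \<in> M"
  shows "atomic_joins M P x (atom x ` T x y) (\<lambda>A. J x {n \<in> T x y. atom x n \<in> A})"
proof
  show "finite M" by (rule finite_M)
  show "poset_on M P" by (rule poset_M)
  show "x \<in> M" by (rule x)
  show "J x {n \<in> T x y. atom x n \<in> A} \<in> M" if "A \<subseteq> atom x ` T x y" for A by (rule J_in_M)
  show "P (J x {n \<in> T x y. atom x n \<in> A}) v \<longleftrightarrow> P x v \<and> (\<forall>a\<in>A. P a v)"
    if "A \<subseteq> atom x ` T x y" "v \<in> M" for A v
  proof -
    have "{n \<in> T x y. atom x n \<in> A} \<subseteq> uw (tp x)" using T_uw by blast
    moreover have "(\<forall>n\<in>{n \<in> T x y. atom x n \<in> A}. P (atom x n) v) \<longleftrightarrow> (\<forall>a\<in>A. P a v)" using that(1) by blast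
    ultimately show ?thesis using J_le_iff[OF x _ that(2)] by simp
  qed
  show "covers M P x a" if "a \<in> atom x ` T x y" for a using that covers_iff[OF x] T_uw by blast
qed

lemma homotopy_facial_F: "homotopy_facial F P"
  unfolding homotopy_facial_def max_cones_F
proof (intro ballI impI conjI)
  fix x y assume xy: "x \<in> M" "y \<in> M" "P x y"
  let ?At = "atom x ` T x y" and ?J' = "\<lambda>A. J x {n \<in> T x y. atom x n \<in> A}"
  interpret aj: atomic_joins M P x ?At ?J' by (rule atomic_joins[OF xy(1)])
  have JAt: "?J' ?At = J x (T x y)" by (rule arg_cong[where f = "J x"]) blast
  have at1: "\<And>a. covers M P x a \<Longrightarrow> P a y \<Longrightarrow> a \<in> ?At" and at2: "\<And>a. a \<in> ?At \<Longrightarrow> P a y"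
    using atoms_eq[OF xy(1), of y] by blast+
  show "open_interval_contractible M P x y" if nf: "\<not> facial_interval F P x y"
  proof -
    have J: "J x (T x y) \<noteq> y" using nf facial_interval_iff[OF xy] by blast
    have "x \<noteq> y"
    proof
      assume "x = y"
      then have "P y (J x (T x y))" using C_le_J[OF xy(1) T_uw] by simp
      then show False using J P_antisym J_in_M xy(2) J_T_le[OF xy] by blast
    qed
    then show ?thesis using aj.nonatomic_contractible[OF xy(2,3) at1 at2] J JAt by simp
  qed
  show "open_interval_sphere M P x y (int DIM('a) - 2 - aff_dim G)"
    if G: "G \<in> F" and st: "{D \<in> M. G \<subseteq> D} = interval M P x y" for G
  proof -
    obtain C S where C: "C \<in> M" "S \<subseteq> uw (tp C)" "{D \<in> M. G \<subseteq> D} = interval M P C (J C S)"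
      "aff_dim G = int DIM('a) - int (card S)"
      using facial_form[OF G] by blast
    have "interval M P x y = interval M P C (J C S)" using st C(3) by simp
    then have xC: "x = C" "y = J C S"
      using interval_endpoints[OF xy C(1) J_in_M C_le_J[OF C(1,2)]] by blast+
    then have TS: "T x y = S" using T_J[OF C(1,2)] by simp
    have Sx: "S \<subseteq> uw (tp x)" using C(2) xC by simp
    have y: "J x S = y" using xC by simp
    have finS: "finite S" using Sx finN uw_N finite_subset by metis
    \<comment> \<open>The expected sphere has dimension \<open>card S - 2\<close>; the values
      \<open>- 2\<close> and \<open>- 1\<close> are the conventions for \<open>x = y\<close> and for
      covers.\<close>
    have dim: "int DIM('a) - 2 - aff_dim G = int (card S) - 2" using C(4) by simp
    consider "card S = 0" | "card S = 1" | m where "card S = Suc (Suc m)"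
      by (metis One_nat_def not0_implies_Suc)
    then show ?thesis
    proof cases
      case 1
      then have "S = {}" using finS by simp
      then have "P y x" using J_le_iff[OF xy(1), of "{}" x] y P_refl[OF xy(1)] xy(1) by auto
      then have "x = y" using P_antisym xy by blast
      then show ?thesis unfolding open_interval_sphere_def dim using 1 by simp
    next
      case 2
      then obtain n where n: "S = {n}" by (metis card_1_singletonE)
      have nu: "n \<in> uw (tp x)" using Sx n by simp
      have "P y (atom x n)"
        using J_le_iff[OF xy(1) Sx, of "atom x n"] y n upper_neighbour(1,2)[OF xy(1) nu] P_refl by auto
      moreover have "P (atom x n) y" using atom_le_J[OF xy(1) Sx, of n] n y by simp
      ultimately have "y = atom x n" using P_antisym upper_neighbour(1)[OF xy(1) nu] xy(2) by blast
      then have "covers M P x y" using covers_up[OF xy(1) nu] by simp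
      then show ?thesis unfolding open_interval_sphere_def dim using 2 by (simp add: covers_def)
    next
      case 3
      have "card ?At = card S" unfolding TS
        by (rule card_image) (rule inj_on_subset[OF atom_inj[OF xy(1)] Sx])
      then have cardAt: "card ?At = Suc (Suc m)" using 3 by simp
      have JAy: "?J' ?At = y" using JAt TS y by simp
      have indep: "a \<in> A" if A: "A \<subseteq> ?At" "a \<in> ?At" "P a (?J' A)" for a A
      proof -
        obtain n where n: "n \<in> T x y" "a = atom x n" using A(2) by blast
        have "n \<in> {n \<in> T x y. atom x n \<in> A}"
          by (rule atom_le_J_imp[OF xy(1)]) (use T_uw n A(3) in auto)
        then show ?thesis using n(2) by simp
      qed
      have "order_complex_space P (open_interval M P x y) homotopy_equivalent_space nsphere m"
        by (rule aj.atomic_sphere[OF xy(2,3) at1 at2 JAy cardAt indep])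
      moreover have "x \<noteq> y"
      proof
        assume "x = y"
        obtain n where n: "n \<in> S" using 3 by fastforce
        then have "P (atom x n) x" using atom_le_J[OF xy(1) Sx n] y \<open>x = y\<close> by simp
        then show False using upper_neighbour(1-3)[OF xy(1)] P_antisym[OF xy(1)] n Sx by blast
      qed
      ultimately show ?thesis unfolding open_interval_sphere_def dim using 3 by simp
    qed
  qed
qed

text \<open>Upper facet normals of \<open>C\<close> are facet normals of \<open>tp C\<close>, lower
  ones of \<open>bt C\<close>. These are in general two regions, so independence is obtained for
  each half separately.\<close>

lemma bisimplicial_normals:
  assumes C: "C \<in> M"
  shows "independent {\<nu> \<in> outward_facet_normals C. - \<nu> \<in> N}" "independent {\<nu> \<in> outward_facet_normals C. \<nu> \<in> N}"
proof -
  have t: "tp C \<in> Regs" "bt C \<in> Regs" using tp bt C by auto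
  have "{\<nu> \<in> outward_facet_normals C. - \<nu> \<in> N} \<subseteq> outward_facet_normals (tp C)"
  proof
    fix \<nu> assume v: "\<nu> \<in> {\<nu> \<in> outward_facet_normals C. - \<nu> \<in> N}"
    then have "\<nu> \<notin> lw (bt C)" using lw_N N_minus[of "- \<nu>"] by auto
    then have "- \<nu> \<in> uw (tp C)" using facet_normal_cases[OF C] v by blast
    then show "\<nu> \<in> outward_facet_normals (tp C)" using uw_normal[OF t(1)] by fastforce
  qed
  then show "independent {\<nu> \<in> outward_facet_normals C. - \<nu> \<in> N}"
    using independent_mono simplicial[OF t(1)] by blast
  have "{\<nu> \<in> outward_facet_normals C. \<nu> \<in> N} \<subseteq> outward_facet_normals (bt C)"
  proof
    fix \<nu> assume v: "\<nu> \<in> {\<nu> \<in> outward_facet_normals C. \<nu> \<in> N}"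
    then have "- \<nu> \<notin> uw (tp C)" using uw_N N_minus by auto
    then have "\<nu> \<in> lw (bt C)" using facet_normal_cases[OF C] v by blast
    then show "\<nu> \<in> outward_facet_normals (bt C)" using lw_normal[OF t(2)] by blast
  qed
  then show "independent {\<nu> \<in> outward_facet_normals C. \<nu> \<in> N}"
    using independent_mono simplicial[OF t(2)] by blast
qed

end

section \<open>Translation from hyperplane arrangements\<close>

context normals
begin

definition "chamber z = {x. \<forall>n\<in>N. 0 < (n \<bullet> z) * (n \<bullet> x)}"

lemma chamber_mem: "zer z = {} \<Longrightarrow> z \<in> chamber z"
  unfolding chamber_def zer_def by (auto simp: zero_less_mult_iff)

lemma convex_chamber: "convex (chamber z)"
proof -
  have "chamber z = (\<Inter>n\<in>N. {x. 0 < ((n \<bullet> z) *\<^sub>R n) \<bullet> x})" by (auto simp: chamber_def)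
  also have "convex \<dots>" by (intro convex_INT ballI convex_halfspace_gt)
  finally show ?thesis .
qed

text \<open>Adding a positive multiple of \<open>z\<close> moves any point of the closed cone into
  the open chamber.\<close>

lemma closure_chamber:
  assumes "zer z = {}"
  shows "closure (chamber z) = reg (neg z)"
proof
  have f: "finite (neg z)" "finite (N - neg z)" using finN finite_subset[OF neg_zer(1)] by auto
  have "closed (reg (neg z))"
    unfolding reg_def by (rule polyhedron_imp_closed[OF polyhedron_inequalities[OF f]])
  moreover have "chamber z \<subseteq> reg (neg z)"
  proof
    fix x assume "x \<in> chamber z"
    then have x: "0 < (n \<bullet> z) * (n \<bullet> x)" if "n \<in> N" for n using that by (simp add: chamber_def)
    have "n \<bullet> x \<le> 0" if "n \<in> neg z" for n using x[of n] that by (auto simp: neg_def zero_less_mult_iff)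
    moreover have "0 \<le> n \<bullet> x" if "n \<in> N - neg z" for n using x[of n] that by (auto simp: neg_def zero_less_mult_iff)
    ultimately show "x \<in> reg (neg z)" by (simp add: reg_def)
  qed
  ultimately show "closure (chamber z) \<subseteq> reg (neg z)" by (rule closure_minimal[rotated])
  show "reg (neg z) \<subseteq> closure (chamber z)"
  proof
    fix x assume x: "x \<in> reg (neg z)"
    have "x + t *\<^sub>R z \<in> chamber z" if t: "t > 0" for t
      unfolding chamber_def
    proof (intro CollectI ballI)
      fix n assume n: "n \<in> N"
      have "n \<bullet> z \<noteq> 0" using assms n by (auto simp: zer_def)
      then have "0 < (n \<bullet> z) * (n \<bullet> z)" using not_real_square_gt_zero by blast
      then have "0 < t * ((n \<bullet> z) * (n \<bullet> z))" using t by (rule mult_pos_pos[rotated])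
      moreover have "0 \<le> (n \<bullet> z) * (n \<bullet> x)"
      proof (cases "n \<in> neg z")
        case True
        then show ?thesis using x by (auto simp: reg_def neg_def mult_nonpos_nonpos)
      next
        case False
        then show ?thesis using x n by (auto simp: reg_def neg_def)
      qed
      ultimately show "0 < (n \<bullet> z) * (n \<bullet> (x + t *\<^sub>R z))" by (simp add: inner_add_right algebra_simps)
    qed
    then have ev: "\<forall>\<^sub>F t in at_right 0. x + t *\<^sub>R z \<in> chamber z"
      using eventually_at_right_less[of 0] by (auto elim: eventually_mono)
    have "((\<lambda>t. x + t *\<^sub>R z) \<longlongrightarrow> x + 0 *\<^sub>R z) (at_right 0)" by (intro tendsto_intros)
    then have lim: "((\<lambda>t. x + t *\<^sub>R z) \<longlongrightarrow> x) (at_right 0)" by simp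
    have "\<forall>\<^sub>F t in at_right 0. x + t *\<^sub>R z \<in> closure (chamber z)"
      using ev by (rule eventually_mono) (use closure_subset in blast)
    then show "x \<in> closure (chamber z)"
      using Lim_in_closed_set[OF closed_closure _ _ lim] trivial_limit_at_right_real by blast
  qed
qed

text \<open>By the intermediate value property no normal changes sign on a connected set that avoids
  the hyperplanes; conversely, chambers are convex.\<close>

lemma connected_component_chamber:
  assumes z: "zer z = {}" and S: "S = {x. zer x = {}}"
  shows "connected_component_set S z = chamber z"
proof
  show "connected_component_set S z \<subseteq> chamber z"
  proof
    fix x assume "x \<in> connected_component_set S z"
    then obtain T where T: "connected T" "T \<subseteq> S" "z \<in> T" "x \<in> T" by (auto simp: connected_component_def)
    have nz: "n \<bullet> y \<noteq> 0" if "n \<in> N" "y \<in> T" for n y using T(2) S that by (auto simp: zer_def)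
    have "0 < (n \<bullet> z) * (n \<bullet> x)" if n: "n \<in> N" for n
    proof (rule ccontr)
      assume "\<not> ?thesis"
      then have "(n \<bullet> z \<le> 0 \<and> 0 \<le> n \<bullet> x) \<or> (n \<bullet> x \<le> 0 \<and> 0 \<le> n \<bullet> z)"
        using nz[OF n T(3)] nz[OF n T(4)] by (auto simp: zero_less_mult_iff)
      then have "\<exists>y\<in>T. n \<bullet> y = 0"
        using connected_ivt_hyperplane[OF T(1,3,4), of n 0] connected_ivt_hyperplane[OF T(1,4,3), of n 0] by blast
      then show False using nz[OF n] by blast
    qed
    then show "x \<in> chamber z" by (simp add: chamber_def)
  qed
  have "chamber z \<subseteq> S" unfolding S chamber_def zer_def by auto
  then show "chamber z \<subseteq> connected_component_set S z"
    by (intro connected_component_maximal chamber_mem z convex_connected convex_chamber)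
qed

lemma regions_eq:
  assumes "\<Union>A = {x. zer x \<noteq> {}}"
  shows "regions A = Regs"
proof -
  have S: "- \<Union>A = {x. zer x = {}}" using assms by auto
  have "closure (connected_component_set (- \<Union>A) z) = reg (neg z)" if "z \<in> - \<Union>A" for z
    using connected_component_chamber[OF _ S] closure_chamber that S by simp
  then have "regions A = (\<lambda>z. reg (neg z)) ` (- \<Union>A)"
    unfolding regions_def components_def image_image by (intro image_cong) auto
  then show ?thesis unfolding Regs_def S by auto
qed

text \<open>Write \<open>b x\<close> as \<open>w \<bullet> x\<close>. Its minimum on the sphere is
  at \<open>- w\<close> divided by its norm, and in the interior of the base region every normal is
  positive. For \<open>w = 0\<close> all unit vectors would be minima, among them
  \<open>- n\<close>, which is not in the base region.\<close>

lemma min_in_interior_neg: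
  assumes b: "min_in_interior (reg (neg \<beta>)) b" and n: "n \<in> N"
  shows "b n < 0"
proof -
  have lin: "linear b" and sub: "{x \<in> sphere 0 1. \<forall>y\<in>sphere 0 1. b x \<le> b y} \<subseteq> interior (reg (neg \<beta>))"
    using b by (auto simp: min_in_interior_def)
  define w where "w = adjoint b 1"
  have w: "b x = w \<bullet> x" for x
    using adjoint_works[OF lin, of x 1] by (simp add: w_def inner_commute)
  have inB: "0 \<le> n \<bullet> x" if "x \<in> reg (neg \<beta>)" for x
    using that n by (simp add: reg_def neg_zer_base)
  have inI: "0 < n \<bullet> x" if x: "x \<in> interior (reg (neg \<beta>))" for x
  proof -
    obtain e where e: "e > 0" "ball x e \<subseteq> reg (neg \<beta>)" using x by (auto simp: mem_interior)
    have "x - (e / 2) *\<^sub>R n \<in> ball x e" using e(1) unit[OF n] by (simp add: dist_norm)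
    then have "0 \<le> n \<bullet> (x - (e / 2) *\<^sub>R n)" using inB e(2) by blast
    moreover have "n \<bullet> n = 1" using unit[OF n] by (simp add: dot_square_norm)
    ultimately show ?thesis using e(1) by (simp add: inner_diff_right)
  qed
  show ?thesis
  proof (cases "w = 0")
    case True
    have "- n \<in> {x \<in> sphere 0 1. \<forall>y\<in>sphere 0 1. b x \<le> b y}" using unit[OF n] w True by simp
    then have "0 < n \<bullet> - n" using inI sub by blast
    then show ?thesis using inner_ge_zero[of n] by (simp del: inner_ge_zero)
  next
    case False
    let ?x = "- (1 / norm w) *\<^sub>R w"
    have wx: "w \<bullet> ?x = - norm w" using False by (simp add: dot_square_norm power2_eq_square)
    have "b ?x \<le> b y" if "y \<in> sphere 0 1" for y
    proof -
      have "\<bar>w \<bullet> y\<bar> \<le> norm w * norm y" by (rule Cauchy_Schwarz_ineq2)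
      then show ?thesis unfolding w wx using that by auto
    qed
    then have "?x \<in> {x \<in> sphere 0 1. \<forall>y\<in>sphere 0 1. b x \<le> b y}" using False by simp
    then have "0 < n \<bullet> ?x" using inI sub by blast
    then have "(1 / norm w) * (n \<bullet> w) < 0" by simp
    then have "n \<bullet> w < 0" using False by (simp add: divide_less_0_iff)
    then show ?thesis by (simp add: w inner_commute)
  qed
qed

end

lemma ex_oriented_normals:
  fixes A :: "'a::euclidean_space set set"
  assumes A: "central_arrangement A" and \<beta>: "\<beta> \<notin> \<Union>A"
  defines "N \<equiv> {n. norm n = 1 \<and> {x. n \<bullet> x = 0} \<in> A \<and> 0 < n \<bullet> \<beta>}"
  shows "normals N \<beta>" "(\<lambda>n. {x. n \<bullet> x = 0}) ` N = A" "inj_on (\<lambda>n. {x. n \<bullet> x = 0}) N"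
proof -
  show inj: "inj_on (\<lambda>n. {x. n \<bullet> x = 0}) N"
  proof (rule inj_onI)
    fix m n assume mn: "m \<in> N" "n \<in> N" "{x. m \<bullet> x = 0} = {x. n \<bullet> x = 0}"
    have "n = m \<or> n = - m" by (rule unit_normals_eq) (use mn in \<open>auto simp: N_def\<close>)
    then show "m = n" using mn(1,2) by (auto simp: N_def)
  qed
  show im: "(\<lambda>n. {x. n \<bullet> x = 0}) ` N = A"
  proof
    show "A \<subseteq> (\<lambda>n. {x. n \<bullet> x = 0}) ` N"
    proof
      fix H assume H: "H \<in> A"
      then obtain a where a: "a \<noteq> 0" "H = {x. a \<bullet> x = 0}" using A by (auto simp: central_arrangement_def)
      have ab: "a \<bullet> \<beta> \<noteq> 0" using \<beta> H a(2) by blast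
      define n where "n = (sgn (a \<bullet> \<beta>) / norm a) *\<^sub>R a"
      have s: "sgn (a \<bullet> \<beta>) / norm a \<noteq> 0" using a(1) ab by (simp add: sgn_zero_iff)
      have "{x. n \<bullet> x = 0} = H" using s a(2) by (auto simp: n_def)
      moreover have "norm n = 1" using a(1) ab by (simp add: n_def abs_sgn_eq)
      moreover have "0 < n \<bullet> \<beta>"
      proof -
        have "n \<bullet> \<beta> = \<bar>a \<bullet> \<beta>\<bar> / norm a" by (simp add: n_def abs_sgn mult.commute)
        then show ?thesis using a(1) ab by simp
      qed
      ultimately show "H \<in> (\<lambda>n. {x. n \<bullet> x = 0}) ` N" using H by (auto simp: N_def)
    qed
  qed (auto simp: N_def)
  have "finite A" using A by (simp add: central_arrangement_def)
  then have "finite N" using inj im finite_image_iff by blast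
  then show "normals N \<beta>" by unfold_locales (auto simp: N_def)
qed

context region_lattice
begin

text \<open>Distinct classes have distinct cones, so the class of a region can be replaced by its
  cone throughout.\<close>

lemma region_conesI:
  assumes P': "\<And>R R'. R \<in> Regs \<Longrightarrow> R' \<in> Regs \<Longrightarrow> P' (D (k R)) (D (k R')) \<longleftrightarrow> P (k R) (k R')"
  shows "region_cones N \<beta> le (\<lambda>R. D (k R)) P'"
proof -
  have inj: "D (k R) = D (k R') \<longleftrightarrow> k R = k R'" if "R \<in> Regs" "R' \<in> Regs" for R R'
    using D_inj that by auto
  have "lattice_quotient Regs le (\<lambda>R. D (k R)) P'"
  proof
    show "finite Regs" by (rule fin)
    show "lattice_on Regs le" by (rule lat)
    show "D (k (jn x z)) = D (k (jn y z))" "D (k (mt x z)) = D (k (mt y z))"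
      if "x \<in> Regs" "y \<in> Regs" "z \<in> Regs" "D (k x) = D (k y)" for x y z
      using join_cong[OF that(1-3)] meet_cong[OF that(1-3)] inj[OF that(1,2)] that(4) by auto
    show "P' (D (k x)) (D (k y)) \<longleftrightarrow> (\<exists>x'\<in>Regs. \<exists>y'\<in>Regs. D (k x') = D (k x) \<and> D (k y') = D (k y) \<and> le x' y')"
      if "x \<in> Regs" "y \<in> Regs" for x y
      unfolding P'[OF that] P_eq[OF that] using inj that by (intro bex_cong refl) simp
  qed
  then interpret c: region_lattice N \<beta> le "\<lambda>R. D (k R)" P'
    using le_iff normals_axioms unfolding region_lattice_def region_lattice_axioms_def by blast
  show ?thesis
  proof
    show "D (k R) = c.D (D (k R))" if "R \<in> Regs" for R
    proof -
      have "{R' \<in> Regs. D (k R') = D (k R)} = {R' \<in> Regs. k R' = k R}" using inj that by blast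
      then show ?thesis unfolding c.D_def by (simp add: D_def)
    qed
  qed
qed

end

text \<open>A functional \<open>a\<close> with the same kernel as the unit normal \<open>n\<close>
  is a multiple of it, and \<open>\<beta>\<close> forces the factor to be positive.\<close>

lemma sep_set_eq:
  fixes A :: "'a::euclidean_space set set"
  assumes "normals N \<beta>" "(\<lambda>n. {x. n \<bullet> x = 0}) ` N = A" "\<beta> \<in> B" "B \<subseteq> {x. \<forall>n\<in>N. 0 \<le> n \<bullet> x}"
  shows "sep_set A B R = (\<lambda>n. {x. n \<bullet> x = 0}) ` normals.sg N R"
proof -
  interpret normals N \<beta> by (rule assms)
  show ?thesis
  proof
    show "sep_set A B R \<subseteq> (\<lambda>n. {x. n \<bullet> x = 0}) ` sg R"
    proof
      fix H assume "H \<in> sep_set A B R"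
      then obtain a where a: "H \<in> A" "H = {x. a \<bullet> x = 0}" "R \<subseteq> {x. a \<bullet> x \<le> 0}" "B \<subseteq> {x. 0 \<le> a \<bullet> x}"
        by (auto simp: sep_set_def)
      obtain n where n: "n \<in> N" "H = {x. n \<bullet> x = 0}" using a(1) assms(2) by blast
      have nn: "n \<bullet> n = 1" using unit[OF n(1)] by (simp add: dot_square_norm)
      have same: "a \<bullet> x = 0 \<longleftrightarrow> n \<bullet> x = 0" for x using a(2) n(2) by blast
      have a_eq: "a \<bullet> x = (a \<bullet> n) * (n \<bullet> x)" for x
      proof -
        have "n \<bullet> (x - (n \<bullet> x) *\<^sub>R n) = 0" by (simp add: inner_diff_right nn)
        then have "a \<bullet> (x - (n \<bullet> x) *\<^sub>R n) = 0" using same by blast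
        then show ?thesis by (simp add: inner_diff_right)
      qed
      have "0 \<le> (a \<bullet> n) * (n \<bullet> \<beta>)" using a(4) assms(3) a_eq[of \<beta>] by auto
      then have "0 \<le> a \<bullet> n" using pos[OF n(1)] by (simp add: zero_le_mult_iff)
      moreover have "a \<bullet> n \<noteq> 0" using same[of n] nn by simp
      ultimately have "0 < a \<bullet> n" by simp
      then have "n \<bullet> x \<le> 0" if "x \<in> R" for x using a(3) that a_eq[of x] by (auto simp: mult_le_0_iff)
      then show "H \<in> (\<lambda>n. {x. n \<bullet> x = 0}) ` sg R" using n by (auto simp: sg_def)
    qed
    show "(\<lambda>n. {x. n \<bullet> x = 0}) ` sg R \<subseteq> sep_set A B R"
    proof clarify
      fix n assume n: "n \<in> sg R"
      then have "n \<in> N" "\<forall>x\<in>R. n \<bullet> x \<le> 0" by (auto simp: sg_def)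
      then show "{x. n \<bullet> x = 0} \<in> sep_set A B R"
        unfolding sep_set_def using assms(2,4) by (intro CollectI conjI exI[of _ n]) auto
    qed
  qed
qed

lemma lattice_quotient_classes:
  assumes "finite X" "lattice_on X le" "lattice_congruence X le Th"
  shows "lattice_quotient X le (\<lambda>x. Th `` {x}) (quot_le le)"
proof
  have eq: "equiv X Th" using assms(3) by (simp add: lattice_congruence_def)
  have cls: "Th `` {x} = Th `` {y} \<longleftrightarrow> (x, y) \<in> Th" if "x \<in> X" "y \<in> X" for x y
    using eq_equiv_class_iff[OF eq that] .
  have sub: "x \<in> X \<and> y \<in> X" if "(x, y) \<in> Th" for x y
    using eq that by (auto simp: equiv_def refl_on_def)
  show "finite X" "lattice_on X le" by fact+
  show "Th `` {ljoin X le x z} = Th `` {ljoin X le y z}" "Th `` {lmeet X le x z} = Th `` {lmeet X le y z}"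
    if h: "x \<in> X" "y \<in> X" "z \<in> X" "Th `` {x} = Th `` {y}" for x y z
  proof -
    have "(x, y) \<in> Th" using cls h by blast
    then have "(ljoin X le x z, ljoin X le y z) \<in> Th" "(lmeet X le x z, lmeet X le y z) \<in> Th"
      using assms(3) h(3) unfolding lattice_congruence_def by blast+
    then show "Th `` {ljoin X le x z} = Th `` {ljoin X le y z}" "Th `` {lmeet X le x z} = Th `` {lmeet X le y z}"
      using equiv_class_eq[OF eq] by blast+
  qed
  show "quot_le le (Th `` {x}) (Th `` {y}) \<longleftrightarrow>
      (\<exists>x'\<in>X. \<exists>y'\<in>X. Th `` {x'} = Th `` {x} \<and> Th `` {y'} = Th `` {y} \<and> le x' y')"
    if h: "x \<in> X" "y \<in> X" for x y
  proof -
    have "x' \<in> Th `` {x} \<longleftrightarrow> x' \<in> X \<and> Th `` {x'} = Th `` {x}" for x'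
      using cls[OF h(1), of x'] sub[of x x'] by auto
    moreover have "y' \<in> Th `` {y} \<longleftrightarrow> y' \<in> X \<and> Th `` {y'} = Th `` {y}" for y'
      using cls[OF h(2), of y'] sub[of y y'] by auto
    ultimately show ?thesis unfolding quot_le_def by blast
  qed
qed

theorem theorem5p1:
  fixes A :: "'a::euclidean_space set set" and B :: "'a set" and Th :: "('a set \<times> 'a set) set"
  assumes "central_arrangement A"
    and "B \<in> regions A"
    and "lattice_on (regions A) (region_le A B)"
    and "lattice_congruence (regions A) (region_le A B) Th"
  shows "\<exists>F :: 'a set set. \<exists>\<phi> :: 'a set set \<Rightarrow> 'a set.
     complete_fan F \<and> refined_by F (arrangement_fan A) \<and>
     bij_betw \<phi> (regions A // Th) (max_cones F) \<and>
     (let P = (\<lambda>C1 C2. \<exists>X\<in>regions A // Th. \<exists>Y\<in>regions A // Th.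
                 \<phi> X = C1 \<and> \<phi> Y = C2 \<and> quot_le (region_le A B) X Y) in
        fan_lattice F P \<and>
        (\<forall>b. min_in_interior B b \<longrightarrow> induced_by F P b) \<and>
        (\<forall>L. linear_extension (regions A // Th) (quot_le (region_le A B)) L \<longrightarrow>
               shell (sphere_dim F) (map \<phi> L)) \<and>
        (simplicial_arrangement A \<longrightarrow>
           homotopy_facial F P \<and> atomic_facial F P \<and>
           (\<forall>b. min_in_interior B b \<longrightarrow> bisimplicial F P b)))"
proof -
  obtain U where U: "U \<in> components (- \<Union>A)" "B = closure U" using assms(2) by (auto simp: regions_def)
  obtain \<beta> where \<beta>U: "\<beta> \<in> U" using in_components_nonempty[OF U(1)] by blast
  then have \<beta>: "\<beta> \<notin> \<Union>A" using in_components_subset[OF U(1)] by blast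
  define N where "N = {n. norm n = 1 \<and> {x. n \<bullet> x = 0} \<in> A \<and> 0 < n \<bullet> \<beta>}"
  note N = ex_oriented_normals[OF assms(1) \<beta>, folded N_def]
  interpret nl: normals N \<beta> by (rule N(1))
  have "x \<in> \<Union>A \<longleftrightarrow> nl.zer x \<noteq> {}" for x
    unfolding nl.zer_def N(2)[symmetric] by auto
  then have UA: "\<Union>A = {x. nl.zer x \<noteq> {}}" by blast
  have reg: "regions A = nl.Regs" using nl.regions_eq[OF UA] .
  have "U = connected_component_set (- \<Union>A) \<beta>"
    using U(1) \<beta>U by (metis componentsE connected_component_eq)
  moreover have "- \<Union>A = {x. nl.zer x = {}}" using UA by auto
  ultimately have "U = nl.chamber \<beta>" using nl.connected_component_chamber nl.neg_zer_base(2) by metis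
  then have B: "B = nl.reg (nl.neg \<beta>)" using U(2) nl.closure_chamber[OF nl.neg_zer_base(2)] by simp
  have \<beta>B: "\<beta> \<in> B" using \<beta>U U(2) closure_subset by blast
  have BN: "B \<subseteq> {x. \<forall>n\<in>N. 0 \<le> n \<bullet> x}" unfolding B nl.reg_def nl.neg_zer_base by auto
  let ?le = "region_le A B" and ?cls = "\<lambda>R. Th `` {R}"
  have le: "?le R R' \<longleftrightarrow> nl.sg R \<subseteq> nl.sg R'" for R R'
    unfolding region_le_def sep_set_eq[OF N(1,2) \<beta>B BN] using inj_on_image_subset_iff[OF N(3) nl.sg_N nl.sg_N] .
  interpret q: lattice_quotient nl.Regs ?le ?cls "quot_le ?le"
    using lattice_quotient_classes[OF nl.finite_Regs] assms(3,4) unfolding reg by blast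
  interpret q: region_lattice N \<beta> ?le ?cls "quot_le ?le"
    by unfold_locales (rule le)
  have Q: "regions A // Th = q.M" unfolding q.M_def reg by (auto simp: quotient_def)
  have eqv: "equiv nl.Regs Th" using assms(4) unfolding reg lattice_congruence_def by blast
  \<comment> \<open>A class is itself a set of regions, so its cone is its union; hence
    \<open>Union\<close> serves as \<open>\<phi>\<close>.\<close>
  have DU: "q.D X = \<Union>X" if X: "X \<in> q.M" for X
  proof -
    obtain R where R: "R \<in> nl.Regs" "X = ?cls R" using X by (rule q.M_cases)
    have "{R' \<in> nl.Regs. ?cls R' = X} = X"
    proof (intro set_eqI iffI)
      fix R' assume "R' \<in> {R' \<in> nl.Regs. ?cls R' = X}"
      then show "R' \<in> X" using equiv_class_self[OF eqv, of R'] by blast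
    next
      fix R' assume "R' \<in> X"
      then have h: "(R, R') \<in> Th" using R(2) by blast
      then have "R' \<in> nl.Regs" using eqv unfolding equiv_def refl_on_def by blast
      then show "R' \<in> {R' \<in> nl.Regs. ?cls R' = X}" using equiv_class_eq[OF eqv h] R(2) by simp
    qed
    then show ?thesis unfolding q.D_def by simp
  qed
  have inj: "inj_on Union q.M"
  proof (rule inj_onI)
    show "X = Y" if "X \<in> q.M" "Y \<in> q.M" "\<Union>X = \<Union>Y" for X Y
      using q.D_inj[OF that(1,2)] DU[OF that(1)] DU[OF that(2)] that(3) by simp
  qed
  define P where "P = (\<lambda>C1 C2. \<exists>X\<in>regions A // Th. \<exists>Y\<in>regions A // Th.
                 \<Union>X = C1 \<and> \<Union>Y = C2 \<and> quot_le ?le X Y)"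
  have P_iff: "P (\<Union>X) (\<Union>Y) \<longleftrightarrow> quot_le ?le X Y" if X: "X \<in> q.M" and Y: "Y \<in> q.M" for X Y
  proof
    assume "P (\<Union>X) (\<Union>Y)"
    then obtain X' Y' where h: "X' \<in> q.M" "Y' \<in> q.M" "\<Union>X' = \<Union>X" "\<Union>Y' = \<Union>Y" "quot_le ?le X' Y'"
      unfolding P_def Q by blast
    have "X' = X" "Y' = Y" using inj_onD[OF inj h(3,1) X] inj_onD[OF inj h(4,2) Y] by blast+
    then show "quot_le ?le X Y" using h(5) by simp
  qed (use X Y in \<open>auto simp: P_def Q\<close>)
  have rc: "region_cones N \<beta> ?le (\<lambda>R. q.D (?cls R)) P"
  proof (rule q.region_conesI)
    show "P (q.D (?cls R)) (q.D (?cls R')) \<longleftrightarrow> quot_le ?le (?cls R) (?cls R')"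
      if "R \<in> nl.Regs" "R' \<in> nl.Regs" for R R'
      using that P_iff[of "?cls R" "?cls R'"] DU q.k_in_M by simp
  qed
  interpret c: region_cones N \<beta> ?le "\<lambda>R. q.D (?cls R)" P by (rule rc)
  have MU: "c.M = Union ` q.M" unfolding c.M_def q.M_def image_image using DU q.k_in_M by (intro image_cong) auto
  have bij: "bij_betw Union (regions A // Th) (max_cones c.F)"
    unfolding Q c.max_cones_F MU using inj by (rule inj_on_imp_bij_betw)
  have refined: "refined_by c.F (arrangement_fan A)"
    using c.refined unfolding arrangement_fan_def reg .
  have bneg: "b n < 0" if "min_in_interior B b" "n \<in> N" for b n
    using nl.min_in_interior_neg that unfolding B by blast
  have lin: "b (- x) = - b x" if "min_in_interior B b" for b x
    using that linear_neg unfolding min_in_interior_def by blast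
  have induced: "induced_by c.F P b" if b: "min_in_interior B b" for b
    unfolding induced_by_def c.max_cones_F
  proof (intro allI impI)
    fix C1 C2 \<nu> assume "covers c.M P C1 C2"
      "norm \<nu> = 1 \<and> C1 \<subseteq> {x. \<nu> \<bullet> x \<le> 0} \<and> C2 \<subseteq> {x. 0 \<le> \<nu> \<bullet> x}"
    \<comment> \<open>Normals in \<open>N\<close> point to the side of the base region, where
      \<open>b\<close> is least, so \<open>b\<close> is negative on them.\<close>
    then have "- \<nu> \<in> N" using c.separating_normal_of_cover by blast
    then show "0 < b \<nu>" using bneg[OF b] lin[OF b] by fastforce
  qed
  have shelling: "shell (sphere_dim c.F) (map Union L)"
    if L: "linear_extension (regions A // Th) (quot_le ?le) L" for L
  proof (rule c.shelling)
    have L': "distinct L" "set L = q.M"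
      "\<And>i j. i < length L \<Longrightarrow> j < length L \<Longrightarrow> quot_le ?le (L ! i) (L ! j) \<Longrightarrow> i \<le> j"
      using L unfolding linear_extension_def Q by auto
    have "i \<le> j" if "i < length L" "j < length L" "P (\<Union>(L ! i)) (\<Union>(L ! j))" for i j
    proof -
      have "L ! i \<in> q.M" "L ! j \<in> q.M" using L'(2) that nth_mem by blast+
      then show ?thesis using P_iff that L'(3) by blast
    qed
    then show "linear_extension c.M P (map Union L)"
      unfolding linear_extension_def MU using L'(1,2) inj by (simp add: distinct_map)
  qed
  have simplicial: "homotopy_facial c.F P \<and> atomic_facial c.F P \<and> (\<forall>b. min_in_interior B b \<longrightarrow> bisimplicial c.F P b)"
    if "simplicial_arrangement A"
  proof -
    have s: "simplicial_region_cones N \<beta> ?le (\<lambda>R. q.D (?cls R)) P"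
      using rc that unfolding simplicial_region_cones_def simplicial_region_cones_axioms_def
        simplicial_arrangement_def reg by blast
    interpret s: simplicial_region_cones N \<beta> ?le "\<lambda>R. q.D (?cls R)" P by (rule s)
    have "bisimplicial c.F P b" if b: "min_in_interior B b" for b
      unfolding bisimplicial_def c.max_cones_F
    proof (intro conjI ballI induced[OF b])
      fix C assume C: "C \<in> c.M"
      have or: "- \<nu> \<in> N \<or> \<nu> \<in> N" if "\<nu> \<in> outward_facet_normals C" for \<nu>
        using c.facet_normal_cases[OF C that] c.uw_N c.lw_N by blast
      \<comment> \<open>Because \<open>b\<close> is negative on \<open>N\<close>, its sign on a
        facet normal tells upper walls from lower ones.\<close>
      have "{\<nu> \<in> outward_facet_normals C. 0 < b \<nu>} \<subseteq> {\<nu> \<in> outward_facet_normals C. - \<nu> \<in> N}"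
        using or bneg[OF b] by force
      then show "independent {\<nu> \<in> outward_facet_normals C. 0 < b \<nu>}"
        using independent_mono s.bisimplicial_normals(1)[OF C] by blast
      have "{\<nu> \<in> outward_facet_normals C. b \<nu> < 0} \<subseteq> {\<nu> \<in> outward_facet_normals C. \<nu> \<in> N}"
        using or bneg[OF b] lin[OF b] by force
      then show "independent {\<nu> \<in> outward_facet_normals C. b \<nu> < 0}"
        using independent_mono s.bisimplicial_normals(2)[OF C] by blast
    qed
    then show ?thesis using s.homotopy_facial_F s.atomic_facial_F by blast
  qed
  show ?thesis
    unfolding Let_def
    by (intro exI[of _ c.F] exI[of _ Union] conjI allI impI c.complete_F refined bij;
      (unfold P_def[symmetric])?; use c.fan_lattice_F induced shelling simplicial in blast)
qed

end
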